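(* Let $\sigma>0$ and $\lambda\in\mathcal D$. For every starting pair $(t,x)$, $t\ge0$, $x\in\mathbb R$, and every finite $T\geq t$, the process $(Z_{t,s})_{s\in[t,T]}$ is a true $\mathbb P^{t,x}$-martingale, $\mathbb E^{t,x}[Z_{t,T}]=1$, and $Z_{t,T}>0$ almost surely. Consequently $$\frac{\mathrm d\mathbb Q^{t,x}}{\mathrm d\mathbb P^{t,x}}\Big|_{\mathcal F_s}=Z_{t,s}$$ defines a probability measure $\mathbb Q^{t,x}$ equivalent to $\mathbb P^{t,x}$ on $\mathcal F_T$, and under $\mathbb Q^{t,x}$, $$\mathrm dX_s=\sigma\,\mathrm dW^{\mathbb Q}_s,\qquad X_s=x+\sigma W^{\mathbb Q}_s,\qquad s\in[t,T],$$ where $W^{\mathbb Q}$ is a Brownian motion under $\mathbb Q^{t,x}$ with $W^{\mathbb Q}_t=0$.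
   Context: $(\Omega,\mathcal F,(\mathcal F_t)_{t\ge0},\mathbb P)$ is a filtered probability space satisfying the usual conditions and carrying a standard one-dimensional Brownian motion $W$. Class $\mathcal D$: all $\lambda\in C^1(\mathbb R)$ that are strictly decreasing with $\lambda(\theta)=0$ for some (unique) $\theta\in\mathbb R$. For $\lambda\in\mathcal D$ the SDE $\mathrm dX_s=\lambda(X_s)\,\mathrm ds+\sigma\,\mathrm dW_s$ has a unique non-explosive strong solution; $\mathbb P^{t,x}$ (with expectation $\mathbb E^{t,x}$) is the law under which it starts from $X_t=x$. With $\eta=\lambda/\sigma$, for $t\le s\le T$, $$Z_{t,s}:=\exp\Big(-\int_t^s\eta(X_r)\,\mathrm dW_r-\frac12\int_t^s\eta(X_r)^2\,\mathrm dr\Big).$$ *)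

theory Defs
  imports "HOL-Probability.Probability"
begin

text \<open>
  Time is modelled by \<^typ>\<open>real\<close>, but only times in \<open>[0,\<infinity>)\<close> matter: precomposing \<open>F\<close> with
  \<open>max 0\<close> makes the library notion of a filtration ignore \<open>F s\<close> for negative \<open>s\<close>.
\<close>
locale usual_filtered_prob_space =
  prob_space M + complete_measure M + filtration "space M" "\<lambda>s. F (max 0 s)"
  for M :: "'a measure" and F :: "real \<Rightarrow> 'a measure" +
  assumes subalgebra_F: "0 \<le> s \<Longrightarrow> subalgebra M (F s)"
    and null_sets_F0: "null_sets M \<subseteq> sets (F 0)"
    and right_continuous_F: "0 \<le> s \<Longrightarrow> (\<Inter>u\<in>{s<..}. sets (F u)) = sets (F s)"

text \<open>
  Standard Brownian motion relative to \<open>F\<close> with time set \<open>J\<close> (an interval with left end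
  point \<open>a\<close>), started from \<open>0\<close> at time \<open>a\<close>. Path properties are required almost surely.
\<close>
definition brownian_motion ::
    "'a measure \<Rightarrow> (real \<Rightarrow> 'a measure) \<Rightarrow> real \<Rightarrow> real set \<Rightarrow> (real \<Rightarrow> 'a \<Rightarrow> real) \<Rightarrow> bool" where
  "brownian_motion M F a J B \<longleftrightarrow>
     (\<forall>s\<in>J. B s \<in> borel_measurable (F s)) \<and>
     (AE \<omega> in M. B a \<omega> = 0) \<and>
     (AE \<omega> in M. continuous_on J (\<lambda>s. B s \<omega>)) \<and>
     (\<forall>r\<in>J. \<forall>s\<in>J. r < s \<longrightarrow>
        distributed M lborel (\<lambda>\<omega>. B s \<omega> - B r \<omega>) (normal_density 0 (sqrt (s - r))) \<and>
        prob_space.indep_set M (sets (F r))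
          {(\<lambda>\<omega>. B s \<omega> - B r \<omega>) -` A \<inter> space M | A. A \<in> sets borel})"

definition martingale ::
    "'a measure \<Rightarrow> (real \<Rightarrow> 'a measure) \<Rightarrow> real set \<Rightarrow> (real \<Rightarrow> 'a \<Rightarrow> real) \<Rightarrow> bool" where
  "martingale M F J Z \<longleftrightarrow>
     (\<forall>s\<in>J. Z s \<in> borel_measurable (F s) \<and> integrable M (Z s)) \<and>
     (\<forall>r\<in>J. \<forall>s\<in>J. r \<le> s \<longrightarrow> (AE \<omega> in M. real_cond_exp M (F r) (Z s) \<omega> = Z r \<omega>))"

definition class_D :: "(real \<Rightarrow> real) set" where
  "class_D = {l. l C1_differentiable_on UNIV \<and> strict_antimono_on UNIV l \<and> (\<exists>\<theta>. l \<theta> = 0)}"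

text \<open>
  \<open>X\<close> solves \<open>dX = b(X) ds + \<sigma> dW\<close> on the time set \<open>J\<close> (an interval with left end point \<open>t\<close>)
  with \<open>X = x\<close> at time \<open>t\<close>. The noise coefficient being constant, the stochastic integral of
  \<open>\<sigma>\<close> over \<open>[t,s]\<close> is \<open>\<sigma> (W s - W t)\<close>.
\<close>
definition sde_solution ::
    "'a measure \<Rightarrow> (real \<Rightarrow> 'a measure) \<Rightarrow> (real \<Rightarrow> 'a \<Rightarrow> real) \<Rightarrow> (real \<Rightarrow> real) \<Rightarrow> real \<Rightarrow>
     real \<Rightarrow> real \<Rightarrow> real set \<Rightarrow> (real \<Rightarrow> 'a \<Rightarrow> real) \<Rightarrow> bool" where
  "sde_solution M F W b \<sigma> t x J X \<longleftrightarrow>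
     (\<forall>s\<in>J. X s \<in> borel_measurable (F s)) \<and>
     (AE \<omega> in M. continuous_on J (\<lambda>s. X s \<omega>)) \<and>
     (AE \<omega> in M. \<forall>s\<in>J. X s \<omega> = x + (LBINT r:{t..s}. b (X r \<omega>)) + \<sigma> * (W s \<omega> - W t \<omega>))"

text \<open>
  The Ito integral on \<open>[t,T]\<close>. The data \<open>(k, a, \<xi>)\<close> encode the simple predictable process
  whose value on \<open>(a i, a (i+1)]\<close> is \<open>\<xi> i\<close>, for \<open>i < k\<close>.
\<close>
definition simple_data ::
    "(real \<Rightarrow> 'a measure) \<Rightarrow> real \<Rightarrow> real \<Rightarrow> nat \<Rightarrow> (nat \<Rightarrow> real) \<Rightarrow> (nat \<Rightarrow> 'a \<Rightarrow> real) \<Rightarrow> bool" where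
  "simple_data F t T k a \<xi> \<longleftrightarrow>
     a 0 = t \<and> a k = T \<and>
     (\<forall>i<k. a i \<le> a (Suc i) \<and> \<xi> i \<in> borel_measurable (F (a i)) \<and>
        (\<exists>C. \<forall>\<omega>\<in>space (F (a i)). \<bar>\<xi> i \<omega>\<bar> \<le> C))"

definition simple_process ::
    "nat \<Rightarrow> (nat \<Rightarrow> real) \<Rightarrow> (nat \<Rightarrow> 'a \<Rightarrow> real) \<Rightarrow> real \<Rightarrow> 'a \<Rightarrow> real" where
  "simple_process k a \<xi> r \<omega> = (\<Sum>i<k. \<xi> i \<omega> * indicator {a i<..a (Suc i)} r)"

definition simple_integral ::
    "(real \<Rightarrow> 'a \<Rightarrow> real) \<Rightarrow> nat \<Rightarrow> (nat \<Rightarrow> real) \<Rightarrow> (nat \<Rightarrow> 'a \<Rightarrow> real) \<Rightarrow> real \<Rightarrow> 'a \<Rightarrow> real" where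
  "simple_integral W k a \<xi> s \<omega> =
     (\<Sum>i<k. \<xi> i \<omega> * (W (min s (a (Suc i))) \<omega> - W (min s (a i)) \<omega>))"

definition converges_in_prob ::
    "'a measure \<Rightarrow> (nat \<Rightarrow> 'a \<Rightarrow> real) \<Rightarrow> ('a \<Rightarrow> real) \<Rightarrow> bool" where
  "converges_in_prob M Y L \<longleftrightarrow>
     (\<forall>n. Y n \<in> borel_measurable M) \<and> L \<in> borel_measurable M \<and>
     (\<forall>\<epsilon>>0. (\<lambda>n. measure M {\<omega>\<in>space M. \<epsilon> < \<bar>Y n \<omega> - L \<omega>\<bar>}) \<longlonglongrightarrow> 0)"

text \<open>
  \<open>I s\<close> is a version of the integral of \<open>H\<close> against \<open>W\<close> over \<open>[t,s]\<close>, for \<open>s \<in> [t,T]\<close>, where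
  \<open>H\<close> is almost surely square integrable on \<open>[t,T]\<close>: \<open>I\<close> is adapted, almost surely
  continuous, and a limit in probability of integrals of simple processes that approximate \<open>H\<close>
  in \<open>L\<^sup>2([t,T])\<close> in probability. This determines \<open>I\<close> up to indistinguishability.
\<close>
definition is_ito_integral ::
    "'a measure \<Rightarrow> (real \<Rightarrow> 'a measure) \<Rightarrow> (real \<Rightarrow> 'a \<Rightarrow> real) \<Rightarrow> real \<Rightarrow> real \<Rightarrow>
     (real \<Rightarrow> 'a \<Rightarrow> real) \<Rightarrow> (real \<Rightarrow> 'a \<Rightarrow> real) \<Rightarrow> bool" where
  "is_ito_integral M F W t T H I \<longleftrightarrow>
     (AE \<omega> in M. set_integrable lborel {t..T} (\<lambda>r. H r \<omega>) \<and>
                 set_integrable lborel {t..T} (\<lambda>r. (H r \<omega>)\<^sup>2)) \<and>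
     (\<forall>s\<in>{t..T}. I s \<in> borel_measurable (F s)) \<and>
     (AE \<omega> in M. continuous_on {t..T} (\<lambda>s. I s \<omega>)) \<and>
     (\<exists>k a \<xi>. (\<forall>n. simple_data F t T (k n) (a n) (\<xi> n)) \<and>
        converges_in_prob M
          (\<lambda>n \<omega>. LBINT r:{t..T}. (simple_process (k n) (a n) (\<xi> n) r \<omega> - H r \<omega>)\<^sup>2) (\<lambda>_. 0) \<and>
        (\<forall>s\<in>{t..T}. converges_in_prob M (\<lambda>n. simple_integral W (k n) (a n) (\<xi> n) s) (I s)))"

text \<open>The process \<open>Z\<close>, where \<open>I\<close> is a version of the stochastic integral of \<open>\<eta>(X)\<close> from \<open>t\<close>.\<close>
definition exp_density ::
    "(real \<Rightarrow> real) \<Rightarrow> (real \<Rightarrow> 'a \<Rightarrow> real) \<Rightarrow> (real \<Rightarrow> 'a \<Rightarrow> real) \<Rightarrow> real \<Rightarrow> real \<Rightarrow> 'a \<Rightarrow> real" where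
  "exp_density \<eta> X I t s \<omega> = exp (- I s \<omega> - 1 / 2 * (LBINT r:{t..s}. (\<eta> (X r \<omega>))\<^sup>2))"

definition measure_change ::
    "'a measure \<Rightarrow> (real \<Rightarrow> 'a measure) \<Rightarrow> real \<Rightarrow> (real \<Rightarrow> 'a \<Rightarrow> real) \<Rightarrow> 'a measure" where
  "measure_change M F s Z = density (restr_to_subalg M (F s)) (\<lambda>\<omega>. ennreal (Z s \<omega>))"

end

theory Submission
  imports Defs
begin

text \<open>
  Girsanov's identity for simple integrands \<open>\<xi>\<close> is a Gaussian computation: the density
  \<open>exp (- \<integral> \<xi> dW - 1/2 \<integral> \<xi>\<^sup>2 ds)\<close> is a martingale and turns \<open>W + \<integral> \<xi> ds\<close> into a Brownian
  motion. For the simple processes approximating \<open>\<eta>(X)\<close> these densities converge to \<open>Z\<close> almost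
  surely along a subsequence, so Fatou's lemma gives \<open>E Z \<le> 1\<close>, and once \<open>E Z = 1\<close> is known,
  Scheffe's lemma gives convergence in \<open>L\<^sup>1\<close>, which carries the martingale property and the
  characteristic function of the increments of \<open>X\<close> over to the limit.

  For \<open>E Z \<ge> 1\<close>, clip the approximations at a bound \<open>C\<close> for \<open>\<bar>\<eta>\<bar>\<close> on the ball of radius \<open>R\<close>
  about \<open>x\<close>. Their densities are bounded in \<open>L\<^sup>2\<close> and converge to \<open>Z\<close> where \<open>X\<close> stays in the
  ball. The mass they put on the remaining paths is small: until \<open>X\<close> leaves the ball, it is close to
  \<open>x + \<sigma> (W + \<integral> \<xi> ds)\<close>, which under the new measure is a Brownian motion, and the maximal
  inequality makes an excursion to distance \<open>R\<close> unlikely as \<open>R \<rightarrow> \<infinity>\<close>.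
\<close>

section \<open>Exponential martingales of Brownian increments\<close>

text \<open>The obstacle is that \<eta> may grow without bound, so \<open>\<eta> (X)\<close> need
  not have the exponential moments that Novikov's criterion asks for. What saves the mass is the
  equation itself: W plus the integral of \<open>\<eta> (X)\<close> is (X - x) / \<sigma>, so under
  the changed measure the path that controls the integrand is a Brownian motion, which cannot run
  off to infinity in finite time. Stopping times are avoided: integrands are clipped in value
  instead of being stopped, and exits are detected path by path on a countable grid of times. The
  order of the limits matters. The maximal inequality gives a bound in which the clipping level does
  not appear, so R can be fixed first; R determines C, and C determines the truncation level N. The
  index of the approximation tends to infinity with all three held fixed. The complex parameter
  \<open>\<zeta> = \<xi> + \<i> * u\<close> handles density and character in one Gaussian integral:
  u = 0 gives the martingale property, general u gives the law of the increments and their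
  independence of the past.\<close>

lemma gaussian_exponential_martingale:
  fixes \<xi> u h :: real
  assumes h: "0 < h"
  defines "\<zeta> \<equiv> complex_of_real \<xi> + \<i> * complex_of_real u"
  shows "has_bochner_integral (density lborel (normal_density 0 (sqrt h)))
           (\<lambda>y. exp (- \<zeta> * complex_of_real y - \<zeta>\<^sup>2 / 2 * complex_of_real h)) 1"
proof -
  define f where "f y = exp (- \<zeta> * complex_of_real y - \<zeta>\<^sup>2 / 2 * complex_of_real h)" for y
  define g where "g y = normal_density 0 (sqrt h) y *\<^sub>R f y" for y
  interpret std: real_distribution std_normal_distribution by (rule real_dist_normal_dist)
  \<comment> \<open>Completing the square with a real shift only: y = - \<xi> h + sqrt h z absorbs
    the real part of \<zeta>, while the imaginary part stays behind as the character of a standard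
    normal variable. A complex shift would require moving the contour. The factor
    \<open>sqrt h\<close> is the Jacobian.\<close>
  have affine: "sqrt h *\<^sub>R g (- \<xi> * h + sqrt h * z) =
      of_real (exp (u\<^sup>2 * h / 2)) * (std_normal_density z *\<^sub>R iexp (- (u * sqrt h) * z))" for z
  proof -
    have sq: "sqrt h * sqrt h = h" using h by simp
    have sqc: "complex_of_real (sqrt h) * complex_of_real (sqrt h) = complex_of_real h"
      by (metis sq of_real_mult)
    have nd: "sqrt h * normal_density 0 (sqrt h) y = 1 / sqrt (2 * pi) * exp (- y\<^sup>2 / (2 * h))" for y
      using h by (simp add: normal_density_def real_sqrt_mult field_simps)
    have e: "- (- \<xi> * h + sqrt h * z)\<^sup>2 / (2 * h) = - \<xi>\<^sup>2 * h / 2 + \<xi> * sqrt h * z - z\<^sup>2 / 2"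
      using h sq by (simp add: field_simps power2_eq_square)
    have expo: "complex_of_real (- \<xi>\<^sup>2 * h / 2 + \<xi> * sqrt h * z - z\<^sup>2 / 2)
        + (- \<zeta> * complex_of_real (- \<xi> * h + sqrt h * z) - \<zeta>\<^sup>2 / 2 * complex_of_real h)
      = complex_of_real (u\<^sup>2 * h / 2) + (complex_of_real (- z\<^sup>2 / 2) + \<i> * complex_of_real (- (u * sqrt h) * z))"
      by (simp add: \<zeta>_def field_simps power2_eq_square)
    have "sqrt h *\<^sub>R g (- \<xi> * h + sqrt h * z)
        = complex_of_real (1 / sqrt (2 * pi)) * (exp (complex_of_real (- \<xi>\<^sup>2 * h / 2 + \<xi> * sqrt h * z - z\<^sup>2 / 2))
          * f (- \<xi> * h + sqrt h * z))"
      unfolding g_def scaleR_scaleR nd e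
      by (simp add: scaleR_conv_of_real exp_of_real[symmetric])
    also have "\<dots> = complex_of_real (1 / sqrt (2 * pi)) *
        exp (complex_of_real (u\<^sup>2 * h / 2) + (complex_of_real (- z\<^sup>2 / 2) + \<i> * complex_of_real (- (u * sqrt h) * z)))"
      unfolding f_def exp_add[symmetric] expo ..
    also have "\<dots> = of_real (exp (u\<^sup>2 * h / 2)) * (std_normal_density z *\<^sub>R iexp (- (u * sqrt h) * z))"
      by (simp only: exp_add exp_of_real) (simp add: std_normal_density_def scaleR_conv_of_real)
    finally show ?thesis .
  qed
  have "integrable std_normal_distribution (\<lambda>z. iexp (- (u * sqrt h) * z))"
    by (rule std.integrable_iexp) auto
  then have i: "integrable lborel (\<lambda>z. std_normal_density z *\<^sub>R iexp (- (u * sqrt h) * z))"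
    by (subst (asm) integrable_density) auto
  have "(\<integral>z. std_normal_density z *\<^sub>R iexp (- (u * sqrt h) * z) \<partial>lborel) = char std_normal_distribution (- (u * sqrt h))"
    unfolding char_def by (subst integral_density) auto
  also have "\<dots> = of_real (exp (- (u\<^sup>2 * h / 2)))"
    using h by (simp add: char_std_normal_distribution power_mult_distrib)
  finally have v: "(\<integral>z. std_normal_density z *\<^sub>R iexp (- (u * sqrt h) * z) \<partial>lborel) = of_real (exp (- (u\<^sup>2 * h / 2)))" .
  have i2: "integrable lborel (\<lambda>z. sqrt h *\<^sub>R g (- \<xi> * h + sqrt h * z))"
    unfolding affine by (rule integrable_mult_right[OF i])
  have ig: "integrable lborel g"
    using integrable_scaleR_right[OF i2, of "1 / sqrt h"] h
      lborel_integrable_real_affine_iff[of "sqrt h" g "- \<xi> * h"] by simp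
  have "integral\<^sup>L lborel g = (\<integral>z. sqrt h *\<^sub>R g (- \<xi> * h + sqrt h * z) \<partial>lborel)"
    using h by (subst lborel_integral_real_affine[of "sqrt h" g "- \<xi> * h"]) auto
  also have "\<dots> = of_real (exp (u\<^sup>2 * h / 2)) * of_real (exp (- (u\<^sup>2 * h / 2)))"
    by (simp only: affine integral_mult_right_zero v)
  also have "\<dots> = 1" by (simp flip: of_real_mult exp_add)
  finally have vg: "integral\<^sup>L lborel g = 1" .
  have "f \<in> borel_measurable lborel" unfolding f_def by measurable
  then show ?thesis
    unfolding has_bochner_integral_iff f_def[symmetric]
    using ig vg unfolding g_def by (simp add: integrable_density integral_density)
qed


section \<open>Brownian increments and their independence of the past\<close>

locale brownian_filtration = usual_filtered_prob_space M F
  for M :: "'a measure" and F :: "real \<Rightarrow> 'a measure" +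
  fixes W :: "real \<Rightarrow> 'a \<Rightarrow> real"
  assumes brownian: "brownian_motion M F 0 {0..} W"
begin

lemma space_F: "0 \<le> s \<Longrightarrow> space (F s) = space M"
  and sets_F_subset: "0 \<le> s \<Longrightarrow> sets (F s) \<subseteq> sets M"
  using subalgebra_F unfolding subalgebra_def by auto

lemma sets_F_mono: "0 \<le> r \<Longrightarrow> r \<le> s \<Longrightarrow> sets (F r) \<subseteq> sets (F s)"
  using sets_F_mono[of r s] by (simp add: max_def)

lemma measurable_F_mono:
  assumes "f \<in> measurable (F r) N" "0 \<le> r" "r \<le> s"
  shows "f \<in> measurable (F s) N"
  using assms sets_F_mono[of r s] space_F[of r] space_F[of s]
  unfolding measurable_def by auto

lemma measurable_F_M: "f \<in> measurable (F s) N \<Longrightarrow> 0 \<le> s \<Longrightarrow> f \<in> measurable M N"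
  using measurable_from_subalg subalgebra_F by blast

lemma W_measurable: "0 \<le> s \<Longrightarrow> W s \<in> borel_measurable (F s)"
  using brownian unfolding brownian_motion_def by auto

lemma W_measurable_F: "0 \<le> r \<Longrightarrow> r \<le> s \<Longrightarrow> W r \<in> borel_measurable (F s)"
  using W_measurable measurable_F_mono by blast

lemma W_measurable_M[measurable]: "0 \<le> s \<Longrightarrow> W s \<in> borel_measurable M"
  using W_measurable measurable_F_M by blast

lemma past_measurable: "0 \<le> a \<Longrightarrow> (\<lambda>\<omega>. \<omega>) \<in> measurable M (F a)"
  using measurable_from_subalg[OF subalgebra_F measurable_ident] by (simp add: id_def)

text \<open>The identity map into \<open>F a\<close> acts as a random variable that carries the
  entire past. Independence then says that its joint law with the next increment is a product, so
  expectations of functions of both become iterated integrals.\<close>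

lemma distr_past_increment:
  assumes "0 \<le> a" "a < b"
  shows "distr M (F a \<Otimes>\<^sub>M borel) (\<lambda>\<omega>. (\<omega>, W b \<omega> - W a \<omega>)) =
    distr M (F a) (\<lambda>\<omega>. \<omega>) \<Otimes>\<^sub>M density lborel (normal_density 0 (sqrt (b - a)))"
proof -
  define D where "D \<omega> = W b \<omega> - W a \<omega>" for \<omega>
  have dist: "distributed M lborel D (normal_density 0 (sqrt (b - a)))"
    and ind: "indep_set (sets (F a)) {D -` A \<inter> space M | A. A \<in> sets borel}"
    using brownian assms unfolding brownian_motion_def D_def by auto
  have D: "D \<in> borel_measurable M" unfolding D_def using assms by (intro borel_measurable_diff W_measurable_M) auto
  have idm: "(\<lambda>\<omega>. \<omega>) \<in> measurable M (F a)"
    using assms by (intro past_measurable) auto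
  have dN: "distr M borel D = density lborel (normal_density 0 (sqrt (b - a)))"
    using dist distr_cong[of M M borel lborel D D] unfolding distributed_def by simp
  have "distr M (F a) (\<lambda>\<omega>. \<omega>) \<Otimes>\<^sub>M distr M borel D = distr M (F a \<Otimes>\<^sub>M borel) (\<lambda>\<omega>. (\<omega>, D \<omega>))"
  proof (rule pair_measure_eqI)
    show "sigma_finite_measure (distr M (F a) (\<lambda>\<omega>. \<omega>))" "sigma_finite_measure (distr M borel D)"
      using prob_space_distr[OF idm] prob_space_distr[OF D]
      by (simp_all add: prob_space_imp_sigma_finite)
    fix A B assume "A \<in> sets (distr M (F a) (\<lambda>\<omega>. \<omega>))" "B \<in> sets (distr M borel D)"
    then have A: "A \<in> sets (F a)" and B: "B \<in> sets borel" by auto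
    have AM: "A \<in> sets M" "A \<subseteq> space M" using A sets_F_subset[of a] sets.sets_into_space assms by auto
    have eq: "(\<lambda>\<omega>. (\<omega>, D \<omega>)) -` (A \<times> B) \<inter> space M = A \<inter> (D -` B \<inter> space M)" by auto
    have "prob (A \<inter> (D -` B \<inter> space M)) = prob A * prob (D -` B \<inter> space M)"
      by (rule indep_setD[OF ind A]) (use B in auto)
    moreover have "emeasure (distr M (F a \<Otimes>\<^sub>M borel) (\<lambda>\<omega>. (\<omega>, D \<omega>))) (A \<times> B) = emeasure M (A \<inter> (D -` B \<inter> space M))"
      using A B D idm by (subst emeasure_distr) (auto simp: eq)
    moreover have "emeasure (distr M (F a) (\<lambda>\<omega>. \<omega>)) A = emeasure M A"
      using A AM idm by (subst emeasure_distr) (auto simp: Int_absorb2)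
    moreover have "emeasure (distr M borel D) B = emeasure M (D -` B \<inter> space M)"
      using B D by (subst emeasure_distr) auto
    ultimately show "emeasure (distr M (F a) (\<lambda>\<omega>. \<omega>)) A * emeasure (distr M borel D) B
        = emeasure (distr M (F a \<Otimes>\<^sub>M borel) (\<lambda>\<omega>. (\<omega>, D \<omega>))) (A \<times> B)"
      by (simp add: emeasure_eq_measure ennreal_mult)
  qed simp
  then show ?thesis unfolding dN unfolding D_def by simp
qed

text \<open>The bound on the integrand needed for Fubini comes from the real case \<open>u = 0\<close>, since
  \<open>\<bar>exp (- \<zeta> y - \<zeta>\<^sup>2 h / 2)\<bar> = exp (u\<^sup>2 h / 2) exp (- \<xi> y - \<xi>\<^sup>2 h / 2)\<close> for \<open>\<zeta> = \<xi> + \<i> u\<close>.\<close>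
lemma exponential_step:
  fixes Y :: "'a \<Rightarrow> complex" and \<xi> :: "'a \<Rightarrow> real" and u :: real
  assumes ab: "0 \<le> a" "a < b"
    and Y: "Y \<in> borel_measurable (F a)" "integrable M Y" and xi: "\<xi> \<in> borel_measurable (F a)"
  defines "\<zeta> \<equiv> \<lambda>\<omega>. complex_of_real (\<xi> \<omega>) + \<i> * complex_of_real u"
  shows "has_bochner_integral M
     (\<lambda>\<omega>. Y \<omega> * exp (- \<zeta> \<omega> * complex_of_real (W b \<omega> - W a \<omega>) - (\<zeta> \<omega>)\<^sup>2 / 2 * complex_of_real (b - a)))
     (\<integral>\<omega>. Y \<omega> \<partial>M)"
proof -
  define N where "N = density lborel (normal_density 0 (sqrt (b - a)))"
  define P where "P = distr M (F a) (\<lambda>\<omega>. \<omega>)"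
  define g where "g = (\<lambda>(\<omega>, y). Y \<omega> * exp (- \<zeta> \<omega> * complex_of_real y - (\<zeta> \<omega>)\<^sup>2 / 2 * complex_of_real (b - a)))"
  have idm: "(\<lambda>\<omega>. \<omega>) \<in> measurable M (F a)"
    using ab by (intro past_measurable) auto
  interpret N: prob_space N
    unfolding N_def using ab by (intro prob_space_normal_density) auto
  interpret P: prob_space P unfolding P_def by (rule prob_space_distr[OF idm])
  interpret PN: pair_sigma_finite P N ..
  have [measurable_cong]: "sets P = sets (F a)" "sets N = sets borel" unfolding P_def N_def by auto
  have [measurable]: "Y \<in> borel_measurable (F a)" "\<xi> \<in> borel_measurable (F a)" using Y xi by auto
  have zm[measurable]: "\<zeta> \<in> borel_measurable (F a)" unfolding \<zeta>_def by measurable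
  have gm: "g \<in> borel_measurable (F a \<Otimes>\<^sub>M borel)" unfolding g_def by measurable
  have gm': "g \<in> borel_measurable (P \<Otimes>\<^sub>M N)" unfolding g_def by measurable
  have joint: "distr M (F a \<Otimes>\<^sub>M borel) (\<lambda>\<omega>. (\<omega>, W b \<omega> - W a \<omega>)) = P \<Otimes>\<^sub>M N"
    unfolding P_def N_def by (rule distr_past_increment[OF ab])
  have inner: "has_bochner_integral N (\<lambda>y. g (\<omega>, y)) (Y \<omega>)" for \<omega>
    using has_bochner_integral_mult_right[OF gaussian_exponential_martingale[of "b - a" "\<xi> \<omega>" u], of "Y \<omega>"] ab
    unfolding g_def N_def \<zeta>_def by simp
  have ng: "norm (g (\<omega>, y)) = norm (Y \<omega>) * exp (u\<^sup>2 * (b - a) / 2) * exp (- \<xi> \<omega> * y - (\<xi> \<omega>)\<^sup>2 / 2 * (b - a))" for \<omega> y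
    unfolding g_def \<zeta>_def
    by (simp add: norm_mult power2_eq_square exp_add[symmetric] algebra_simps diff_divide_distrib add_divide_distrib)
  have reali: "(\<integral>y. exp (- \<xi> \<omega> * y - (\<xi> \<omega>)\<^sup>2 / 2 * (b - a)) \<partial>N) = 1" for \<omega>
  proof -
    have "has_bochner_integral N (\<lambda>y. complex_of_real (exp (- \<xi> \<omega> * y - (\<xi> \<omega>)\<^sup>2 / 2 * (b - a)))) 1"
      using gaussian_exponential_martingale[of "b - a" "\<xi> \<omega>" 0] ab
      unfolding N_def by (simp add: exp_of_real[symmetric])
    then have "(\<integral>y. complex_of_real (exp (- \<xi> \<omega> * y - (\<xi> \<omega>)\<^sup>2 / 2 * (b - a))) \<partial>N) = 1"
      by (rule has_bochner_integral_integral_eq)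
    then show ?thesis by (metis integral_complex_of_real of_real_eq_1_iff)
  qed
  have innern: "(\<integral>y. norm (g (\<omega>, y)) \<partial>N) = norm (Y \<omega>) * exp (u\<^sup>2 * (b - a) / 2)" for \<omega>
    unfolding ng by (simp only: integral_mult_right_zero reali mult_1_right)
  have YP: "integrable P Y"
    unfolding P_def using Y by (subst integrable_distr_eq[OF idm]) auto
  have ig: "integrable (P \<Otimes>\<^sub>M N) g"
  proof (rule PN.Fubini_integrable[OF gm'])
    show "integrable P (\<lambda>\<omega>. \<integral>y. norm (g (\<omega>, y)) \<partial>N)"
      unfolding innern using YP by auto
    show "AE \<omega> in P. integrable N (\<lambda>y. g (\<omega>, y))"
      using inner by (simp add: has_bochner_integral_iff)
  qed
  have pm: "(\<lambda>\<omega>. (\<omega>, W b \<omega> - W a \<omega>)) \<in> measurable M (F a \<Otimes>\<^sub>M borel)"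
    using idm W_measurable_M[of a] W_measurable_M[of b] ab by auto
  have "integrable M (\<lambda>\<omega>. g (\<omega>, W b \<omega> - W a \<omega>))"
    using ig integrable_distr_eq[OF pm gm] unfolding joint by simp
  moreover have "(\<integral>\<omega>. g (\<omega>, W b \<omega> - W a \<omega>) \<partial>M) = (\<integral>\<omega>. Y \<omega> \<partial>M)"
  proof -
    have "(\<integral>\<omega>. g (\<omega>, W b \<omega> - W a \<omega>) \<partial>M) = integral\<^sup>L (P \<Otimes>\<^sub>M N) g"
      using integral_distr[OF pm gm] unfolding joint by simp
    also have "\<dots> = (\<integral>\<omega>. (\<integral>y. g (\<omega>, y) \<partial>N) \<partial>P)"
      by (rule PN.integral_fst'[OF ig, symmetric])
    also have "\<dots> = (\<integral>\<omega>. Y \<omega> \<partial>P)"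
      using inner by (intro Bochner_Integration.integral_cong) (auto intro: has_bochner_integral_integral_eq)
    also have "\<dots> = (\<integral>\<omega>. Y \<omega> \<partial>M)"
      unfolding P_def by (rule integral_distr[OF idm]) (use Y in auto)
    finally show ?thesis .
  qed
  ultimately show ?thesis unfolding has_bochner_integral_iff g_def by simp
qed

text \<open>Induction on the number of factors: the product so far is measurable at the left end of
  the next interval and takes the place of \<open>Y\<close> in \<open>exponential_step\<close>.
  Measurability of \<open>\<xi> i\<close> is demanded only on nondegenerate intervals, because
  clamping a partition to [r, s] collapses its late intervals to the point s, where
  \<open>\<xi> i\<close> need not be known yet; the factors of collapsed intervals are 1.\<close>

lemma exponential_product:
  fixes Y :: "'a \<Rightarrow> complex" and \<xi> :: "nat \<Rightarrow> 'a \<Rightarrow> real" and c :: "nat \<Rightarrow> real" and u :: real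
  assumes c0: "0 \<le> c 0" and mono: "\<And>i. i < k \<Longrightarrow> c i \<le> c (Suc i)"
    and Y: "Y \<in> borel_measurable (F (c 0))" "integrable M Y"
    and xi: "\<And>i. i < k \<Longrightarrow> c i < c (Suc i) \<Longrightarrow> \<xi> i \<in> borel_measurable (F (c i))"
  defines "\<zeta> \<equiv> \<lambda>i \<omega>. complex_of_real (\<xi> i \<omega>) + \<i> * complex_of_real u"
  defines "E \<equiv> \<lambda>i \<omega>. exp (- \<zeta> i \<omega> * complex_of_real (W (c (Suc i)) \<omega> - W (c i) \<omega>)
                  - (\<zeta> i \<omega>)\<^sup>2 / 2 * complex_of_real (c (Suc i) - c i))"
  shows "has_bochner_integral M (\<lambda>\<omega>. Y \<omega> * (\<Prod>i<k. E i \<omega>)) (\<integral>\<omega>. Y \<omega> \<partial>M)"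
proof -
  have "c 0 \<le> c j \<and> (\<lambda>\<omega>. Y \<omega> * (\<Prod>i<j. E i \<omega>)) \<in> borel_measurable (F (c j)) \<and>
     has_bochner_integral M (\<lambda>\<omega>. Y \<omega> * (\<Prod>i<j. E i \<omega>)) (\<integral>\<omega>. Y \<omega> \<partial>M)" if "j \<le> k" for j
    using that
  proof (induction j)
    case 0
    then show ?case using Y by (simp add: has_bochner_integral_iff)
  next
    case (Suc j)
    define V where "V \<omega> = Y \<omega> * (\<Prod>i<j. E i \<omega>)" for \<omega>
    have IH: "c 0 \<le> c j" "V \<in> borel_measurable (F (c j))" "has_bochner_integral M V (\<integral>\<omega>. Y \<omega> \<partial>M)"
      using Suc unfolding V_def by auto
    have le: "c j \<le> c (Suc j)" and cj: "0 \<le> c j" using mono[of j] Suc.prems IH(1) c0 by auto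
    have step: "(\<lambda>\<omega>. Y \<omega> * (\<Prod>i<Suc j. E i \<omega>)) = (\<lambda>\<omega>. V \<omega> * E j \<omega>)"
      unfolding V_def by (auto simp: mult.assoc)
    show ?case
    proof (cases "c j = c (Suc j)")
      case True
      then have "E j = (\<lambda>\<omega>. 1)" unfolding E_def by auto
      then show ?thesis unfolding step using IH True by simp
    next
      case False
      then have lt: "c j < c (Suc j)" using le by simp
      have xij: "\<xi> j \<in> borel_measurable (F (c j))" using xi[of j] lt Suc.prems by auto
      have "has_bochner_integral M (\<lambda>\<omega>. V \<omega> * E j \<omega>) (\<integral>\<omega>. V \<omega> \<partial>M)"
        unfolding E_def \<zeta>_def
        by (rule exponential_step[OF cj lt IH(2) _ xij]) (use IH(3) in \<open>auto simp: has_bochner_integral_iff\<close>)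
      moreover have "(\<integral>\<omega>. V \<omega> \<partial>M) = (\<integral>\<omega>. Y \<omega> \<partial>M)"
        using IH(3) by (simp add: has_bochner_integral_iff)
      moreover have "(\<lambda>\<omega>. V \<omega> * E j \<omega>) \<in> borel_measurable (F (c (Suc j)))"
      proof -
        have [measurable]: "V \<in> borel_measurable (F (c (Suc j)))" "\<xi> j \<in> borel_measurable (F (c (Suc j)))"
          "W (c j) \<in> borel_measurable (F (c (Suc j)))" "W (c (Suc j)) \<in> borel_measurable (F (c (Suc j)))"
          using measurable_F_mono[OF _ cj le] IH(2) xij W_measurable_F[of "c j" "c (Suc j)"] W_measurable_F[of "c (Suc j)" "c (Suc j)"] cj le
          by auto
        show ?thesis unfolding E_def \<zeta>_def by measurable
      qed
      ultimately show ?thesis unfolding step using IH(1) le by auto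
    qed
  qed
  then show ?thesis by auto
qed

end

section \<open>Girsanov's theorem for simple integrands\<close>

lemma simple_dataD:
  assumes "simple_data F t T k a \<xi>"
  shows "a 0 = t" "a k = T" "i < k \<Longrightarrow> a i \<le> a (Suc i)" "i < k \<Longrightarrow> \<xi> i \<in> borel_measurable (F (a i))"
  using assms unfolding simple_data_def by auto

lemma simple_data_mono:
  assumes "simple_data F t T k a \<xi>" "i \<le> j" "j \<le> k"
  shows "a i \<le> a j"
  using assms(2,3)
proof (induction j rule: dec_induct)
  case (step n)
  then show ?case using simple_dataD(3)[OF assms(1), of n] by auto
qed auto

lemma simple_data_start_le: "simple_data F t T k a \<xi> \<Longrightarrow> i \<le> k \<Longrightarrow> t \<le> a i"
  using simple_data_mono[of F t T k a \<xi> 0 i] by (auto simp: simple_dataD)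

lemma simple_data_comp:
  assumes "simple_data F t T k a \<xi>" "continuous_on UNIV (f :: real \<Rightarrow> real)"
  shows "simple_data F t T k a (\<lambda>i \<omega>. f (\<xi> i \<omega>))"
  unfolding simple_data_def
proof (intro conjI allI impI)
  show "a 0 = t" "a k = T" using simple_dataD[OF assms(1)] by auto
  fix i assume i: "i < k"
  show "a i \<le> a (Suc i)" using simple_dataD[OF assms(1)] i by auto
  have f[measurable]: "f \<in> borel_measurable borel" using assms(2) by (rule borel_measurable_continuous_onI)
  have [measurable]: "\<xi> i \<in> borel_measurable (F (a i))" using simple_dataD[OF assms(1)] i by auto
  show "(\<lambda>\<omega>. f (\<xi> i \<omega>)) \<in> borel_measurable (F (a i))" by measurable
  obtain C where C: "\<And>\<omega>. \<omega> \<in> space (F (a i)) \<Longrightarrow> \<bar>\<xi> i \<omega>\<bar> \<le> C"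
    using assms(1) i unfolding simple_data_def by blast
  have "compact (f ` {-C..C})"
    by (intro compact_continuous_image continuous_on_subset[OF assms(2)]) auto
  then obtain B where B: "\<And>y. y \<in> f ` {-C..C} \<Longrightarrow> \<bar>y\<bar> \<le> B"
    using compact_imp_bounded bounded_real by metis
  have "\<bar>f (\<xi> i \<omega>)\<bar> \<le> B" if "\<omega> \<in> space (F (a i))" for \<omega>
    using C[OF that] by (intro B imageI) auto
  then show "\<exists>C. \<forall>\<omega>\<in>space (F (a i)). \<bar>f (\<xi> i \<omega>)\<bar> \<le> C" by blast
qed

text \<open>The partition points are clamped to [r, s] instead of refining the partition by r and s.
  The index range stays the same, and the clamped points run from r to s.\<close>

lemma simple_integral_diff:
  assumes "r \<le> s"
  shows "simple_integral V k a \<xi> s \<omega> - simple_integral V k a \<xi> r \<omega> =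
    (\<Sum>i<k. \<xi> i \<omega> * (V (max r (min s (a (Suc i)))) \<omega> - V (max r (min s (a i))) \<omega>))"
proof -
  have *: "V (min s x) \<omega> - V (min r x) \<omega> = V (max r (min s x)) \<omega> - V r \<omega>" for x
    using assms by (cases "x \<le> r") (auto simp: max_def min_def)
  have "\<xi> i \<omega> * (V (min s (a (Suc i))) \<omega> - V (min s (a i)) \<omega>) - \<xi> i \<omega> * (V (min r (a (Suc i))) \<omega> - V (min r (a i)) \<omega>)
      = \<xi> i \<omega> * (V (max r (min s (a (Suc i)))) \<omega> - V (max r (min s (a i))) \<omega>)" for i
    using *[of "a i"] *[of "a (Suc i)"] by (simp add: right_diff_distrib[symmetric])
  then show ?thesis unfolding simple_integral_def by (simp add: sum_subtractf[symmetric])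
qed

lemma simple_integral_linear:
  "simple_integral V k a (\<lambda>i \<omega>. \<xi> i \<omega> + \<xi>' i \<omega>) s \<omega> = simple_integral V k a \<xi> s \<omega> + simple_integral V k a \<xi>' s \<omega>"
  "simple_integral V k a (\<lambda>i \<omega>. \<xi> i \<omega> - \<xi>' i \<omega>) s \<omega> = simple_integral V k a \<xi> s \<omega> - simple_integral V k a \<xi>' s \<omega>"
  "simple_integral V k a (\<lambda>i \<omega>. c * \<xi> i \<omega>) s \<omega> = c * simple_integral V k a \<xi> s \<omega>"
  unfolding simple_integral_def
  by (simp_all add: sum.distrib sum_subtractf sum_distrib_left algebra_simps)

lemma simple_integral_const:
  assumes "simple_data F t T k a \<xi>" "t \<le> s" "s \<le> T"
  shows "simple_integral V k a (\<lambda>i \<omega>. c) s \<omega> = c * (V s \<omega> - V t \<omega>)"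
proof -
  have "simple_integral V k a (\<lambda>i \<omega>. c) s \<omega> = c * (\<Sum>i<k. V (min s (a (Suc i))) \<omega> - V (min s (a i)) \<omega>)"
    unfolding simple_integral_def by (simp add: sum_distrib_left)
  also have "(\<Sum>i<k. V (min s (a (Suc i))) \<omega> - V (min s (a i)) \<omega>) = V (min s (a k)) \<omega> - V (min s (a 0)) \<omega>"
    by (rule sum_lessThan_telescope)
  finally show ?thesis using simple_dataD(1,2)[OF assms(1)] assms(2,3) by (simp add: min_def)
qed

lemma simple_integral_start:
  assumes "simple_data F t T k a \<xi>"
  shows "simple_integral V k a \<xi>' t \<omega> = 0"
proof -
  have "min t (a i) = t" if "i \<le> k" for i using simple_data_start_le[OF assms that] by simp
  then show ?thesis unfolding simple_integral_def by simp
qed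

text \<open>Integration against the deterministic integrator s gives the Lebesgue integral, so drift
  and energy inherit every lemma about \<open>simple_integral\<close>.\<close>

abbreviation simple_drift :: "nat \<Rightarrow> (nat \<Rightarrow> real) \<Rightarrow> (nat \<Rightarrow> 'a \<Rightarrow> real) \<Rightarrow> real \<Rightarrow> 'a \<Rightarrow> real" where
  "simple_drift \<equiv> simple_integral (\<lambda>s \<omega>. s)"

abbreviation simple_energy :: "nat \<Rightarrow> (nat \<Rightarrow> real) \<Rightarrow> (nat \<Rightarrow> 'a \<Rightarrow> real) \<Rightarrow> real \<Rightarrow> 'a \<Rightarrow> real" where
  "simple_energy k a \<xi> \<equiv> simple_drift k a (\<lambda>i \<omega>. (\<xi> i \<omega>)\<^sup>2)"

lemma simple_drift_mono:
  assumes "simple_data F t T k a \<psi>" "\<And>i. i < k \<Longrightarrow> \<xi> i \<omega> \<le> \<xi>' i \<omega>"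
  shows "simple_drift k a \<xi> s \<omega> \<le> simple_drift k a \<xi>' s \<omega>"
  unfolding simple_integral_def
  by (intro sum_mono mult_right_mono) (use assms simple_dataD(3)[OF assms(1)] in \<open>auto simp: min_def, force+\<close>)

context brownian_filtration
begin

text \<open>The stochastic exponential of the integral of - \<xi> against W.\<close>

definition simple_density :: "nat \<Rightarrow> (nat \<Rightarrow> real) \<Rightarrow> (nat \<Rightarrow> 'a \<Rightarrow> real) \<Rightarrow> real \<Rightarrow> 'a \<Rightarrow> real" where
  "simple_density k a \<xi> s \<omega> = exp (- simple_integral W k a \<xi> s \<omega> - simple_energy k a \<xi> s \<omega> / 2)"

text \<open>The process that becomes a Brownian motion started at time t under the density with the
  same \<xi>.\<close>

definition simple_shift :: "real \<Rightarrow> nat \<Rightarrow> (nat \<Rightarrow> real) \<Rightarrow> (nat \<Rightarrow> 'a \<Rightarrow> real) \<Rightarrow> real \<Rightarrow> 'a \<Rightarrow> real" where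
  "simple_shift t k a \<xi> s \<omega> = W s \<omega> - W t \<omega> + simple_drift k a \<xi> s \<omega>"

lemma simple_density_pos[simp]: "0 < simple_density k a \<xi> s \<omega>"
  unfolding simple_density_def by simp

lemma simple_density_nonneg[simp]: "0 \<le> simple_density k a \<xi> s \<omega>"
  unfolding simple_density_def by simp

lemma simple_integral_measurable:
  assumes sd: "simple_data F t T k a \<xi>" and t: "0 \<le> t" "t \<le> s"
    and V: "\<And>r. t \<le> r \<Longrightarrow> r \<le> s \<Longrightarrow> V r \<in> borel_measurable (F s)"
  shows "simple_integral V k a \<xi> s \<in> borel_measurable (F s)"
proof -
  have "(\<lambda>\<omega>. \<xi> i \<omega> * (V (min s (a (Suc i))) \<omega> - V (min s (a i)) \<omega>)) \<in> borel_measurable (F s)" if i: "i < k" for i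
  proof (cases "a i \<le> s")
    case True
    have ai: "t \<le> a i" "t \<le> a (Suc i)"
      using simple_data_start_le[OF sd, of i] simple_data_start_le[OF sd, of "Suc i"] i by auto
    have "\<xi> i \<in> borel_measurable (F s)"
      using measurable_F_mono[OF simple_dataD(4)[OF sd i] _ True] ai t by auto
    then show ?thesis
      using V[of "min s (a (Suc i))"] V[of "min s (a i)"] ai t
      by (intro borel_measurable_times borel_measurable_diff) auto
  next
    \<comment> \<open>Here \<open>\<xi> i\<close> is not yet known at time s, but the increment it
      multiplies is zero.\<close>
    case False
    then have "min s (a i) = s" "min s (a (Suc i)) = s" using simple_dataD(3)[OF sd i] by auto
    then show ?thesis by simp
  qed
  then show ?thesis unfolding simple_integral_def[abs_def] by (intro borel_measurable_sum) auto
qed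

lemma simple_adapted:
  assumes sd: "simple_data F t T k a \<xi>" and t: "0 \<le> t" "t \<le> s"
  shows "simple_integral W k a \<xi> s \<in> borel_measurable (F s)"
    and "simple_drift k a \<xi> s \<in> borel_measurable (F s)"
    and "simple_energy k a \<xi> s \<in> borel_measurable (F s)"
    and "simple_density k a \<xi> s \<in> borel_measurable (F s)"
    and "simple_shift t k a \<xi> s \<in> borel_measurable (F s)"
proof -
  have sd2: "simple_data F t T k a (\<lambda>i \<omega>. (\<xi> i \<omega>)\<^sup>2)"
    by (rule simple_data_comp[OF sd]) (intro continuous_intros)
  show [measurable]: "simple_integral W k a \<xi> s \<in> borel_measurable (F s)"
    by (rule simple_integral_measurable[OF sd t]) (use t W_measurable_F in auto)
  show [measurable]: "simple_drift k a \<xi> s \<in> borel_measurable (F s)"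
    by (rule simple_integral_measurable[OF sd t]) auto
  show [measurable]: "simple_energy k a \<xi> s \<in> borel_measurable (F s)"
    by (rule simple_integral_measurable[OF sd2 t]) auto
  show "simple_density k a \<xi> s \<in> borel_measurable (F s)"
    unfolding simple_density_def[abs_def] by measurable
  have [measurable]: "W s \<in> borel_measurable (F s)" "W t \<in> borel_measurable (F s)"
    using W_measurable_F t by auto
  show "simple_shift t k a \<xi> s \<in> borel_measurable (F s)"
    unfolding simple_shift_def[abs_def] by measurable
qed

text \<open>A conditional statement given \<open>F r\<close>, expressed by testing against arbitrary
  integrable \<open>Y\<close>: weighted with the density ratio, the increment of the shift is
  Gaussian with variance s - r and independent of the past.\<close>

lemma simple_girsanov_char:
  fixes Y :: "'a \<Rightarrow> complex"
  assumes sd: "simple_data F t T k a \<xi>" and t: "0 \<le> t" "t \<le> r" "r \<le> s" "s \<le> T"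
    and Y: "Y \<in> borel_measurable (F r)" "integrable M Y"
  shows "has_bochner_integral M
      (\<lambda>\<omega>. Y \<omega> * (complex_of_real (simple_density k a \<xi> s \<omega> / simple_density k a \<xi> r \<omega>) *
          iexp (u * (simple_shift t k a \<xi> s \<omega> - simple_shift t k a \<xi> r \<omega>))))
      (complex_of_real (exp (- u\<^sup>2 * (s - r) / 2)) * (\<integral>\<omega>. Y \<omega> \<partial>M))"
proof -
  define c where "c i = max r (min s (a i))" for i
  \<comment> \<open>The imaginary part is - u, so that - \<zeta> w contributes the phase + u w. The
    cross term of \<open>- \<zeta>\<^sup>2 / 2 * h\<close> contributes + u \<xi> h, and both phases
    together are u times the increment of the shift. The remaining real term
    \<open>u\<^sup>2 * h / 2\<close> becomes the Gaussian factor on the other side.\<close>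
  define \<zeta> where "\<zeta> i \<omega> = complex_of_real (\<xi> i \<omega>) + \<i> * complex_of_real (- u)" for i \<omega>
  define E where "E i \<omega> = exp (- \<zeta> i \<omega> * complex_of_real (W (c (Suc i)) \<omega> - W (c i) \<omega>)
                  - (\<zeta> i \<omega>)\<^sup>2 / 2 * complex_of_real (c (Suc i) - c i))" for i \<omega>
  have c0: "c 0 = r" "c k = s" unfolding c_def using simple_dataD(1,2)[OF sd] t by auto
  have ge: "r \<le> c i" for i unfolding c_def by simp
  have mono: "c i \<le> c (Suc i)" if "i < k" for i
    unfolding c_def using simple_dataD(3)[OF sd that] by auto
  \<comment> \<open>If \<open>a i\<close> were at least s, both clamped end points would equal s.
    Hence a nondegenerate clamped interval has \<open>a i\<close> < s, and clamping can only have
    moved \<open>a i\<close> upwards.\<close>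
  have xi: "\<xi> i \<in> borel_measurable (F (c i))" if i: "i < k" "c i < c (Suc i)" for i
  proof -
    have "a i \<le> c i" using i(2) simple_dataD(3)[OF sd i(1)] t unfolding c_def by (auto simp: max_def min_def split: if_splits)
    moreover have "0 \<le> a i" using simple_data_start_le[OF sd, of i] i t by auto
    ultimately show ?thesis using measurable_F_mono[OF simple_dataD(4)[OF sd i(1)]] by auto
  qed
  have main: "has_bochner_integral M (\<lambda>\<omega>. Y \<omega> * (\<Prod>i<k. E i \<omega>)) (\<integral>\<omega>. Y \<omega> \<partial>M)"
    unfolding E_def \<zeta>_def
    by (rule exponential_product[where c = c and \<xi> = \<xi> and k = k and u = "- u" and Y = Y, OF _ mono _ Y(2) xi])
      (use c0 t Y(1) in simp_all)
  have prod: "(\<Prod>i<k. E i \<omega>) = complex_of_real (exp (u\<^sup>2 * (s - r) / 2)) *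
      (complex_of_real (simple_density k a \<xi> s \<omega> / simple_density k a \<xi> r \<omega>) *
          iexp (u * (simple_shift t k a \<xi> s \<omega> - simple_shift t k a \<xi> r \<omega>)))" for \<omega>
  proof -
    define w where "w i = W (c (Suc i)) \<omega> - W (c i) \<omega>" for i
    define h where "h i = c (Suc i) - c i" for i
    have E: "E i \<omega> = exp (complex_of_real (- (\<xi> i \<omega> * w i) - (\<xi> i \<omega>)\<^sup>2 * h i / 2 + u\<^sup>2 * h i / 2)
        + \<i> * complex_of_real (u * (w i + \<xi> i \<omega> * h i)))" for i
      unfolding E_def \<zeta>_def w_def[symmetric] h_def[symmetric]
      by (rule arg_cong[where f=exp]) (simp add: field_simps power2_eq_square)
    have tel: "(\<Sum>i<k. w i) = W s \<omega> - W r \<omega>" "(\<Sum>i<k. h i) = s - r"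
      unfolding w_def h_def using sum_lessThan_telescope[of "\<lambda>i. W (c i) \<omega>" k]
        sum_lessThan_telescope[of c k] c0 by auto
    have S: "(\<Sum>i<k. \<xi> i \<omega> * w i) = simple_integral W k a \<xi> s \<omega> - simple_integral W k a \<xi> r \<omega>"
      "(\<Sum>i<k. \<xi> i \<omega> * h i) = simple_drift k a \<xi> s \<omega> - simple_drift k a \<xi> r \<omega>"
      "(\<Sum>i<k. (\<xi> i \<omega>)\<^sup>2 * h i) = simple_energy k a \<xi> s \<omega> - simple_energy k a \<xi> r \<omega>"
      unfolding simple_integral_diff[OF t(3)] w_def h_def c_def by simp_all
    have R: "(\<Sum>i<k. - (\<xi> i \<omega> * w i) - (\<xi> i \<omega>)\<^sup>2 * h i / 2 + u\<^sup>2 * h i / 2)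
       = - (simple_integral W k a \<xi> s \<omega> - simple_integral W k a \<xi> r \<omega>)
         - (simple_energy k a \<xi> s \<omega> - simple_energy k a \<xi> r \<omega>) / 2 + u\<^sup>2 * (s - r) / 2"
      unfolding S[symmetric] tel[symmetric]
      by (simp add: sum.distrib sum_subtractf sum_negf sum_divide_distrib sum_distrib_left)
    have I: "(\<Sum>i<k. u * (w i + \<xi> i \<omega> * h i)) = u * (simple_shift t k a \<xi> s \<omega> - simple_shift t k a \<xi> r \<omega>)"
      unfolding sum_distrib_left[symmetric] sum.distrib S tel simple_shift_def by simp
    have "(\<Prod>i<k. E i \<omega>) = exp (\<Sum>i<k. (complex_of_real (- (\<xi> i \<omega> * w i) - (\<xi> i \<omega>)\<^sup>2 * h i / 2 + u\<^sup>2 * h i / 2)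
        + \<i> * complex_of_real (u * (w i + \<xi> i \<omega> * h i))))"
      unfolding E by (rule exp_sum[symmetric]) simp
    also have "\<dots> = exp (complex_of_real (\<Sum>i<k. - (\<xi> i \<omega> * w i) - (\<xi> i \<omega>)\<^sup>2 * h i / 2 + u\<^sup>2 * h i / 2)
        + \<i> * complex_of_real (\<Sum>i<k. u * (w i + \<xi> i \<omega> * h i)))"
      by (rule arg_cong[where f = exp]) (subst sum.distrib, simp only: sum_distrib_left of_real_sum)
    also have "\<dots> = complex_of_real (exp (- (simple_integral W k a \<xi> s \<omega> - simple_integral W k a \<xi> r \<omega>)
         - (simple_energy k a \<xi> s \<omega> - simple_energy k a \<xi> r \<omega>) / 2 + u\<^sup>2 * (s - r) / 2)) *
         iexp (u * (simple_shift t k a \<xi> s \<omega> - simple_shift t k a \<xi> r \<omega>))"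
      unfolding R I exp_add exp_of_real ..
    also have "exp (- (simple_integral W k a \<xi> s \<omega> - simple_integral W k a \<xi> r \<omega>)
         - (simple_energy k a \<xi> s \<omega> - simple_energy k a \<xi> r \<omega>) / 2 + u\<^sup>2 * (s - r) / 2)
         = exp (u\<^sup>2 * (s - r) / 2) * (simple_density k a \<xi> s \<omega> / simple_density k a \<xi> r \<omega>)"
      unfolding simple_density_def exp_diff[symmetric] exp_add[symmetric]
      by (simp add: field_simps)
    finally show ?thesis by (simp only: of_real_mult mult.assoc)
  qed
  have "has_bochner_integral M (\<lambda>\<omega>. complex_of_real (exp (- u\<^sup>2 * (s - r) / 2)) * (Y \<omega> * (\<Prod>i<k. E i \<omega>)))
      (complex_of_real (exp (- u\<^sup>2 * (s - r) / 2)) * (\<integral>\<omega>. Y \<omega> \<partial>M))"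
    using has_bochner_integral_mult_right[OF main] by blast
  moreover have "complex_of_real (exp (- u\<^sup>2 * (s - r) / 2)) * (Y \<omega> * (\<Prod>i<k. E i \<omega>)) =
      Y \<omega> * (complex_of_real (simple_density k a \<xi> s \<omega> / simple_density k a \<xi> r \<omega>) *
          iexp (u * (simple_shift t k a \<xi> s \<omega> - simple_shift t k a \<xi> r \<omega>)))" for \<omega>
  proof -
    have "complex_of_real (exp (- u\<^sup>2 * (s - r) / 2)) * complex_of_real (exp (u\<^sup>2 * (s - r) / 2)) = 1"
      unfolding of_real_mult[symmetric] exp_add[symmetric] by simp
    moreover have "e1 * (y * (e2 * z)) = y * z" if "e1 * e2 = 1" for e1 e2 y z :: complex
      using that by (simp add: mult.left_commute[of e1 y] mult.assoc[symmetric, of e1 e2])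
    ultimately show ?thesis unfolding prod by blast
  qed
  ultimately show ?thesis by simp
qed

lemma simple_density_integrable:
  assumes sd: "simple_data F t T k a \<xi>" and t: "0 \<le> t" "t \<le> s" "s \<le> T"
  shows "integrable M (simple_density k a \<xi> s)" "(\<integral>\<omega>. simple_density k a \<xi> s \<omega> \<partial>M) = 1"
proof -
  have "simple_density k a \<xi> t \<omega> = 1" for \<omega>
    unfolding simple_density_def by (simp add: simple_integral_start[OF sd])
  note start = this
  have one: "(\<integral>\<omega>. (1::complex) \<partial>M) = 1" by (simp add: prob_space)
  have "has_bochner_integral M (\<lambda>\<omega>. complex_of_real (simple_density k a \<xi> s \<omega>)) 1"
    using simple_girsanov_char[OF sd t(1) order_refl t(2,3) borel_measurable_const integrable_const, of 1 0]
    by (simp only: start one mult_1_left mult_1_right div_by_1 mult_zero_left mult_zero_right of_real_0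
        of_real_1 exp_zero power_zero_numeral minus_zero div_0)
  then have b: "integrable M (\<lambda>\<omega>. complex_of_real (simple_density k a \<xi> s \<omega>))"
    "(\<integral>\<omega>. complex_of_real (simple_density k a \<xi> s \<omega>) \<partial>M) = 1"
    unfolding has_bochner_integral_iff by simp_all
  show "integrable M (simple_density k a \<xi> s)"
    using b(1) by (simp only: complex_of_real_integrable_eq)
  show "(\<integral>\<omega>. simple_density k a \<xi> s \<omega> \<partial>M) = 1"
    using b(2) unfolding integral_complex_of_real of_real_eq_1_iff .
qed

text \<open>The choice \<open>Y\<close> = indicator of A times the density at r cancels the
  denominator of the ratio and leaves an expectation under the changed measure.\<close>

lemma simple_density_char:
  assumes sd: "simple_data F t T k a \<xi>" and t: "0 \<le> t" "t \<le> r" "r \<le> s" "s \<le> T" and A: "A \<in> sets (F r)"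
  shows "(\<integral>\<omega>. complex_of_real (indicator A \<omega> * simple_density k a \<xi> s \<omega>) *
          iexp (u * (simple_shift t k a \<xi> s \<omega> - simple_shift t k a \<xi> r \<omega>)) \<partial>M)
    = complex_of_real (exp (- u\<^sup>2 * (s - r) / 2) * (\<integral>\<omega>. indicator A \<omega> * simple_density k a \<xi> r \<omega> \<partial>M))"
proof -
  define Y where "Y \<omega> = complex_of_real (indicator A \<omega> * simple_density k a \<xi> r \<omega>)" for \<omega>
  have AM: "A \<in> sets M" using A sets_F_subset[of r] t by auto
  have [measurable]: "simple_density k a \<xi> r \<in> borel_measurable (F r)" "A \<in> sets (F r)"
    using simple_adapted[OF sd t(1,2)] A by auto
  have Y1: "Y \<in> borel_measurable (F r)" unfolding Y_def by measurable
  have i: "integrable M (\<lambda>\<omega>. indicator A \<omega> * simple_density k a \<xi> r \<omega>)"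
    using integrable_real_mult_indicator[OF AM simple_density_integrable(1)[OF sd t(1,2)]] t
    by (simp add: mult.commute)
  have Y2: "integrable M Y" unfolding Y_def using i by (simp only: complex_of_real_integrable_eq)
  have IY: "(\<integral>\<omega>. Y \<omega> \<partial>M) = complex_of_real (\<integral>\<omega>. indicator A \<omega> * simple_density k a \<xi> r \<omega> \<partial>M)"
    unfolding Y_def by (rule integral_complex_of_real)
  have eq: "Y \<omega> * (complex_of_real (simple_density k a \<xi> s \<omega> / simple_density k a \<xi> r \<omega>) * z)
      = complex_of_real (indicator A \<omega> * simple_density k a \<xi> s \<omega>) * z" for \<omega> z
  proof -
    have "simple_density k a \<xi> r \<omega> \<noteq> 0" by (simp add: simple_density_def)
    then show ?thesis unfolding Y_def by simp
  qed
  show ?thesis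
    using simple_girsanov_char[OF sd t Y1 Y2, of u] unfolding eq IY of_real_mult[symmetric]
    by (rule has_bochner_integral_integral_eq)
qed

lemma simple_density_martingale:
  assumes sd: "simple_data F t T k a \<xi>" and t: "0 \<le> t" "t \<le> r" "r \<le> s" "s \<le> T" and A: "A \<in> sets (F r)"
  shows "(\<integral>\<omega>. indicator A \<omega> * simple_density k a \<xi> s \<omega> \<partial>M) = (\<integral>\<omega>. indicator A \<omega> * simple_density k a \<xi> r \<omega> \<partial>M)"
proof -
  have "(\<integral>\<omega>. complex_of_real (indicator A \<omega> * simple_density k a \<xi> s \<omega>) \<partial>M)
      = complex_of_real (\<integral>\<omega>. indicator A \<omega> * simple_density k a \<xi> r \<omega> \<partial>M)"
    using simple_density_char[OF assms, of 0] by simp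
  then show ?thesis unfolding integral_complex_of_real of_real_eq_iff .
qed

end

section \<open>Maximal inequality and moment bounds\<close>

lemma integrable_indicator_times:
  fixes f :: "'a \<Rightarrow> real"
  shows "A \<in> sets M \<Longrightarrow> integrable M f \<Longrightarrow> integrable M (\<lambda>\<omega>. indicator A \<omega> * f \<omega>)"
  using integrable_real_mult_indicator[of A M f] by (simp add: mult.commute)

context brownian_filtration
begin

text \<open>Relative to the density of \<xi>, the density of \<xi> - \<theta> is the exponential
  martingale with parameter \<theta> of the shifted process. It is again the density of a simple
  integrand, so its martingale property and its total mass are already known.\<close>

lemma simple_density_shift:
  assumes sd: "simple_data F t T k a \<xi>" and s: "t \<le> s" "s \<le> T"
  shows "simple_density k a (\<lambda>i \<omega>. \<xi> i \<omega> - \<theta>) s \<omega> =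
    simple_density k a \<xi> s \<omega> * exp (\<theta> * simple_shift t k a \<xi> s \<omega> - \<theta>\<^sup>2 * (s - t) / 2)"
proof -
  have sq: "(\<xi> i \<omega> - \<theta>)\<^sup>2 = (\<xi> i \<omega>)\<^sup>2 + (- 2 * \<theta> * \<xi> i \<omega> + \<theta>\<^sup>2)" for i \<omega>
    by (simp add: power2_eq_square algebra_simps)
  have e: "simple_energy k a (\<lambda>i \<omega>. \<xi> i \<omega> - \<theta>) s \<omega>
    = simple_energy k a \<xi> s \<omega> + (- 2 * \<theta> * simple_drift k a \<xi> s \<omega> + \<theta>\<^sup>2 * (s - t))"
    unfolding sq simple_integral_linear(1) simple_integral_linear(3) simple_integral_const[OF sd s] ..
  have i: "simple_integral W k a (\<lambda>i \<omega>. \<xi> i \<omega> - \<theta>) s \<omega> = simple_integral W k a \<xi> s \<omega> - \<theta> * (W s \<omega> - W t \<omega>)"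
    unfolding simple_integral_linear(2) simple_integral_const[OF sd s] ..
  show ?thesis
    unfolding simple_density_def e i exp_add[symmetric] simple_shift_def
    by (rule arg_cong[where f = exp]) (simp add: field_simps)
qed

lemma simple_data_minus_const: "simple_data F t T k a \<xi> \<Longrightarrow> simple_data F t T k a (\<lambda>i \<omega>. \<xi> i \<omega> - \<theta>)"
  using simple_data_comp[of F t T k a \<xi> "\<lambda>y. y - \<theta>"] continuous_on_diff[OF continuous_on_id continuous_on_const]
  by auto

lemma simple_data_scale: "simple_data F t T k a \<xi> \<Longrightarrow> simple_data F t T k a (\<lambda>i \<omega>. \<theta> * \<xi> i \<omega>)"
  using simple_data_comp[of F t T k a \<xi> "\<lambda>y. \<theta> * y"] by (auto intro: continuous_intros)

lemma simple_density_measurable: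
  assumes "simple_data F t T k a \<xi>" "0 \<le> t" "t \<le> s"
  shows "simple_density k a \<xi> s \<in> borel_measurable M" "simple_integral W k a \<xi> s \<in> borel_measurable M"
    "simple_energy k a \<xi> s \<in> borel_measurable M" "simple_shift t k a \<xi> s \<in> borel_measurable M"
    "simple_drift k a \<xi> s \<in> borel_measurable M"
  using measurable_F_M[OF _ order_trans[OF assms(2,3)]] simple_adapted[OF assms] by blast+

lemma exceed_sets:
  assumes sd: "simple_data F t T k a \<xi>" and t: "0 \<le> t" and D: "countable D" "D \<subseteq> {t..s}"
  shows "{\<omega> \<in> space M. \<exists>d\<in>D. c \<le> \<theta> * simple_shift t k a \<xi> d \<omega>} \<in> sets (F s)"
proof (cases "D = {}")
  case False
  then have ts: "t \<le> s" "0 \<le> s" using D t by auto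
  have "{\<omega> \<in> space (F s). \<exists>d\<in>D. c \<le> \<theta> * simple_shift t k a \<xi> d \<omega>} \<in> sets (F s)"
  proof (rule sets.sets_Collect_countable_Ex'[OF _ D(1)])
    fix d assume d: "d \<in> D"
    then have [measurable]: "simple_shift t k a \<xi> d \<in> borel_measurable (F s)"
      using measurable_F_mono[OF simple_adapted(5)[OF sd t, of d]] D t by auto
    show "{\<omega> \<in> space (F s). c \<le> \<theta> * simple_shift t k a \<xi> d \<omega>} \<in> sets (F s)" by measurable
  qed
  then show ?thesis using space_F ts by simp
qed auto

lemma exceed_sets_M:
  assumes "simple_data F t T k a \<xi>" "0 \<le> t" "countable D" "D \<subseteq> {t..s}" "t \<le> s"
  shows "{\<omega> \<in> space M. \<exists>d\<in>D. c \<le> \<theta> * simple_shift t k a \<xi> d \<omega>} \<in> sets M"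
  using exceed_sets[OF assms(1-4)] sets_F_subset[OF order_trans[OF assms(2,5)]] by blast

text \<open>Doob's maximal inequality for the exponential martingale of the shift, under the changed
  measure. Inserting the latest time b splits the event into earlier exceedances, covered by the
  induction hypothesis, and those occurring at b for the first time. Keeping the indicator on the
  right-hand side makes the two estimates additive.\<close>

lemma simple_maximal_finite:
  fixes c \<theta> :: real
  assumes sd: "simple_data F t T k a \<xi>" and t: "0 \<le> t" and D: "finite D"
    and s: "D \<subseteq> {t..s}" "t \<le> s" "s \<le> T"
  defines "U \<equiv> {\<omega> \<in> space M. \<exists>d\<in>D. c \<le> \<theta> * simple_shift t k a \<xi> d \<omega>}"
  shows "(\<integral>\<omega>. indicator U \<omega> * simple_density k a \<xi> s \<omega> \<partial>M) \<le>
    exp (\<theta>\<^sup>2 * (T - t) / 2 - c) * (\<integral>\<omega>. indicator U \<omega> * simple_density k a (\<lambda>i \<omega>. \<xi> i \<omega> - \<theta>) s \<omega> \<partial>M)"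
  using D s unfolding U_def
proof (induction D arbitrary: s rule: finite_linorder_max_induct)
  case empty
  then show ?case by simp
next
  case (insert b A)
  define UA where "UA = {\<omega> \<in> space M. \<exists>d\<in>A. c \<le> \<theta> * simple_shift t k a \<xi> d \<omega>}"
  define UB where "UB = {\<omega> \<in> space M. \<exists>d\<in>insert b A. c \<le> \<theta> * simple_shift t k a \<xi> d \<omega>}"
  define V where "V = UB - UA"
  define e where "e = exp (\<theta>\<^sup>2 * (T - t) / 2 - c)"
  define Z where "Z = simple_density k a \<xi>"
  define Z' where "Z' = simple_density k a (\<lambda>i \<omega>. \<xi> i \<omega> - \<theta>)"
  note sd' = simple_data_minus_const[OF sd, of \<theta>]
  have tb: "t \<le> b" "b \<le> s" "b \<le> T" using insert by auto
  have U: "UA \<in> sets (F b)" "UB \<in> sets (F b)" unfolding UA_def UB_def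
    by (rule exceed_sets[OF sd t]; use insert in \<open>force intro: countable_finite\<close>)+
  then have V: "V \<in> sets (F b)" unfolding V_def by auto
  have UM: "UA \<in> sets M" "UB \<in> sets M" "V \<in> sets M" using U V sets_F_subset[of b] tb t by auto
  have split: "indicator UB \<omega> = indicator UA \<omega> + (indicator V \<omega> :: real)" for \<omega>
    unfolding V_def UA_def UB_def by (auto split: split_indicator)
  have iZ: "integrable M (Z r)" "integrable M (Z' r)" if "t \<le> r" "r \<le> T" for r
    unfolding Z_def Z'_def using simple_density_integrable(1)[OF sd t that] simple_density_integrable(1)[OF sd' t that] by auto
  have iI: "integrable M (\<lambda>\<omega>. indicator B \<omega> * Z r \<omega>)" "integrable M (\<lambda>\<omega>. indicator B \<omega> * Z' r \<omega>)"
    if "B \<in> sets M" "t \<le> r" "r \<le> T" for r B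
    using that iZ by (auto intro: integrable_indicator_times)
  have IA: "(\<integral>\<omega>. indicator UA \<omega> * Z s \<omega> \<partial>M) \<le> e * (\<integral>\<omega>. indicator UA \<omega> * Z' s \<omega> \<partial>M)"
    unfolding UA_def Z_def Z'_def e_def by (rule insert.IH) (use insert in auto)
  \<comment> \<open>\<open>V\<close> belongs to \<open>F b\<close>, so both densities can be moved
    from s to b and back. At b the exceedance bounds the tilt factor below by 1 / \<open>e\<close>;
    the constant \<open>e\<close> uses T - t instead of b - t to be the same for all b.\<close>
  have "(\<integral>\<omega>. indicator V \<omega> * Z s \<omega> \<partial>M) = (\<integral>\<omega>. indicator V \<omega> * Z b \<omega> \<partial>M)"
    unfolding Z_def by (rule simple_density_martingale[OF sd t tb(1,2) insert(6) V])
  also have "\<dots> \<le> (\<integral>\<omega>. e * (indicator V \<omega> * Z' b \<omega>) \<partial>M)"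
  proof (rule integral_mono)
    fix \<omega>
    show "indicator V \<omega> * Z b \<omega> \<le> e * (indicator V \<omega> * Z' b \<omega>)"
    proof (cases "\<omega> \<in> V")
      case True
      then have c: "c \<le> \<theta> * simple_shift t k a \<xi> b \<omega>" unfolding V_def UA_def UB_def by auto
      have "\<theta>\<^sup>2 * (b - t) \<le> \<theta>\<^sup>2 * (T - t)" using tb by (intro mult_left_mono) auto
      then have "1 \<le> e * exp (\<theta> * simple_shift t k a \<xi> b \<omega> - \<theta>\<^sup>2 * (b - t) / 2)"
        unfolding e_def exp_add[symmetric] using c by simp
      then have "Z b \<omega> * 1 \<le> Z b \<omega> * (e * exp (\<theta> * simple_shift t k a \<xi> b \<omega> - \<theta>\<^sup>2 * (b - t) / 2))"
        unfolding Z_def by (intro mult_left_mono) auto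
      then show ?thesis using True unfolding Z_def Z'_def simple_density_shift[OF sd tb(1,3)] by (simp add: ac_simps)
    qed simp
  qed (use iI V UM tb in auto)
  also have "\<dots> = e * (\<integral>\<omega>. indicator V \<omega> * Z' s \<omega> \<partial>M)"
    unfolding Z'_def using simple_density_martingale[OF sd' t tb(1,2) insert(6) V] by simp
  finally have IV: "(\<integral>\<omega>. indicator V \<omega> * Z s \<omega> \<partial>M) \<le> e * (\<integral>\<omega>. indicator V \<omega> * Z' s \<omega> \<partial>M)" .
  have sT: "t \<le> s" "s \<le> T" using insert by auto
  have "(\<integral>\<omega>. indicator UB \<omega> * Z s \<omega> \<partial>M) = (\<integral>\<omega>. indicator UA \<omega> * Z s \<omega> \<partial>M) + (\<integral>\<omega>. indicator V \<omega> * Z s \<omega> \<partial>M)"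
    unfolding split distrib_right using iI UM sT by (intro Bochner_Integration.integral_add) auto
  moreover have "(\<integral>\<omega>. indicator UB \<omega> * Z' s \<omega> \<partial>M) = (\<integral>\<omega>. indicator UA \<omega> * Z' s \<omega> \<partial>M) + (\<integral>\<omega>. indicator V \<omega> * Z' s \<omega> \<partial>M)"
    unfolding split distrib_right using iI UM sT by (intro Bochner_Integration.integral_add) auto
  ultimately have "(\<integral>\<omega>. indicator UB \<omega> * Z s \<omega> \<partial>M) \<le> e * (\<integral>\<omega>. indicator UB \<omega> * Z' s \<omega> \<partial>M)"
    using IA IV by (simp add: distrib_left)
  then show ?case unfolding UB_def Z_def Z'_def e_def .
qed

text \<open>Exhaustion by finite subsets and dominated convergence. The tilted density has total
  mass 1, so its indicator can now be dropped.\<close>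

lemma simple_maximal_countable:
  fixes c \<theta> :: real
  assumes sd: "simple_data F t T k a \<xi>" and t: "0 \<le> t" and D: "countable D"
    and s: "D \<subseteq> {t..s}" "t \<le> s" "s \<le> T"
  defines "U \<equiv> {\<omega> \<in> space M. \<exists>d\<in>D. c \<le> \<theta> * simple_shift t k a \<xi> d \<omega>}"
  shows "(\<integral>\<omega>. indicator U \<omega> * simple_density k a \<xi> s \<omega> \<partial>M) \<le> exp (\<theta>\<^sup>2 * (T - t) / 2 - c)"
proof (cases "D = {}")
  case False
  define Dn where "Dn n = from_nat_into D ` {..n}" for n
  define G where "G n = {\<omega> \<in> space M. \<exists>d\<in>Dn n. c \<le> \<theta> * simple_shift t k a \<xi> d \<omega>}" for n
  define e where "e = exp (\<theta>\<^sup>2 * (T - t) / 2 - c)"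
  note sd' = simple_data_minus_const[OF sd, of \<theta>]
  have Dn: "finite (Dn n)" "Dn n \<subseteq> D" for n unfolding Dn_def using from_nat_into[OF False] by auto
  have UM: "G n \<in> sets M" "U \<in> sets M" for n
    unfolding G_def U_def
    using exceed_sets_M[OF sd t countable_finite[OF Dn(1)] order_trans[OF Dn(2) s(1)] s(2)]
      exceed_sets_M[OF sd t D s(1,2)] by blast+
  have Zm: "simple_density k a \<xi> s \<in> borel_measurable M"
    by (rule simple_density_measurable(1)[OF sd t s(2)])
  have "(\<lambda>n. \<integral>\<omega>. indicator (G n) \<omega> * simple_density k a \<xi> s \<omega> \<partial>M)
      \<longlonglongrightarrow> (\<integral>\<omega>. indicator U \<omega> * simple_density k a \<xi> s \<omega> \<partial>M)"
  proof (rule integral_dominated_convergence[where w = "simple_density k a \<xi> s"])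
    show "AE \<omega> in M. (\<lambda>n. indicator (G n) \<omega> * simple_density k a \<xi> s \<omega>)
        \<longlonglongrightarrow> indicator U \<omega> * simple_density k a \<xi> s \<omega>"
    proof (rule AE_I2, rule tendsto_mult_right)
      fix \<omega> assume "\<omega> \<in> space M"
      show "(\<lambda>n. indicator (G n) \<omega>) \<longlonglongrightarrow> (indicator U \<omega> :: real)"
      proof (cases "\<omega> \<in> U")
        case True
        then obtain d where d: "d \<in> D" "c \<le> \<theta> * simple_shift t k a \<xi> d \<omega>" unfolding U_def by auto
        then obtain m where m: "d = from_nat_into D m" using from_nat_into_surj[OF D] by metis
        have "\<forall>n\<ge>m. \<omega> \<in> G n"
          using d m \<open>\<omega> \<in> space M\<close> unfolding G_def Dn_def by auto
        then have "eventually (\<lambda>n. indicator (G n) \<omega> = (indicator U \<omega> :: real)) sequentially"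
          using True by (auto simp: eventually_sequentially intro!: exI[of _ m])
        then show ?thesis by (rule tendsto_eventually)
      next
        case False
        then have "\<omega> \<notin> G n" for n using Dn(2)[of n] unfolding U_def G_def by auto
        then show ?thesis using False by simp
      qed
    qed
    show "integrable M (simple_density k a \<xi> s)" by (rule simple_density_integrable[OF sd t s(2,3)])
    show "\<And>n. AE \<omega> in M. norm (indicator (G n) \<omega> * simple_density k a \<xi> s \<omega>) \<le> simple_density k a \<xi> s \<omega>"
      by (auto split: split_indicator)
  qed (use UM Zm in measurable)
  moreover have "(\<integral>\<omega>. indicator (G n) \<omega> * simple_density k a \<xi> s \<omega> \<partial>M) \<le> e" for n
  proof -
    have "(\<integral>\<omega>. indicator (G n) \<omega> * simple_density k a (\<lambda>i \<omega>. \<xi> i \<omega> - \<theta>) s \<omega> \<partial>M)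
        \<le> (\<integral>\<omega>. simple_density k a (\<lambda>i \<omega>. \<xi> i \<omega> - \<theta>) s \<omega> \<partial>M)"
      using simple_density_integrable(1)[OF sd' t s(2,3)] UM
      by (intro integral_mono integrable_indicator_times) (auto split: split_indicator)
    also have "\<dots> = 1" by (rule simple_density_integrable(2)[OF sd' t s(2,3)])
    finally have "e * (\<integral>\<omega>. indicator (G n) \<omega> * simple_density k a (\<lambda>i \<omega>. \<xi> i \<omega> - \<theta>) s \<omega> \<partial>M) \<le> e"
      unfolding e_def by simp
    moreover have "(\<integral>\<omega>. indicator (G n) \<omega> * simple_density k a \<xi> s \<omega> \<partial>M)
        \<le> e * (\<integral>\<omega>. indicator (G n) \<omega> * simple_density k a (\<lambda>i \<omega>. \<xi> i \<omega> - \<theta>) s \<omega> \<partial>M)"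
      unfolding G_def e_def by (rule simple_maximal_finite[OF sd t]) (use Dn[of n] s in auto)
    ultimately show ?thesis by linarith
  qed
  ultimately show ?thesis unfolding e_def by (intro LIMSEQ_le_const2) auto
qed (simp add: U_def)

text \<open>The tilts \<theta> = 1 and \<theta> = -1 cover the two signs. This is not the optimal
  Gaussian rate, but a bound that vanishes for large c and does not involve \<xi> is all that is
  required.\<close>

lemma simple_maximal:
  fixes c :: real
  assumes sd: "simple_data F t T k a \<xi>" and t: "0 \<le> t" and D: "countable D"
    and s: "D \<subseteq> {t..s}" "t \<le> s" "s \<le> T"
  defines "U \<equiv> {\<omega> \<in> space M. \<exists>d\<in>D. c \<le> \<bar>simple_shift t k a \<xi> d \<omega>\<bar>}"
  shows "U \<in> sets M"
    "(\<integral>\<omega>. indicator U \<omega> * simple_density k a \<xi> s \<omega> \<partial>M) \<le> 2 * exp ((T - t) / 2 - c)"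
proof -
  define U1 where "U1 = {\<omega> \<in> space M. \<exists>d\<in>D. c \<le> 1 * simple_shift t k a \<xi> d \<omega>}"
  define U2 where "U2 = {\<omega> \<in> space M. \<exists>d\<in>D. c \<le> (-1) * simple_shift t k a \<xi> d \<omega>}"
  have abs: "c \<le> \<bar>y\<bar> \<longleftrightarrow> c \<le> y \<or> c \<le> - y" for y :: real by linarith
  have eq: "U = U1 \<union> U2" unfolding U_def U1_def U2_def by (auto simp: abs)
  have UM: "U1 \<in> sets M" "U2 \<in> sets M"
    unfolding U1_def U2_def by (rule exceed_sets_M[OF sd t D s(1,2)])+
  then show U: "U \<in> sets M" unfolding eq by simp
  note iZ = simple_density_integrable(1)[OF sd t s(2,3)]
  have ii: "integrable M (\<lambda>\<omega>. indicator B \<omega> * simple_density k a \<xi> s \<omega>)" if "B \<in> sets M" for B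
    by (rule integrable_indicator_times[OF that iZ])
  have "(\<integral>\<omega>. indicator U \<omega> * simple_density k a \<xi> s \<omega> \<partial>M)
    \<le> (\<integral>\<omega>. indicator U1 \<omega> * simple_density k a \<xi> s \<omega> + indicator U2 \<omega> * simple_density k a \<xi> s \<omega> \<partial>M)"
    using ii UM U unfolding eq by (intro integral_mono) (auto split: split_indicator)
  also have "\<dots> = (\<integral>\<omega>. indicator U1 \<omega> * simple_density k a \<xi> s \<omega> \<partial>M) + (\<integral>\<omega>. indicator U2 \<omega> * simple_density k a \<xi> s \<omega> \<partial>M)"
    using ii UM by (intro Bochner_Integration.integral_add) auto
  also have "\<dots> \<le> exp ((T - t) / 2 - c) + exp ((T - t) / 2 - c)"
    using simple_maximal_countable[OF sd t D s, of c 1] simple_maximal_countable[OF sd t D s, of c "-1"]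
    unfolding U1_def U2_def by (intro add_mono) auto
  finally show "(\<integral>\<omega>. indicator U \<omega> * simple_density k a \<xi> s \<omega> \<partial>M) \<le> 2 * exp ((T - t) / 2 - c)" by simp
qed

text \<open>The square of the density of \<xi> is the density of 2 \<xi> times the exponential of
  the energy of \<xi>. The former has mass 1 and the energy is at most
  \<open>C\<^sup>2 * (s - t)\<close>, so the bound is uniform over all partitions.\<close>

lemma simple_density_square:
  assumes sd: "simple_data F t T k a \<xi>" and t: "0 \<le> t" "t \<le> s" "s \<le> T"
    and C: "\<And>i \<omega>. i < k \<Longrightarrow> \<bar>\<xi> i \<omega>\<bar> \<le> C"
  shows "integrable M (\<lambda>\<omega>. (simple_density k a \<xi> s \<omega>)\<^sup>2)"
    "(\<integral>\<omega>. (simple_density k a \<xi> s \<omega>)\<^sup>2 \<partial>M) \<le> exp (C\<^sup>2 * (s - t))"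
proof -
  note sd2 = simple_data_scale[OF sd, of 2]
  note i2 = simple_density_integrable[OF sd2 t]
  have le: "(simple_density k a \<xi> s \<omega>)\<^sup>2 \<le> exp (C\<^sup>2 * (s - t)) * simple_density k a (\<lambda>i \<omega>. 2 * \<xi> i \<omega>) s \<omega>" for \<omega>
  proof -
    have "simple_energy k a \<xi> s \<omega> \<le> simple_drift k a (\<lambda>i \<omega>. C\<^sup>2) s \<omega>"
      using C by (intro simple_drift_mono[OF sd]) (metis abs_le_square_iff abs_of_nonneg abs_ge_zero order_trans)
    also have "\<dots> = C\<^sup>2 * (s - t)" by (rule simple_integral_const[OF sd t(2,3)])
    finally have "simple_energy k a \<xi> s \<omega> \<le> C\<^sup>2 * (s - t)" .
    moreover have "simple_energy k a (\<lambda>i \<omega>. 2 * \<xi> i \<omega>) s \<omega> = 4 * simple_energy k a \<xi> s \<omega>"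
      by (simp add: power_mult_distrib simple_integral_linear(3))
    ultimately show ?thesis
      unfolding simple_density_def power2_eq_square exp_add[symmetric] simple_integral_linear(3)
      by (simp add: power2_eq_square)
  qed
  show i: "integrable M (\<lambda>\<omega>. (simple_density k a \<xi> s \<omega>)\<^sup>2)"
    by (rule Bochner_Integration.integrable_bound[OF integrable_mult_right[OF i2(1), of "exp (C\<^sup>2 * (s - t))"]])
      (use le simple_density_measurable[OF sd t(1,2)] in \<open>auto intro!: borel_measurable_power\<close>)
  have "(\<integral>\<omega>. (simple_density k a \<xi> s \<omega>)\<^sup>2 \<partial>M) \<le> (\<integral>\<omega>. exp (C\<^sup>2 * (s - t)) * simple_density k a (\<lambda>i \<omega>. 2 * \<xi> i \<omega>) s \<omega> \<partial>M)"
    using i i2 le by (intro integral_mono) auto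
  then show "(\<integral>\<omega>. (simple_density k a \<xi> s \<omega>)\<^sup>2 \<partial>M) \<le> exp (C\<^sup>2 * (s - t))" using i2 by simp
qed

text \<open>Exponential Chebyshev bound, in place of the Ito isometry: where the energy is at most
  \<delta>, the density of the integrand - \<rho> \<xi> with \<rho> = \<theta> or \<rho> = -
  \<theta> is large, although its mean is 1. Small energy in probability thus forces a small
  stochastic integral in probability.\<close>

lemma simple_integral_tail:
  assumes sd: "simple_data F t T k a \<xi>" and t: "0 \<le> t" "t \<le> s" "s \<le> T" and \<theta>: "0 < \<theta>"
  shows "prob {\<omega> \<in> space M. \<epsilon> < \<bar>simple_integral W k a \<xi> s \<omega>\<bar> \<and> simple_energy k a \<xi> s \<omega> \<le> \<delta>}
     \<le> 2 * exp (\<theta>\<^sup>2 * \<delta> / 2 - \<theta> * \<epsilon>)"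
proof -
  define S where "S = simple_integral W k a \<xi> s"
  define V where "V = simple_energy k a \<xi> s"
  have [measurable]: "S \<in> borel_measurable M" "V \<in> borel_measurable M"
    unfolding S_def V_def using simple_density_measurable[OF sd t(1,2)] by auto
  have one: "prob {\<omega> \<in> space M. \<theta> * \<epsilon> < \<rho> * S \<omega> \<and> V \<omega> \<le> \<delta>} \<le> exp (\<theta>\<^sup>2 * \<delta> / 2 - \<theta> * \<epsilon>)"
    if \<rho>: "\<rho>\<^sup>2 = \<theta>\<^sup>2" for \<rho>
  proof -
    define B where "B = {\<omega> \<in> space M. \<theta> * \<epsilon> < \<rho> * S \<omega> \<and> V \<omega> \<le> \<delta>}"
    define Z where "Z = simple_density k a (\<lambda>i \<omega>. (- \<rho>) * \<xi> i \<omega>) s"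
    have B: "B \<in> sets M" unfolding B_def by measurable
    have Z: "integrable M Z" "(\<integral>\<omega>. Z \<omega> \<partial>M) = 1"
      unfolding Z_def using simple_density_integrable[OF simple_data_scale[OF sd, of "- \<rho>"] t] by auto
    have "indicator B \<omega> \<le> exp (\<theta>\<^sup>2 * \<delta> / 2 - \<theta> * \<epsilon>) * Z \<omega>" for \<omega>
    proof (cases "\<omega> \<in> B")
      case True
      have sq: "((- \<rho>) * \<xi> i \<omega>)\<^sup>2 = \<theta>\<^sup>2 * (\<xi> i \<omega>)\<^sup>2" for i \<omega> using \<rho> by (simp add: power_mult_distrib)
      have Zeq: "Z \<omega> = exp (\<rho> * S \<omega> - \<theta>\<^sup>2 * V \<omega> / 2)"
        unfolding Z_def simple_density_def sq simple_integral_linear(3) S_def V_def by simp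
      have "\<theta>\<^sup>2 * V \<omega> \<le> \<theta>\<^sup>2 * \<delta>" using True unfolding B_def by (intro mult_left_mono) auto
      then have "0 \<le> (\<theta>\<^sup>2 * \<delta> / 2 - \<theta> * \<epsilon>) + (\<rho> * S \<omega> - \<theta>\<^sup>2 * V \<omega> / 2)"
        using True unfolding B_def by simp
      then show ?thesis using True unfolding Zeq exp_add[symmetric] by simp
    qed (simp add: Z_def)
    then have "(\<integral>\<omega>. indicator B \<omega> \<partial>M) \<le> (\<integral>\<omega>. exp (\<theta>\<^sup>2 * \<delta> / 2 - \<theta> * \<epsilon>) * Z \<omega> \<partial>M)"
      using Z B by (intro integral_mono) (auto simp: emeasure_eq_measure)
    then show ?thesis using Z B unfolding B_def[symmetric] by simp
  qed
  have sub: "{\<omega> \<in> space M. \<epsilon> < \<bar>S \<omega>\<bar> \<and> V \<omega> \<le> \<delta>} \<subseteq>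
     {\<omega> \<in> space M. \<theta> * \<epsilon> < \<theta> * S \<omega> \<and> V \<omega> \<le> \<delta>} \<union> {\<omega> \<in> space M. \<theta> * \<epsilon> < (- \<theta>) * S \<omega> \<and> V \<omega> \<le> \<delta>}"
  proof
    fix \<omega> assume a: "\<omega> \<in> {\<omega> \<in> space M. \<epsilon> < \<bar>S \<omega>\<bar> \<and> V \<omega> \<le> \<delta>}"
    then have "\<theta> * \<epsilon> < \<theta> * \<bar>S \<omega>\<bar>" using \<theta> by simp
    then show "\<omega> \<in> {\<omega> \<in> space M. \<theta> * \<epsilon> < \<theta> * S \<omega> \<and> V \<omega> \<le> \<delta>} \<union> {\<omega> \<in> space M. \<theta> * \<epsilon> < (- \<theta>) * S \<omega> \<and> V \<omega> \<le> \<delta>}"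
      using a by (cases "0 \<le> S \<omega>") (auto simp: abs_if)
  qed
  have "prob {\<omega> \<in> space M. \<epsilon> < \<bar>S \<omega>\<bar> \<and> V \<omega> \<le> \<delta>} \<le> prob ({\<omega> \<in> space M. \<theta> * \<epsilon> < \<theta> * S \<omega> \<and> V \<omega> \<le> \<delta>}
     \<union> {\<omega> \<in> space M. \<theta> * \<epsilon> < (- \<theta>) * S \<omega> \<and> V \<omega> \<le> \<delta>})"
    by (rule finite_measure_mono[OF sub]) measurable
  also have "\<dots> \<le> prob {\<omega> \<in> space M. \<theta> * \<epsilon> < \<theta> * S \<omega> \<and> V \<omega> \<le> \<delta>}
     + prob {\<omega> \<in> space M. \<theta> * \<epsilon> < (- \<theta>) * S \<omega> \<and> V \<omega> \<le> \<delta>}"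
    by (rule measure_Un_le) measurable
  also have "\<dots> \<le> 2 * exp (\<theta>\<^sup>2 * \<delta> / 2 - \<theta> * \<epsilon>)"
    using one[of \<theta>] one[of "- \<theta>"] by simp
  finally show ?thesis unfolding S_def V_def .
qed

end

section \<open>Pathwise approximation of drift and energy\<close>

lemma tendsto_upperbound_zero:
  fixes f :: "nat \<Rightarrow> real"
  assumes "\<And>n. 0 \<le> f n" "\<And>e. 0 < e \<Longrightarrow> eventually (\<lambda>n. f n < e) sequentially"
  shows "f \<longlonglongrightarrow> 0"
  by (rule order_tendstoI) (use assms in \<open>auto intro: always_eventually less_le_trans\<close>)

lemma simple_process_value:
  assumes "a 0 = t" "a k = T" "\<And>i. i < k \<Longrightarrow> a i \<le> a (Suc i)" and r: "t < r" "r \<le> T"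
  obtains j where "j < k" "a j < r" "r \<le> a (Suc j)" "\<And>\<xi> \<omega>. simple_process k a \<xi> r \<omega> = \<xi> j \<omega>"
proof -
  have mono: "a i \<le> a j" if "i \<le> j" "j \<le> k" for i j
    using that(1) by (induction j rule: dec_induct) (use that(2) assms(3) in \<open>auto intro: order_trans\<close>)
  define P where "P j \<longleftrightarrow> r \<le> a j" for j
  define j' where "j' = (LEAST j. P j)"
  have "P k" unfolding P_def using assms by simp
  then have j': "P j'" "j' \<le> k" "\<And>i. i < j' \<Longrightarrow> \<not> P i"
    unfolding j'_def by (auto intro: LeastI Least_le dest: not_less_Least)
  have "j' \<noteq> 0" using j'(1) r assms(1) unfolding P_def by (cases j') auto
  then obtain j where j: "j' = Suc j" by (cases j') auto
  have jk: "j < k" "a j < r" "r \<le> a (Suc j)" using j' j unfolding P_def by (auto simp: not_le)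
  have "simple_process k a \<xi> r \<omega> = \<xi> j \<omega>" for \<xi> \<omega>
  proof -
    have "indicator {a i<..a (Suc i)} r = (if i = j then 1 else 0 :: real)" if i: "i < k" for i
    proof (cases i j rule: linorder_cases)
      case less
      then have "a (Suc i) \<le> a j" using mono[of "Suc i" j] jk by auto
      then show ?thesis using less jk by auto
    next
      case greater
      then have "a (Suc j) \<le> a i" using mono[of "Suc j" i] i by auto
      then show ?thesis using greater jk by auto
    qed (use jk in auto)
    then have "simple_process k a \<xi> r \<omega> = (\<Sum>i<k. \<xi> i \<omega> * (if i = j then 1 else 0))"
      unfolding simple_process_def by (intro sum.cong) auto
    also have "\<dots> = \<xi> j \<omega>" using jk by (simp add: if_distrib[where f = "\<lambda>y. _ * y"] cong: if_cong)
    finally show ?thesis .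
  qed
  then show ?thesis using that jk by blast
qed

lemma simple_process_measurable[measurable]: "(\<lambda>r. simple_process k a \<xi> r \<omega>) \<in> borel_measurable borel"
  unfolding simple_process_def by measurable

lemma simple_process_bounded: "\<exists>B\<ge>0. \<forall>r. \<bar>simple_process k a \<xi> r \<omega>\<bar> \<le> B"
proof (intro exI[of _ "\<Sum>i<k. \<bar>\<xi> i \<omega>\<bar>"] conjI allI)
  fix r
  have "\<bar>simple_process k a \<xi> r \<omega>\<bar> \<le> (\<Sum>i<k. \<bar>\<xi> i \<omega> * indicator {a i<..a (Suc i)} r\<bar>)"
    unfolding simple_process_def by (rule sum_abs)
  also have "\<dots> \<le> (\<Sum>i<k. \<bar>\<xi> i \<omega>\<bar>)" by (intro sum_mono) (auto split: split_indicator)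
  finally show "\<bar>simple_process k a \<xi> r \<omega>\<bar> \<le> (\<Sum>i<k. \<bar>\<xi> i \<omega>\<bar>)" .
qed (simp add: sum_nonneg)

lemma integrable_lborel_Icc: "integrable lborel (indicator {t..s::real} :: real \<Rightarrow> real)"
  by (rule integrable_real_indicator) (auto simp: emeasure_lborel_Icc_eq)

lemma set_integrable_bounded:
  fixes f :: "real \<Rightarrow> real"
  assumes "(\<lambda>r. indicator {t..s} r * f r) \<in> borel_measurable borel" "\<And>r. r \<in> {t..s} \<Longrightarrow> \<bar>f r\<bar> \<le> B"
  shows "set_integrable lborel {t..s} f"
  unfolding set_integrable_def
proof (rule Bochner_Integration.integrable_bound[where f = "\<lambda>r. indicator {t..s} r * B"])
  show "integrable lborel (\<lambda>r. indicator {t..s} r * B)"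
    by (intro integrable_mult_left integrable_lborel_Icc)
qed (use assms in \<open>auto split: split_indicator intro: order_trans[OF _ abs_ge_self]\<close>)

text \<open>Every point of (t, T] lies in exactly one cell, so \<open>f\<close> applied to the
  simple process is the simple process with values \<open>f (\<xi> i)\<close>, even if
  \<open>f 0\<close> is not 0. Only at t, outside all cells, can this fail, and that single point is
  discarded as a null set.\<close>

lemma simple_drift_eq_integral:
  fixes \<omega> :: 'a
  assumes "a 0 = t" "a k = T" "\<And>i. i < k \<Longrightarrow> a i \<le> a (Suc i)" and s: "t \<le> s" "s \<le> T"
  shows "(LBINT r:{t..s}. f (simple_process k a \<xi> r \<omega>)) =
    simple_integral (\<lambda>s \<omega>. s) k a (\<lambda>i \<omega>. f (\<xi> i \<omega>)) s \<omega>"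
proof -
  have ge: "t \<le> a i" if "i \<le> k" for i
    using that by (induction i) (use assms in \<open>auto intro: order_trans\<close>)
  have "(LBINT r:{t..s}. f (simple_process k a \<xi> r \<omega>)) =
      (\<integral>r. (\<Sum>i<k. f (\<xi> i \<omega>) * indicator {min s (a i)<..min s (a (Suc i))} r) \<partial>lborel)"
    unfolding set_lebesgue_integral_def
  proof (rule integral_discrete_difference[where X = "{t}"])
    fix r assume rt: "r \<notin> {t}"
    show "indicator {t..s} r *\<^sub>R f (simple_process k a \<xi> r \<omega>)
       = (\<Sum>i<k. f (\<xi> i \<omega>) * indicator {min s (a i)<..min s (a (Suc i))} r)"
    proof (cases "t < r \<and> r \<le> s")
      case True
      then have r: "t < r" "r \<le> T" "r \<le> s" using s by auto
      obtain j where j: "j < k" "\<And>\<xi> (\<omega>::'a). simple_process k a \<xi> r \<omega> = \<xi> j \<omega>"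
        using simple_process_value[OF assms(1-3) r(1,2)] by metis
      have "(\<Sum>i<k. f (\<xi> i \<omega>) * indicator {min s (a i)<..min s (a (Suc i))} r) = simple_process k a (\<lambda>i \<omega>. f (\<xi> i \<omega>)) r \<omega>"
        unfolding simple_process_def using r by (intro sum.cong) (auto split: split_indicator)
      then have "(\<Sum>i<k. f (\<xi> i \<omega>) * indicator {min s (a i)<..min s (a (Suc i))} r) = f (\<xi> j \<omega>)"
        by (simp only: j(2))
      then show ?thesis using True by (simp only: j(2)) simp
    next
      case False
      have "indicator {min s (a i)<..min s (a (Suc i))} r = (0::real)" if "i < k" for i
        using False rt ge[of i] that s by (auto split: split_indicator)
      then show ?thesis using False rt by (auto split: split_indicator)
    qed
  qed auto
  also have "\<dots> = (\<Sum>i<k. f (\<xi> i \<omega>) * (min s (a (Suc i)) - min s (a i)))"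
  proof -
    have "min s (a i) \<le> min s (a (Suc i))" if "i < k" for i using assms(3)[OF that] by auto
    then show ?thesis by (subst Bochner_Integration.integral_sum) (auto intro!: sum.cong)
  qed
  finally show ?thesis unfolding simple_integral_def .
qed

lemma integral_abs_le_square:
  fixes f :: "real \<Rightarrow> real"
  assumes "t \<le> s" "0 < \<epsilon>" and i: "set_integrable lborel {t..s} f" "set_integrable lborel {t..s} (\<lambda>r. (f r)\<^sup>2)"
  shows "(LBINT r:{t..s}. \<bar>f r\<bar>) \<le> \<epsilon> * (s - t) + (LBINT r:{t..s}. (f r)\<^sup>2) / \<epsilon>"
proof -
  have "(LBINT r:{t..s}. \<bar>f r\<bar>) \<le> (LBINT r:{t..s}. \<epsilon> + (f r)\<^sup>2 / \<epsilon>)"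
  proof (rule set_integral_mono)
    show "set_integrable lborel {t..s} (\<lambda>r. \<bar>f r\<bar>)" using i(1) by (rule set_integrable_abs)
    show "set_integrable lborel {t..s} (\<lambda>r. \<epsilon> + (f r)\<^sup>2 / \<epsilon>)"
      using i(2) by (intro set_integral_add set_integrable_divide) (auto simp: set_integrable_def integrable_lborel_Icc)
    fix r
    have "0 \<le> (\<bar>f r\<bar> - \<epsilon>)\<^sup>2 + \<epsilon> * \<bar>f r\<bar>" using assms by simp
    then have "\<epsilon> * \<bar>f r\<bar> \<le> \<epsilon>\<^sup>2 + (f r)\<^sup>2" by (simp add: power2_eq_square algebra_simps)
    then show "\<bar>f r\<bar> \<le> \<epsilon> + (f r)\<^sup>2 / \<epsilon>" using assms by (simp add: field_simps power2_eq_square)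
  qed
  also have "\<dots> = (LBINT r:{t..s}. \<epsilon>) + (LBINT r:{t..s}. (f r)\<^sup>2 / \<epsilon>)"
    using i(2) by (intro set_integral_add set_integrable_divide) (auto simp: set_integrable_def integrable_lborel_Icc)
  also have "\<dots> = \<epsilon> * (s - t) + (LBINT r:{t..s}. (f r)\<^sup>2) / \<epsilon>"
    using assms(1) by (simp add: set_lebesgue_integral_def)
  finally show ?thesis .
qed

lemma set_integrable_L2:
  fixes f h :: "real \<Rightarrow> real"
  assumes h: "continuous_on {t..v} h" and f: "f \<in> borel_measurable borel" "\<exists>B. \<forall>r. \<bar>f r\<bar> \<le> B"
  shows "set_integrable lborel {t..v} (\<lambda>r. f r - h r)" "set_integrable lborel {t..v} (\<lambda>r. (f r - h r)\<^sup>2)"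
    "set_integrable lborel {t..v} h" "set_integrable lborel {t..v} (\<lambda>r. (h r)\<^sup>2)"
    "set_integrable lborel {t..v} f" "set_integrable lborel {t..v} (\<lambda>r. (f r)\<^sup>2)"
proof -
  have "compact (h ` {t..v})" by (intro compact_continuous_image h) auto
  then obtain C where C: "\<And>y. y \<in> h ` {t..v} \<Longrightarrow> \<bar>y\<bar> \<le> C" using compact_imp_bounded bounded_real by metis
  obtain B where B: "\<And>r. \<bar>f r\<bar> \<le> B" using f(2) by blast
  note [measurable] = f(1)
  have [measurable]: "(\<lambda>r. indicator {t..v} r * h r) \<in> borel_measurable borel"
    using borel_measurable_continuous_on_indicator[of "{t..v}" h] h by auto
  have eq: "indicator {t..v} r * (f r - h r) = indicator {t..v} r * f r - indicator {t..v} r * h r"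
    "indicator {t..v} r * (f r - h r)\<^sup>2 = (indicator {t..v} r * f r - indicator {t..v} r * h r)\<^sup>2"
    "indicator {t..v} r * (h r)\<^sup>2 = (indicator {t..v} r * h r)\<^sup>2" for r
    by (auto split: split_indicator)
  have le: "\<bar>f r - h r\<bar> \<le> B + C" "\<bar>h r\<bar> \<le> C" if "r \<in> {t..v}" for r
    using B[of r] C[of "h r"] that by auto
  have sq: "\<bar>y\<^sup>2\<bar> \<le> c\<^sup>2" if "\<bar>y\<bar> \<le> c" for y c :: real
    using that by (simp add: abs_le_square_iff[symmetric])
  show "set_integrable lborel {t..v} (\<lambda>r. f r - h r)"
    by (rule set_integrable_bounded[where B = "B + C"]) (use le in \<open>auto simp: eq(1)\<close>)
  show "set_integrable lborel {t..v} (\<lambda>r. (f r - h r)\<^sup>2)"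
    by (rule set_integrable_bounded[where B = "(B + C)\<^sup>2"]) (use le sq in \<open>auto simp: eq(2)\<close>)
  show "set_integrable lborel {t..v} h"
    by (rule set_integrable_bounded[where B = C]) (use le in auto)
  show "set_integrable lborel {t..v} (\<lambda>r. (h r)\<^sup>2)"
    by (rule set_integrable_bounded[where B = "C\<^sup>2"]) (use le sq in \<open>auto simp: eq(3)\<close>)
  show "set_integrable lborel {t..v} f"
    by (rule set_integrable_bounded[where B = B]) (use B in auto)
  show "set_integrable lborel {t..v} (\<lambda>r. (f r)\<^sup>2)"
    by (rule set_integrable_bounded[where B = "B\<^sup>2"]) (use B sq in auto)
qed

text \<open>Since \<open>f\<^sup>2 - h\<^sup>2 = (f - h)\<^sup>2 + 2 h (f - h)\<close>, convergence in \<open>L\<^sup>2\<close> gives that of the energies;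
  \<open>integral_abs_le_square\<close> replaces the Cauchy-Schwarz inequality.\<close>
lemma L2_convergence_drift_energy:
  fixes f :: "nat \<Rightarrow> real \<Rightarrow> real" and h :: "real \<Rightarrow> real"
  assumes s: "t \<le> s" "s \<le> T" and h: "continuous_on {t..T} h"
    and f: "\<And>n. f n \<in> borel_measurable borel" "\<And>n. \<exists>B. \<forall>r. \<bar>f n r\<bar> \<le> B"
    and lim: "(\<lambda>n. LBINT r:{t..T}. (f n r - h r)\<^sup>2) \<longlonglongrightarrow> 0"
  shows "(\<lambda>n. LBINT r:{t..s}. \<bar>f n r - h r\<bar>) \<longlonglongrightarrow> 0"
    and "(\<lambda>n. LBINT r:{t..s}. f n r) \<longlonglongrightarrow> (LBINT r:{t..s}. h r)"
    and "(\<lambda>n. LBINT r:{t..s}. (f n r)\<^sup>2) \<longlonglongrightarrow> (LBINT r:{t..s}. (h r)\<^sup>2)"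
proof -
  have hs: "continuous_on {t..s} h" using h s by (auto intro: continuous_on_subset)
  have "compact (h ` {t..T})" by (intro compact_continuous_image h) auto
  then obtain C where C: "\<And>y. y \<in> h ` {t..T} \<Longrightarrow> \<bar>y\<bar> \<le> C" using compact_imp_bounded bounded_real by metis
  have hb: "\<bar>h r\<bar> \<le> C" if "r \<in> {t..T}" for r using C that by auto
  have C0: "0 \<le> C" using hb[of t] s by auto
  note int = set_integrable_L2[OF continuous_on_subset[OF h] f]
  have s': "{t..s} \<subseteq> {t..T}" using s by auto
  have J: "(LBINT r:{t..s}. (f n r - h r)\<^sup>2) \<le> (LBINT r:{t..T}. (f n r - h r)\<^sup>2)" for n
    unfolding set_lebesgue_integral_def
    using int(2)[OF s', of n] int(2)[OF order_refl, of n] s(2)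
    by (intro integral_mono) (auto simp: set_integrable_def split: split_indicator)
  have J0: "0 \<le> (LBINT r:{t..s}. (f n r - h r)\<^sup>2)" for n
    unfolding set_lebesgue_integral_def by (intro integral_nonneg_AE) auto
  have limJ: "(\<lambda>n. LBINT r:{t..s}. (f n r - h r)\<^sup>2) \<longlonglongrightarrow> 0"
    by (rule tendsto_sandwich[OF _ _ tendsto_const lim]) (use J J0 in auto)
  show abs: "(\<lambda>n. LBINT r:{t..s}. \<bar>f n r - h r\<bar>) \<longlonglongrightarrow> 0"
  proof (rule tendsto_upperbound_zero)
    show "0 \<le> (LBINT r:{t..s}. \<bar>f n r - h r\<bar>)" for n
      unfolding set_lebesgue_integral_def by (intro integral_nonneg_AE) auto
    fix e :: real assume e: "0 < e"
    \<comment> \<open>The weight is fixed first, so that the length term stays below e / 2; the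
      summand 1 in the denominator covers s = t. The squared term divided by this fixed
      \<open>d\<close> still tends to zero.\<close>
    define d where "d = e / (2 * (s - t + 1))"
    have d: "0 < d" "d * (s - t) < e / 2 * 1"
      unfolding d_def using e s by (simp, simp add: field_simps)
    have "(\<lambda>n. d * (s - t) + (LBINT r:{t..s}. (f n r - h r)\<^sup>2) / d) \<longlonglongrightarrow> d * (s - t) + 0 / d"
      using limJ d by (intro tendsto_intros) auto
    then have "eventually (\<lambda>n. d * (s - t) + (LBINT r:{t..s}. (f n r - h r)\<^sup>2) / d < e) sequentially"
      by (rule order_tendstoD(2)) (use d(2) e in simp)
    then show "eventually (\<lambda>n. (LBINT r:{t..s}. \<bar>f n r - h r\<bar>) < e) sequentially"
    proof eventually_elim
      case (elim n)
      then show ?case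
        using integral_abs_le_square[OF s(1) d(1) int(1)[OF s', of n] int(2)[OF s', of n]] by linarith
    qed
  qed
  show "(\<lambda>n. LBINT r:{t..s}. f n r) \<longlonglongrightarrow> (LBINT r:{t..s}. h r)"
  proof (rule LIM_zero_cancel, rule Lim_null_comparison[OF _ abs])
    show "eventually (\<lambda>n. norm ((LBINT r:{t..s}. f n r) - (LBINT r:{t..s}. h r)) \<le> (LBINT r:{t..s}. \<bar>f n r - h r\<bar>)) sequentially"
    proof (rule always_eventually, rule allI)
      fix n
      have "(LBINT r:{t..s}. f n r) - (LBINT r:{t..s}. h r) = (LBINT r:{t..s}. f n r - h r)"
        using int[OF s'] by (intro set_integral_diff(2)[symmetric]) auto
      then show "norm ((LBINT r:{t..s}. f n r) - (LBINT r:{t..s}. h r)) \<le> (LBINT r:{t..s}. \<bar>f n r - h r\<bar>)"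
        using set_integral_norm_bound[OF int(1)[OF s', of n]] by simp
    qed
  qed
  show "(\<lambda>n. LBINT r:{t..s}. (f n r)\<^sup>2) \<longlonglongrightarrow> (LBINT r:{t..s}. (h r)\<^sup>2)"
  proof (rule LIM_zero_cancel, rule Lim_null_comparison)
    show "(\<lambda>n. (LBINT r:{t..s}. (f n r - h r)\<^sup>2) + 2 * C * (LBINT r:{t..s}. \<bar>f n r - h r\<bar>)) \<longlonglongrightarrow> 0"
      using tendsto_add[OF limJ tendsto_mult[OF tendsto_const[of "2 * C"] abs]] by simp
    show "eventually (\<lambda>n. norm ((LBINT r:{t..s}. (f n r)\<^sup>2) - (LBINT r:{t..s}. (h r)\<^sup>2)) \<le>
        (LBINT r:{t..s}. (f n r - h r)\<^sup>2) + 2 * C * (LBINT r:{t..s}. \<bar>f n r - h r\<bar>)) sequentially"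
    proof (rule always_eventually, rule allI)
      fix n
      note i = int(1)[OF s', of n] int(2)[OF s', of n] int(3)[OF s'] int(4)[OF s']
        int(5)[OF s', of n] int(6)[OF s', of n]
      have ia: "set_integrable lborel {t..s} (\<lambda>r. \<bar>f n r - h r\<bar>)" using i(1) by (rule set_integrable_abs)
      have id: "set_integrable lborel {t..s} (\<lambda>r. (f n r)\<^sup>2 - (h r)\<^sup>2)" using i by (intro set_integral_diff(1)) auto
      have isum: "set_integrable lborel {t..s} (\<lambda>r. (f n r - h r)\<^sup>2 + 2 * C * \<bar>f n r - h r\<bar>)"
        using i ia by (intro set_integral_add(1) set_integrable_mult_right) auto
      have "norm ((LBINT r:{t..s}. (f n r)\<^sup>2) - (LBINT r:{t..s}. (h r)\<^sup>2)) = norm (LBINT r:{t..s}. (f n r)\<^sup>2 - (h r)\<^sup>2)"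
        using i by (subst set_integral_diff(2)) auto
      also have "\<dots> \<le> (LBINT r:{t..s}. norm ((f n r)\<^sup>2 - (h r)\<^sup>2))" by (rule set_integral_norm_bound[OF id])
      also have "\<dots> \<le> (LBINT r:{t..s}. (f n r - h r)\<^sup>2 + 2 * C * \<bar>f n r - h r\<bar>)"
      proof (rule set_integral_mono[OF set_integrable_norm[OF id] isum])
        fix r assume r: "r \<in> {t..s}"
        have "(f n r)\<^sup>2 - (h r)\<^sup>2 = (f n r - h r)\<^sup>2 + 2 * h r * (f n r - h r)"
          by (simp add: power2_eq_square algebra_simps)
        then have "norm ((f n r)\<^sup>2 - (h r)\<^sup>2) \<le> (f n r - h r)\<^sup>2 + 2 * \<bar>h r\<bar> * \<bar>f n r - h r\<bar>"
          using abs_triangle_ineq[of "(f n r - h r)\<^sup>2" "2 * h r * (f n r - h r)"] by (simp add: abs_mult)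
        also have "\<dots> \<le> (f n r - h r)\<^sup>2 + 2 * C * \<bar>f n r - h r\<bar>"
          using hb[of r] r s by (intro add_left_mono mult_right_mono) auto
        finally show "norm ((f n r)\<^sup>2 - (h r)\<^sup>2) \<le> (f n r - h r)\<^sup>2 + 2 * C * \<bar>f n r - h r\<bar>" .
      qed
      also have "\<dots> = (LBINT r:{t..s}. (f n r - h r)\<^sup>2) + 2 * C * (LBINT r:{t..s}. \<bar>f n r - h r\<bar>)"
        using i ia by (subst set_integral_add(2)) auto
      finally show "norm ((LBINT r:{t..s}. (f n r)\<^sup>2) - (LBINT r:{t..s}. (h r)\<^sup>2)) \<le>
        (LBINT r:{t..s}. (f n r - h r)\<^sup>2) + 2 * C * (LBINT r:{t..s}. \<bar>f n r - h r\<bar>)" .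
    qed
  qed
qed

section \<open>Approximation of the Ito integral\<close>

lemma converges_in_prob_subseq:
  assumes "converges_in_prob M Y L" "strict_mono \<phi>"
  shows "converges_in_prob M (\<lambda>n. Y (\<phi> n)) L"
  unfolding converges_in_prob_def
proof (intro conjI allI impI)
  fix \<epsilon> :: real assume "0 < \<epsilon>"
  then have "(\<lambda>n. measure M {\<omega>\<in>space M. \<epsilon> < \<bar>Y n \<omega> - L \<omega>\<bar>}) \<longlonglongrightarrow> 0"
    using assms(1) unfolding converges_in_prob_def by auto
  from LIMSEQ_subseq_LIMSEQ[OF this assms(2)]
  show "(\<lambda>n. measure M {\<omega>\<in>space M. \<epsilon> < \<bar>Y (\<phi> n) \<omega> - L \<omega>\<bar>}) \<longlonglongrightarrow> 0" by (simp add: o_def)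
qed (use assms(1) in \<open>auto simp: converges_in_prob_def\<close>)

context prob_space
begin

text \<open>Truncating the distance at 1 turns convergence in probability into convergence in L1,
  which has an almost surely convergent subsequence. Along it the truncation is eventually
  inactive.\<close>

lemma converges_in_prob_AE_subseq:
  assumes Y: "converges_in_prob M Y L"
  obtains \<phi> :: "nat \<Rightarrow> nat" where "strict_mono \<phi>" "AE \<omega> in M. (\<lambda>n. Y (\<phi> n) \<omega>) \<longlonglongrightarrow> L \<omega>"
proof -
  have [measurable]: "Y n \<in> borel_measurable M" "L \<in> borel_measurable M" for n
    using Y unfolding converges_in_prob_def by auto
  have lim: "(\<lambda>n. prob {\<omega>\<in>space M. \<epsilon> < \<bar>Y n \<omega> - L \<omega>\<bar>}) \<longlonglongrightarrow> 0" if "0 < \<epsilon>" for \<epsilon>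
    using Y that unfolding converges_in_prob_def by auto
  define u where "u n \<omega> = min 1 \<bar>Y n \<omega> - L \<omega>\<bar>" for n \<omega>
  have [measurable]: "u n \<in> borel_measurable M" for n unfolding u_def by measurable
  have u: "0 \<le> u n \<omega>" "u n \<omega> \<le> 1" for n \<omega> unfolding u_def by auto
  have ui: "integrable M (u n)" for n
    by (rule integrable_const_bound[where B = 1]) (use u in auto)
  have "(\<lambda>n. \<integral>\<omega>. norm (u n \<omega>) \<partial>M) \<longlonglongrightarrow> 0"
  proof (rule tendsto_upperbound_zero)
    fix e :: real assume e: "0 < e"
    have "eventually (\<lambda>n. prob {\<omega>\<in>space M. e / 2 < \<bar>Y n \<omega> - L \<omega>\<bar>} < e / 2) sequentially"
      by (rule order_tendstoD(2)[OF lim]) (use e in auto)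
    then show "eventually (\<lambda>n. (\<integral>\<omega>. norm (u n \<omega>) \<partial>M) < e) sequentially"
    proof eventually_elim
      case (elim n)
      define B where "B = {\<omega>\<in>space M. e / 2 < \<bar>Y n \<omega> - L \<omega>\<bar>}"
      have B: "B \<in> sets M" unfolding B_def by measurable
      have "(\<integral>\<omega>. norm (u n \<omega>) \<partial>M) \<le> (\<integral>\<omega>. e / 2 + indicator B \<omega> \<partial>M)"
      proof (rule integral_mono)
        fix \<omega> assume "\<omega> \<in> space M"
        then show "norm (u n \<omega>) \<le> e / 2 + indicator B \<omega>"
          using u[of n \<omega>] e min.cobounded2[of 1 "\<bar>Y n \<omega> - L \<omega>\<bar>"] unfolding B_def u_def
          by (auto split: split_indicator simp del: min.cobounded2)
      qed (use ui B in \<open>auto simp: emeasure_eq_measure\<close>)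
      also have "\<dots> = e / 2 + prob B"
        using B by (simp add: prob_space emeasure_eq_measure)
      finally show ?case using elim unfolding B_def by simp
    qed
  qed simp
  then obtain \<phi> where \<phi>: "strict_mono (\<phi> :: nat \<Rightarrow> nat)" "AE \<omega> in M. (\<lambda>n. u (\<phi> n) \<omega>) \<longlonglongrightarrow> 0"
    using tendsto_L1_AE_subseq[where M = M and u = u, OF ui] by blast
  have "AE \<omega> in M. (\<lambda>n. Y (\<phi> n) \<omega>) \<longlonglongrightarrow> L \<omega>"
    using \<phi>(2)
  proof eventually_elim
    case (elim \<omega>)
    have "eventually (\<lambda>n. u (\<phi> n) \<omega> < 1) sequentially" by (rule order_tendstoD(2)[OF elim]) simp
    then have "eventually (\<lambda>n. u (\<phi> n) \<omega> = \<bar>Y (\<phi> n) \<omega> - L \<omega>\<bar>) sequentially"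
      by eventually_elim (auto simp: u_def min_def split: if_splits)
    from tendsto_cong[THEN iffD1, OF this elim]
    show ?case using LIM_zero_cancel tendsto_rabs_zero_iff by blast
  qed
  with \<phi>(1) show ?thesis by (rule that)
qed

lemma converges_in_prob_common_AE_subseq:
  assumes "finite S" "\<And>i. i \<in> S \<Longrightarrow> converges_in_prob M (Y i) (L i)"
  obtains \<phi> :: "nat \<Rightarrow> nat" where "strict_mono \<phi>" "\<And>i. i \<in> S \<Longrightarrow> AE \<omega> in M. (\<lambda>n. Y i (\<phi> n) \<omega>) \<longlonglongrightarrow> L i \<omega>"
proof -
  have "\<exists>\<phi>::nat \<Rightarrow> nat. strict_mono \<phi> \<and> (\<forall>i\<in>S. AE \<omega> in M. (\<lambda>n. Y i (\<phi> n) \<omega>) \<longlonglongrightarrow> L i \<omega>)"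
    using assms
  proof (induction S)
    case empty
    show ?case by (intro exI[of _ id]) (simp add: strict_mono_id)
  next
    case (insert j S)
    obtain \<phi> :: "nat \<Rightarrow> nat" where \<phi>: "strict_mono \<phi>" "\<And>i. i \<in> S \<Longrightarrow> AE \<omega> in M. (\<lambda>n. Y i (\<phi> n) \<omega>) \<longlonglongrightarrow> L i \<omega>"
      using insert.IH[OF insert.prems[OF insertI2]] by blast
    have "converges_in_prob M (\<lambda>n. Y j (\<phi> n)) (L j)"
      by (rule converges_in_prob_subseq[OF insert.prems[OF insertI1] \<phi>(1)])
    then obtain \<psi> :: "nat \<Rightarrow> nat" where \<psi>: "strict_mono \<psi>" "AE \<omega> in M. (\<lambda>n. Y j (\<phi> (\<psi> n)) \<omega>) \<longlonglongrightarrow> L j \<omega>"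
      by (rule converges_in_prob_AE_subseq)
    have "AE \<omega> in M. (\<lambda>n. Y i (\<phi> (\<psi> n)) \<omega>) \<longlonglongrightarrow> L i \<omega>" if "i \<in> S" for i
      using \<phi>(2)[OF that]
    proof eventually_elim
      case (elim \<omega>)
      from LIMSEQ_subseq_LIMSEQ[OF this \<psi>(1)] show ?case by (simp add: o_def)
    qed
    moreover have "strict_mono (\<lambda>n. \<phi> (\<psi> n))" using \<phi>(1) \<psi>(1) by (simp add: strict_mono_def)
    ultimately show ?case using \<psi>(2) by (intro exI[of _ "\<lambda>n. \<phi> (\<psi> n)"]) auto
  qed
  then show ?thesis using that by blast
qed

end

text \<open>By completeness every subset of a null set is measurable, and all null sets lie in
  \<open>F 0\<close>. Hence almost sure limits of adapted variables remain adapted.\<close>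

lemma (in usual_filtered_prob_space) measurable_F_AE:
  fixes f g :: "'a \<Rightarrow> real"
  assumes f: "f \<in> borel_measurable (F s)" and s: "0 \<le> s" and eq: "AE \<omega> in M. f \<omega> = g \<omega>"
  shows "g \<in> borel_measurable (F s)"
proof (rule measurableI)
  have sp: "space (F s) = space M" using subalgebra_F[OF s] unfolding subalgebra_def by simp
  obtain N where N: "\<And>\<omega>. \<omega> \<in> space M - N \<Longrightarrow> f \<omega> = g \<omega>" "N \<in> null_sets M"
    using AE_E3[OF eq] by metis
  have null: "B \<in> sets (F s)" if "B \<subseteq> N" for B
  proof -
    have "B \<in> null_sets M" by (rule complete2[OF that N(2)])
    then have "B \<in> sets (F 0)" using null_sets_F0 by auto
    then show ?thesis using sets_F_mono[of 0 s] s by (auto simp: max_def)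
  qed
  fix A :: "real set" assume "A \<in> sets borel"
  then have fA: "f -` A \<inter> space (F s) \<in> sets (F s)" using f by auto
  have agree: "f \<omega> \<in> A \<longleftrightarrow> g \<omega> \<in> A" if "\<omega> \<in> space (F s)" "\<omega> \<notin> N" for \<omega>
    using N(1)[of \<omega>] that sp by simp
  have "(f -` A \<inter> space (F s) - N) \<union> (g -` A \<inter> space (F s) \<inter> N) \<in> sets (F s)"
    by (intro sets.Un sets.Diff null fA) auto
  also have "(f -` A \<inter> space (F s) - N) \<union> (g -` A \<inter> space (F s) \<inter> N) = g -` A \<inter> space (F s)"
    using agree by blast
  finally show "g -` A \<inter> space (F s) \<in> sets (F s)" .
qed simp

section \<open>Exit of a path from a ball, observed on a countable grid\<close>

lemma dense_grid:
  fixes f :: "real \<Rightarrow> real"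
  assumes f: "continuous_on {t..s} f" and \<tau>: "\<tau> \<in> {t..s}" "c < f \<tau>"
  obtains d where "d \<in> {t..s} \<inter> (\<rat> \<union> {t, s})" "c < f d"
proof (cases "\<tau> = t \<or> \<tau> = s")
  case True
  then show ?thesis using \<tau> that[of \<tau>] by auto
next
  case False
  then have \<tau>': "t < \<tau>" "\<tau> < s" using \<tau> by auto
  have "isCont f \<tau>" using f \<tau>' by (intro continuous_on_interior[of "{t..s}"]) auto
  then have "eventually (\<lambda>y. c < f y) (at \<tau>)"
    unfolding isCont_def by (rule order_tendstoD(1)) (rule \<tau>(2))
  then obtain d where d: "0 < d" "\<And>y. y \<noteq> \<tau> \<Longrightarrow> dist y \<tau> < d \<Longrightarrow> c < f y"
    unfolding eventually_at by auto
  obtain q where q: "q \<in> \<rat>" "\<tau> < q" "q < min s (\<tau> + d)"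
    using Rats_dense_in_real[of \<tau> "min s (\<tau> + d)"] d \<tau>' by auto
  have "c < f q" using q by (intro d(2)) (auto simp: dist_real_def)
  then show ?thesis using q \<tau>' by (intro that[of q]) auto
qed

lemma countable_grid: "countable ({t..s} \<inter> (\<rat> \<union> {t, s :: real}))"
  by (intro countable_Int2 countable_Un countable_rat) auto

text \<open>Before the path first leaves the ball of radius \<open>R\<close> the clipped integrand \<open>f\<close> is as close
  to \<open>h\<close> as the unclipped \<open>g\<close>, so the drift computed with \<open>f\<close> still reproduces the path there.\<close>
lemma exit_forces_large_shift:
  fixes p w h f g :: "real \<Rightarrow> real"
  assumes s: "t \<le> s" and p: "continuous_on {t..s} p" "p t = x" and R: "0 < R" and sig: "0 < \<sigma>"
    and d: "d \<in> {t..s}" "R < \<bar>p d - x\<bar>"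
    and eq: "\<And>r. r \<in> {t..s} \<Longrightarrow> p r = x + \<sigma> * (w r + (LBINT v:{t..r}. h v))"
    and h: "\<And>r. r \<in> {t..s} \<Longrightarrow> \<bar>p r - x\<bar> \<le> R \<Longrightarrow> \<bar>h r\<bar> \<le> C"
    and f: "\<And>r. f r = max (- C) (min C (g r))"
    and int: "\<And>v. v \<in> {t..s} \<Longrightarrow> set_integrable lborel {t..v} f" "\<And>v. v \<in> {t..s} \<Longrightarrow> set_integrable lborel {t..v} h"
      "set_integrable lborel {t..s} g"
    and close: "(LBINT r:{t..s}. \<bar>g r - h r\<bar>) \<le> 1"
  obtains \<tau> where "\<tau> \<in> {t..s}" "R / \<sigma> - 1 \<le> \<bar>w \<tau> + (LBINT v:{t..\<tau>}. f v)\<bar>"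
proof -
  define q where "q r = \<bar>p r - x\<bar>" for r
  have q: "continuous_on {t..s} q" unfolding q_def by (intro continuous_intros p)
  have ivt: "\<exists>y\<in>{t..r}. q y = R" if "r \<in> {t..s}" "R \<le> q r" for r
  proof -
    have "continuous_on {t..r} q" by (rule continuous_on_subset[OF q]) (use that in auto)
    moreover have "q t \<le> R" unfolding q_def using p R by simp
    ultimately show ?thesis using IVT'[of q t R r] that by auto
  qed
  \<comment> \<open>Times at which the path is on the sphere. Closedness makes the infimum an actual
    hitting time, and the intermediate value theorem keeps the path in the ball before it. The
    argument concerns one path, so no measurability of the hitting time arises.\<close>
  define S where "S = {y \<in> {t..s}. q y = R}"
  have "closed S"
    unfolding S_def using continuous_closed_preimage_constant[OF q, of R] by simp
  moreover have "S \<noteq> {}" using ivt[of d] d unfolding S_def q_def by force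
  moreover have bdd: "bdd_below S" unfolding S_def by (intro bdd_belowI[of _ t]) auto
  ultimately have "Inf S \<in> S" by (intro closed_contains_Inf)
  define \<tau> where "\<tau> = Inf S"
  have \<tau>: "\<tau> \<in> {t..s}" "q \<tau> = R" using \<open>Inf S \<in> S\<close> unfolding \<tau>_def S_def by auto
  have before: "q r \<le> R" if r: "r \<in> {t..\<tau>}" for r
  proof (rule ccontr)
    assume "\<not> q r \<le> R"
    then obtain y where y: "y \<in> {t..r}" "q y = R" using ivt[of r] r \<tau> by auto
    then have "y \<in> S" unfolding S_def using r \<tau> by auto
    then have "\<tau> \<le> y" unfolding \<tau>_def using bdd by (rule cInf_lower)
    then have "y = r" using y r by auto
    then show False using y \<open>\<not> q r \<le> R\<close> by simp
  qed
  have fh: "\<bar>f r - h r\<bar> \<le> \<bar>g r - h r\<bar>" if r: "r \<in> {t..\<tau>}" for r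
    using h[of r] before[OF r] r \<tau>(1) unfolding f q_def by (auto simp: max_def min_def)
  have sub: "{t..\<tau>} \<subseteq> {t..s}" using \<tau> by auto
  have i1: "set_integrable lborel {t..\<tau>} (\<lambda>r. f r - h r)" using int \<tau>(1) by (intro set_integral_diff) auto
  have i3: "set_integrable lborel {t..s} (\<lambda>r. \<bar>g r - h r\<bar>)" using int s by (intro set_integrable_abs set_integral_diff) auto
  have i2: "set_integrable lborel {t..\<tau>} (\<lambda>r. \<bar>g r - h r\<bar>)"
    by (rule set_integrable_subset[OF i3 _ sub]) simp
  have "\<bar>LBINT r:{t..\<tau>}. f r - h r\<bar> \<le> (LBINT r:{t..\<tau>}. \<bar>f r - h r\<bar>)"
    using set_integral_norm_bound[OF i1] by simp
  also have "\<dots> \<le> (LBINT r:{t..\<tau>}. \<bar>g r - h r\<bar>)"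
    by (rule set_integral_mono[OF set_integrable_abs[OF i1] i2 fh])
  also have "\<dots> \<le> (LBINT r:{t..s}. \<bar>g r - h r\<bar>)"
    unfolding set_lebesgue_integral_def using i2 i3 sub
    by (intro integral_mono) (auto simp: set_integrable_def split: split_indicator)
  also have "\<dots> \<le> 1" by (rule close)
  finally have "\<bar>(LBINT r:{t..\<tau>}. f r) - (LBINT r:{t..\<tau>}. h r)\<bar> \<le> 1"
    using int \<tau>(1) by (subst set_integral_diff(2)[symmetric]) auto
  moreover have "\<sigma> * \<bar>w \<tau> + (LBINT v:{t..\<tau>}. h v)\<bar> = R"
    using \<tau>(2) eq[OF \<tau>(1)] sig unfolding q_def by (simp add: abs_mult)
  then have "R / \<sigma> = \<bar>w \<tau> + (LBINT v:{t..\<tau>}. h v)\<bar>"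
    using sig by (simp add: nonzero_divide_eq_eq mult.commute)
  ultimately have "R / \<sigma> - 1 \<le> \<bar>w \<tau> + (LBINT v:{t..\<tau>}. f v)\<bar>" by linarith
  with \<tau>(1) show ?thesis by (rule that)
qed


text \<open>One sequence of simple integrands witnessing the Ito integral is fixed. The equation for
  X is written with \<sigma> factored out, since the bracket that remains is the limit of
  \<open>simple_shift\<close>.\<close>

locale ito_approximation = brownian_filtration M F W
  for M :: "'a measure" and F :: "real \<Rightarrow> 'a measure" and W :: "real \<Rightarrow> 'a \<Rightarrow> real" +
  fixes \<sigma> x t T :: real and \<eta> :: "real \<Rightarrow> real" and X I :: "real \<Rightarrow> 'a \<Rightarrow> real"
    and k :: "nat \<Rightarrow> nat" and a :: "nat \<Rightarrow> nat \<Rightarrow> real" and \<xi> :: "nat \<Rightarrow> nat \<Rightarrow> 'a \<Rightarrow> real"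
  assumes sig: "0 < \<sigma>" and t: "0 \<le> t" "t \<le> T" and eta: "continuous_on UNIV \<eta>"
    and X_meas: "\<And>s. t \<le> s \<Longrightarrow> X s \<in> borel_measurable (F s)"
    and X_path: "AE \<omega> in M. continuous_on {t..T} (\<lambda>s. X s \<omega>) \<and>
       (\<forall>s\<in>{t..T}. X s \<omega> = x + \<sigma> * (W s \<omega> - W t \<omega> + (LBINT r:{t..s}. \<eta> (X r \<omega>))))"
    and simple: "\<And>n. simple_data F t T (k n) (a n) (\<xi> n)"
    and L2: "converges_in_prob M
        (\<lambda>n \<omega>. LBINT r:{t..T}. (simple_process (k n) (a n) (\<xi> n) r \<omega> - \<eta> (X r \<omega>))\<^sup>2) (\<lambda>_. 0)"
    and integral_conv: "\<And>s. s \<in> {t..T} \<Longrightarrow> converges_in_prob M (\<lambda>n. simple_integral W (k n) (a n) (\<xi> n) s) (I s)"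
begin

abbreviation "g n r \<omega> \<equiv> simple_process (k n) (a n) (\<xi> n) r \<omega>"

definition J :: "nat \<Rightarrow> 'a \<Rightarrow> real" where
  "J n \<omega> = (LBINT r:{t..T}. (g n r \<omega> - \<eta> (X r \<omega>))\<^sup>2)"

abbreviation Z :: "real \<Rightarrow> 'a \<Rightarrow> real" where "Z \<equiv> exp_density \<eta> X I t"

lemma J_measurable[measurable]: "J n \<in> borel_measurable M"
  using L2 unfolding converges_in_prob_def J_def by auto

lemma path_h:
  assumes "continuous_on {t..T} (\<lambda>s. X s \<omega>)"
  shows "continuous_on {t..T} (\<lambda>r. \<eta> (X r \<omega>))"
  by (rule continuous_on_compose2[OF eta assms]) auto

lemma g_bounded: "\<exists>B. \<forall>r. \<bar>g n r \<omega>\<bar> \<le> B"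
  using simple_process_bounded[of "k n" "a n" "\<xi> n" \<omega>] by blast

lemma drift_eq:
  assumes "s \<in> {t..T}"
  shows "(LBINT r:{t..s}. f (g n r \<omega>)) = simple_drift (k n) (a n) (\<lambda>i \<omega>. f (\<xi> n i \<omega>)) s \<omega>"
  by (rule simple_drift_eq_integral[OF simple_dataD(1)[OF simple] simple_dataD(2)[OF simple] simple_dataD(3)[OF simple]])
    (use assms in auto)

text \<open>The equation for X identifies the limit of noise plus approximate drift: the processes
  that are Brownian under the approximating measures converge to X itself, centred and
  scaled.\<close>

lemma simple_shift_limit:
  assumes s: "s \<in> {t..T}" and lim: "(\<lambda>n. J (\<phi> n) \<omega>) \<longlonglongrightarrow> 0" and c: "continuous_on {t..T} (\<lambda>s. X s \<omega>)"
    and eq: "X s \<omega> = x + \<sigma> * (W s \<omega> - W t \<omega> + (LBINT r:{t..s}. \<eta> (X r \<omega>)))"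
  shows "(\<lambda>n. simple_shift t (k (\<phi> n)) (a (\<phi> n)) (\<xi> (\<phi> n)) s \<omega>) \<longlonglongrightarrow> (X s \<omega> - x) / \<sigma>"
proof -
  have "(\<lambda>n. LBINT r:{t..s}. g (\<phi> n) r \<omega>) \<longlonglongrightarrow> (LBINT r:{t..s}. \<eta> (X r \<omega>))"
    by (rule L2_convergence_drift_energy(2)[where T = T])
      (use s path_h[OF c] g_bounded lim in \<open>auto simp: J_def\<close>)
  then have "(\<lambda>n. W s \<omega> - W t \<omega> + simple_drift (k (\<phi> n)) (a (\<phi> n)) (\<xi> (\<phi> n)) s \<omega>)
     \<longlonglongrightarrow> W s \<omega> - W t \<omega> + (LBINT r:{t..s}. \<eta> (X r \<omega>))"
    using drift_eq[OF s, of "\<lambda>y. y"] by (intro tendsto_add tendsto_const) simp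
  moreover have "W s \<omega> - W t \<omega> + (LBINT r:{t..s}. \<eta> (X r \<omega>)) = (X s \<omega> - x) / \<sigma>"
    using eq sig by simp
  ultimately show ?thesis unfolding simple_shift_def by simp
qed

lemma simple_density_limit:
  assumes s: "s \<in> {t..T}" and lim: "(\<lambda>n. J (\<phi> n) \<omega>) \<longlonglongrightarrow> 0" and c: "continuous_on {t..T} (\<lambda>s. X s \<omega>)"
    and lI: "(\<lambda>n. simple_integral W (k (\<phi> n)) (a (\<phi> n)) (\<xi> (\<phi> n)) s \<omega>) \<longlonglongrightarrow> I s \<omega>"
  shows "(\<lambda>n. simple_density (k (\<phi> n)) (a (\<phi> n)) (\<xi> (\<phi> n)) s \<omega>) \<longlonglongrightarrow> Z s \<omega>"
proof -
  have "(\<lambda>n. LBINT r:{t..s}. (g (\<phi> n) r \<omega>)\<^sup>2) \<longlonglongrightarrow> (LBINT r:{t..s}. (\<eta> (X r \<omega>))\<^sup>2)"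
    by (rule L2_convergence_drift_energy(3)[where T = T])
      (use s path_h[OF c] g_bounded lim in \<open>auto simp: J_def\<close>)
  then have e: "(\<lambda>n. simple_energy (k (\<phi> n)) (a (\<phi> n)) (\<xi> (\<phi> n)) s \<omega>) \<longlonglongrightarrow> (LBINT r:{t..s}. (\<eta> (X r \<omega>))\<^sup>2)"
    using drift_eq[OF s, of "\<lambda>y. y\<^sup>2"] by simp
  show ?thesis
    unfolding simple_density_def exp_density_def
    using tendsto_exp[OF tendsto_diff[OF tendsto_minus[OF lI] tendsto_divide[OF e tendsto_const[of 2]]]] by simp
qed

text \<open>The subsequence may depend on the finite set of times, since every identity to be passed
  to the limit involves at most two of them.\<close>

lemma common_subseq:
  assumes "finite S" "S \<subseteq> {t..T}"
  obtains \<phi> :: "nat \<Rightarrow> nat" where "strict_mono \<phi>" "AE \<omega> in M. (\<lambda>n. J (\<phi> n) \<omega>) \<longlonglongrightarrow> 0"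
    "\<And>s. s \<in> S \<Longrightarrow> AE \<omega> in M. (\<lambda>n. simple_integral W (k (\<phi> n)) (a (\<phi> n)) (\<xi> (\<phi> n)) s \<omega>) \<longlonglongrightarrow> I s \<omega>"
proof -
  \<comment> \<open>\<open>None\<close> stands for the L2 error and \<open>Some s\<close> for the
    integral up to s, so that one extraction serves both kinds of convergence.\<close>
  define Y where "Y i n = (case i of None \<Rightarrow> J n | Some s \<Rightarrow> simple_integral W (k n) (a n) (\<xi> n) s)" for i n
  define L where "L i = (case i of None \<Rightarrow> (\<lambda>_. 0) | Some s \<Rightarrow> I s)" for i
  have "converges_in_prob M (Y i) (L i)" if "i \<in> insert None (Some ` S)" for i
    using that assms L2 integral_conv unfolding Y_def L_def J_def[abs_def] by (auto simp: subset_iff)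
  then obtain \<phi> :: "nat \<Rightarrow> nat" where \<phi>: "strict_mono \<phi>"
      "\<And>i. i \<in> insert None (Some ` S) \<Longrightarrow> AE \<omega> in M. (\<lambda>n. Y i (\<phi> n) \<omega>) \<longlonglongrightarrow> L i \<omega>"
    using converges_in_prob_common_AE_subseq[of "insert None (Some ` S)" Y L] assms(1) by blast
  show ?thesis
  proof (rule that[OF \<phi>(1)])
    show "AE \<omega> in M. (\<lambda>n. J (\<phi> n) \<omega>) \<longlonglongrightarrow> 0" using \<phi>(2)[of None] by (simp add: Y_def L_def)
    show "AE \<omega> in M. (\<lambda>n. simple_integral W (k (\<phi> n)) (a (\<phi> n)) (\<xi> (\<phi> n)) s \<omega>) \<longlonglongrightarrow> I s \<omega>"
      if "s \<in> S" for s using \<phi>(2)[of "Some s"] that by (simp add: Y_def L_def)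
  qed
qed

lemma AE_simple_density_limit:
  assumes "s \<in> {t..T}" "AE \<omega> in M. (\<lambda>n. J (\<phi> n) \<omega>) \<longlonglongrightarrow> 0"
    "AE \<omega> in M. (\<lambda>n. simple_integral W (k (\<phi> n)) (a (\<phi> n)) (\<xi> (\<phi> n)) s \<omega>) \<longlonglongrightarrow> I s \<omega>"
  shows "AE \<omega> in M. (\<lambda>n. simple_density (k (\<phi> n)) (a (\<phi> n)) (\<xi> (\<phi> n)) s \<omega>) \<longlonglongrightarrow> Z s \<omega>"
  using assms(2,3) X_path
proof eventually_elim
  case (elim \<omega>)
  then show ?case by (intro simple_density_limit assms(1)) auto
qed

lemma Z_pos: "0 < Z s \<omega>" unfolding exp_density_def by simp

text \<open>The formula for Z contains a path integral whose measurability in \<omega> is not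
  apparent. It is obtained from the approximating densities, which are adapted and converge to Z
  almost surely.\<close>

lemma Z_measurable_F:
  assumes s: "s \<in> {t..T}"
  shows "Z s \<in> borel_measurable (F s)"
proof -
  obtain \<phi> :: "nat \<Rightarrow> nat" where \<phi>: "strict_mono \<phi>" "AE \<omega> in M. (\<lambda>n. J (\<phi> n) \<omega>) \<longlonglongrightarrow> 0"
    "\<And>r. r \<in> {s} \<Longrightarrow> AE \<omega> in M. (\<lambda>n. simple_integral W (k (\<phi> n)) (a (\<phi> n)) (\<xi> (\<phi> n)) r \<omega>) \<longlonglongrightarrow> I r \<omega>"
    using common_subseq[of "{s}"] s by blast
  define f where "f n = simple_density (k (\<phi> n)) (a (\<phi> n)) (\<xi> (\<phi> n)) s" for n
  have [measurable]: "f n \<in> borel_measurable (F s)" for n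
    unfolding f_def by (rule simple_adapted(4)[OF simple t(1)]) (use s in auto)
  have m: "(\<lambda>\<omega>. lim (\<lambda>n. f n \<omega>)) \<in> borel_measurable (F s)" by measurable
  have e: "AE \<omega> in M. lim (\<lambda>n. f n \<omega>) = Z s \<omega>"
    using AE_simple_density_limit[OF s \<phi>(2) \<phi>(3)[OF singletonI]]
    by eventually_elim (auto simp: f_def intro: limI)
  show ?thesis by (rule measurable_F_AE[OF m _ e]) (use s t in simp)
qed

lemma Z_measurable_M: "s \<in> {t..T} \<Longrightarrow> Z s \<in> borel_measurable M"
  using measurable_F_M[OF Z_measurable_F, of s] t by simp

lemma Z_integrable:
  assumes s: "s \<in> {t..T}"
  shows "integrable M (Z s)" "(\<integral>\<omega>. Z s \<omega> \<partial>M) \<le> 1"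
proof -
  obtain \<phi> :: "nat \<Rightarrow> nat" where \<phi>: "strict_mono \<phi>" "AE \<omega> in M. (\<lambda>n. J (\<phi> n) \<omega>) \<longlonglongrightarrow> 0"
    "\<And>r. r \<in> {s} \<Longrightarrow> AE \<omega> in M. (\<lambda>n. simple_integral W (k (\<phi> n)) (a (\<phi> n)) (\<xi> (\<phi> n)) r \<omega>) \<longlonglongrightarrow> I r \<omega>"
    using common_subseq[of "{s}"] s by blast
  define f where "f n = simple_density (k (\<phi> n)) (a (\<phi> n)) (\<xi> (\<phi> n)) s" for n
  have [measurable]: "f n \<in> borel_measurable M" for n
    unfolding f_def by (rule simple_density_measurable[OF simple t(1)]) (use s in auto)
  have fi: "integrable M (f n)" "(\<integral>\<omega>. f n \<omega> \<partial>M) = 1" for n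
    unfolding f_def using s by (auto intro!: simple_density_integrable[OF simple t(1)])
  have f0: "0 \<le> f n \<omega>" for n \<omega> unfolding f_def by simp
  have Zm: "Z s \<in> borel_measurable M" by (rule Z_measurable_M[OF s])
  have "(\<integral>\<^sup>+\<omega>. ennreal (Z s \<omega>) \<partial>M) = (\<integral>\<^sup>+\<omega>. liminf (\<lambda>n. ennreal (f n \<omega>)) \<partial>M)"
  proof (rule nn_integral_cong_AE)
    show "AE \<omega> in M. ennreal (Z s \<omega>) = liminf (\<lambda>n. ennreal (f n \<omega>))"
      using AE_simple_density_limit[OF s \<phi>(2) \<phi>(3)[OF singletonI]]
    proof eventually_elim
      case (elim \<omega>)
      then have "(\<lambda>n. ennreal (f n \<omega>)) \<longlonglongrightarrow> ennreal (Z s \<omega>)" unfolding f_def by (rule tendsto_ennrealI)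
      then show ?case by (intro lim_imp_Liminf[symmetric]) auto
    qed
  qed
  also have "\<dots> \<le> liminf (\<lambda>n. \<integral>\<^sup>+\<omega>. ennreal (f n \<omega>) \<partial>M)"
    by (rule nn_integral_liminf) measurable
  also have "\<dots> = 1"
    using fi f0 by (simp add: nn_integral_eq_integral Liminf_const)
  finally have le: "(\<integral>\<^sup>+\<omega>. ennreal (Z s \<omega>) \<partial>M) \<le> 1" .
  show i: "integrable M (Z s)"
  proof (rule integrableI_bounded[OF Zm])
    have "norm (Z s \<omega>) = Z s \<omega>" for \<omega> using Z_pos[of s \<omega>] by simp
    then show "(\<integral>\<^sup>+\<omega>. ennreal (norm (Z s \<omega>)) \<partial>M) < \<infinity>"
      using le_less_trans[OF le] by simp
  qed
  have "ennreal (\<integral>\<omega>. Z s \<omega> \<partial>M) \<le> ennreal 1"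
    using le nn_integral_eq_integral[OF i] Z_pos by (simp add: less_imp_le)
  then show "(\<integral>\<omega>. Z s \<omega> \<partial>M) \<le> 1" by (subst (asm) ennreal_le_iff) auto
qed

end

section \<open>No loss of mass\<close>

definition clip :: "real \<Rightarrow> real \<Rightarrow> real" where "clip C y = max (- C) (min C y)"

lemma continuous_clip: "continuous_on UNIV (clip C)"
  unfolding clip_def[abs_def] by (intro continuous_intros)

lemma clip_measurable[measurable]: "clip C \<in> borel_measurable borel"
  by (rule borel_measurable_continuous_onI[OF continuous_clip])

lemma clip_bounded: "0 \<le> C \<Longrightarrow> \<bar>clip C y\<bar> \<le> C"
  unfolding clip_def by auto

text \<open>\<open>clip C\<close> is the nearest-point projection onto [-C, C], and h is a point of
  that interval.\<close>

lemma clip_close: "\<bar>h\<bar> \<le> C \<Longrightarrow> \<bar>clip C y - h\<bar> \<le> \<bar>y - h\<bar>"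
  and clip_defect: "\<bar>h\<bar> \<le> C \<Longrightarrow> \<bar>y - clip C y\<bar> \<le> \<bar>y - h\<bar>"
  unfolding clip_def by (auto simp: max_def min_def)

lemma abs_le_imp_square_le: "\<bar>a :: real\<bar> \<le> \<bar>b\<bar> \<Longrightarrow> a\<^sup>2 \<le> b\<^sup>2"
  by (simp add: abs_le_square_iff)

lemma set_integral_point:
  fixes t :: real
  shows "(LBINT r:{t}. f r) = (0::real)"
proof -
  have "(LBINT r:{t}. f r) = (\<integral>r. 0 \<partial>(lborel :: real measure))"
    unfolding set_lebesgue_integral_def by (rule integral_discrete_difference[where X = "{t}"]) auto
  then show ?thesis by simp
qed

locale clipped_approximation = ito_approximation +
  fixes s R C :: real
  assumes s: "s \<in> {t..T}" and R: "0 < R" and C: "0 \<le> C"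
    and eta_le: "\<And>y. \<bar>y - x\<bar> \<le> R \<Longrightarrow> \<bar>\<eta> y\<bar> \<le> C"
begin

text \<open>Countability makes the exit events below measurable; continuity of the paths makes the
  grid sufficient.\<close>

definition D :: "real set" where "D = {t..s} \<inter> (\<rat> \<union> {t, s})"

definition U :: "'a set" where "U = {\<omega> \<in> space M. \<exists>d\<in>D. R < \<bar>X d \<omega> - x\<bar>}"

definition \<xi>' :: "nat \<Rightarrow> nat \<Rightarrow> 'a \<Rightarrow> real" where "\<xi>' n i \<omega> = clip C (\<xi> n i \<omega>)"

definition z :: "nat \<Rightarrow> 'a \<Rightarrow> real" where "z n = simple_density (k n) (a n) (\<xi>' n) s"

text \<open>The exit level of the scaled path is R / \<sigma>. One unit is lost to the error of the
  approximate drift up to the exit, a second one buys a strict inequality, which survives the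
  passage from the exit time to a grid point.\<close>

definition V :: "nat \<Rightarrow> 'a set" where
  "V n = {\<omega> \<in> space M. \<exists>d\<in>D. R / \<sigma> - 2 \<le> \<bar>simple_shift t (k n) (a n) (\<xi>' n) d \<omega>\<bar>}"

definition good :: "'a \<Rightarrow> bool" where
  "good \<omega> \<longleftrightarrow> \<omega> \<in> space M \<and> continuous_on {t..T} (\<lambda>s. X s \<omega>) \<and>
     (\<forall>s\<in>{t..T}. X s \<omega> = x + \<sigma> * (W s \<omega> - W t \<omega> + (LBINT r:{t..s}. \<eta> (X r \<omega>)))) \<and>
     continuous_on {0..} (\<lambda>s. W s \<omega>)"

lemma ts: "t \<le> s" "s \<le> T" "0 \<le> s" using s t by auto

lemma D: "countable D" "D \<subseteq> {t..s}" unfolding D_def using countable_grid by auto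

lemma AE_good: "AE \<omega> in M. good \<omega>"
proof -
  have "AE \<omega> in M. continuous_on {0..} (\<lambda>s. W s \<omega>)" using brownian unfolding brownian_motion_def by auto
  with X_path AE_space show ?thesis by eventually_elim (auto simp: good_def)
qed

lemma good_space: "good \<omega> \<Longrightarrow> \<omega> \<in> space M"
  and good_path: "good \<omega> \<Longrightarrow> continuous_on {t..T} (\<lambda>s. X s \<omega>)"
  unfolding good_def by blast+

lemma U_sets[measurable]: "U \<in> sets M"
  unfolding U_def
proof (rule sets.sets_Collect_countable_Ex'[OF _ D(1)])
  fix d assume "d \<in> D"
  then have "t \<le> d" "0 \<le> d" using D(2) t by auto
  then have [measurable]: "X d \<in> borel_measurable M" using measurable_F_M X_meas by blast
  show "{\<omega> \<in> space M. R < \<bar>X d \<omega> - x\<bar>} \<in> sets M" by measurable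
qed

lemma simple': "simple_data F t T (k n) (a n) (\<xi>' n)"
  unfolding \<xi>'_def by (rule simple_data_comp[OF simple continuous_clip])

lemma z_integrable: "integrable M (z n)" "(\<integral>\<omega>. z n \<omega> \<partial>M) = 1"
  unfolding z_def using simple_density_integrable[OF simple' t(1) ts(1,2)] by auto

lemma z_square: "integrable M (\<lambda>\<omega>. (z n \<omega>)\<^sup>2)" "(\<integral>\<omega>. (z n \<omega>)\<^sup>2 \<partial>M) \<le> exp (C\<^sup>2 * (s - t))"
  unfolding z_def
  using simple_density_square[OF simple' t(1) ts(1,2), where C = C] clip_bounded[OF C] unfolding \<xi>'_def by auto

lemma z_pos: "0 < z n \<omega>" unfolding z_def by simp

lemma V_sets[measurable]: "V n \<in> sets M"
  and V_bound: "(\<integral>\<omega>. indicator (V n) \<omega> * z n \<omega> \<partial>M) \<le> 2 * exp ((T - t) / 2 - (R / \<sigma> - 2))"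
  unfolding V_def z_def by (rule simple_maximal[OF simple' t(1) D ts(1,2)])+

lemma h_cont: "good \<omega> \<Longrightarrow> v \<le> T \<Longrightarrow> continuous_on {t..v} (\<lambda>r. \<eta> (X r \<omega>))"
  using continuous_on_subset[OF path_h[OF good_path]] by auto

lemma g_measurable: "(\<lambda>r. g n r \<omega>) \<in> borel_measurable borel"
  by (rule simple_process_measurable)

lemmas g_integrable = set_integrable_L2[OF h_cont g_measurable g_bounded]

lemma clip_g_measurable: "(\<lambda>r. clip C (g n r \<omega>)) \<in> borel_measurable borel"
  using g_measurable[of n \<omega>] by measurable

lemma clip_g_bounded: "\<exists>B. \<forall>r. \<bar>clip C (g n r \<omega>)\<bar> \<le> B"
  using clip_bounded[OF C] by blast

lemmas clip_g_integrable = set_integrable_L2[OF h_cont clip_g_measurable clip_g_bounded]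

lemma J_ge:
  assumes "good \<omega>"
  shows "(LBINT r:{t..s}. (g n r \<omega> - \<eta> (X r \<omega>))\<^sup>2) \<le> J n \<omega>"
proof -
  have "set_integrable lborel {t..s} (\<lambda>r. (g n r \<omega> - \<eta> (X r \<omega>))\<^sup>2)"
    "set_integrable lborel {t..T} (\<lambda>r. (g n r \<omega> - \<eta> (X r \<omega>))\<^sup>2)"
    using g_integrable(2)[OF assms ts(2)] g_integrable(2)[OF assms order_refl] by auto
  then show ?thesis
    unfolding J_def set_lebesgue_integral_def set_integrable_def
    using ts by (intro integral_mono) (auto split: split_indicator)
qed

lemma outside_U:
  assumes "good \<omega>" "\<omega> \<notin> U" "r \<in> {t..s}"
  shows "\<bar>\<eta> (X r \<omega>)\<bar> \<le> C"
proof (rule eta_le, rule ccontr)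
  assume "\<not> \<bar>X r \<omega> - x\<bar> \<le> R"
  then have gt: "R < \<bar>X r \<omega> - x\<bar>" by simp
  have "continuous_on {t..s} (\<lambda>r. X r \<omega>)"
    by (rule continuous_on_subset[OF good_path[OF assms(1)]]) (use ts in auto)
  then have "continuous_on {t..s} (\<lambda>r. \<bar>X r \<omega> - x\<bar>)" by (intro continuous_intros)
  then obtain d where "d \<in> D" "R < \<bar>X d \<omega> - x\<bar>"
    unfolding D_def using assms(3) gt by (rule dense_grid[where f = "\<lambda>r. \<bar>X r \<omega> - x\<bar>"])
  then show False using good_space[OF assms(1)] assms(2) unfolding U_def by blast
qed

text \<open>Off \<open>U\<close> the values of \<open>\<eta> (X)\<close> stay in [-C, C], so
  clipping moves the approximation by no more than its distance to
  \<open>\<eta> (X)\<close>.\<close>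

lemma energy_defect:
  assumes "good \<omega>" "\<omega> \<notin> U"
  shows "simple_energy (k n) (a n) (\<lambda>i \<omega>. \<xi> n i \<omega> - \<xi>' n i \<omega>) s \<omega> \<le> J n \<omega>"
proof -
  have m: "(\<lambda>r. g n r \<omega> - clip C (g n r \<omega>)) \<in> borel_measurable borel"
    using g_measurable[of n \<omega>] by measurable
  obtain B where B: "\<And>r. \<bar>g n r \<omega>\<bar> \<le> B" using g_bounded by blast
  have b: "\<exists>B. \<forall>r. \<bar>g n r \<omega> - clip C (g n r \<omega>)\<bar> \<le> B"
  proof (intro exI allI)
    fix r show "\<bar>g n r \<omega> - clip C (g n r \<omega>)\<bar> \<le> B + C"
      using B[of r] clip_bounded[OF C, of "g n r \<omega>"] by linarith
  qed
  have "simple_energy (k n) (a n) (\<lambda>i \<omega>. \<xi> n i \<omega> - \<xi>' n i \<omega>) s \<omega>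
      = (LBINT r:{t..s}. (g n r \<omega> - clip C (g n r \<omega>))\<^sup>2)"
    unfolding \<xi>'_def using drift_eq[OF s, of "\<lambda>y. (y - clip C y)\<^sup>2"] by simp
  also have "\<dots> \<le> (LBINT r:{t..s}. (g n r \<omega> - \<eta> (X r \<omega>))\<^sup>2)"
  proof (rule set_integral_mono)
    show "set_integrable lborel {t..s} (\<lambda>r. (g n r \<omega> - clip C (g n r \<omega>))\<^sup>2)"
      by (rule set_integrable_L2(6)[OF h_cont[OF assms(1) ts(2)] m b])
    show "set_integrable lborel {t..s} (\<lambda>r. (g n r \<omega> - \<eta> (X r \<omega>))\<^sup>2)"
      by (rule g_integrable(2)[OF assms(1) ts(2)])
    fix r assume "r \<in> {t..s}"
    then show "(g n r \<omega> - clip C (g n r \<omega>))\<^sup>2 \<le> (g n r \<omega> - \<eta> (X r \<omega>))\<^sup>2"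
      by (intro abs_le_imp_square_le clip_defect outside_U[OF assms])
  qed
  also have "\<dots> \<le> J n \<omega>" by (rule J_ge[OF assms(1)])
  finally show ?thesis .
qed

text \<open>With this weight in \<open>integral_abs_le_square\<close>, the length term is at most
  1/2, and \<open>J n \<omega> \<le> \<epsilon>\<^sub>0 / 2\<close> makes the other term at most
  1/2. Together they give the drift error 1 that \<open>exit_forces_large_shift\<close>
  tolerates.\<close>

definition \<epsilon>\<^sub>0 :: real where "\<epsilon>\<^sub>0 = 1 / (2 * (s - t + 1))"

lemma eps0: "0 < \<epsilon>\<^sub>0" "\<epsilon>\<^sub>0 * (s - t) \<le> 1 / 2"
  unfolding \<epsilon>\<^sub>0_def using ts by (simp_all add: field_simps)

lemma exit_in_V:
  assumes good: "good \<omega>" and U: "\<omega> \<in> U" and J: "J n \<omega> \<le> \<epsilon>\<^sub>0 / 2"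
  shows "\<omega> \<in> V n"
proof -
  have X: "continuous_on {t..T} (\<lambda>s. X s \<omega>)" "continuous_on {0..} (\<lambda>s. W s \<omega>)"
    "\<And>s. s \<in> {t..T} \<Longrightarrow> X s \<omega> = x + \<sigma> * (W s \<omega> - W t \<omega> + (LBINT r:{t..s}. \<eta> (X r \<omega>)))"
    "\<omega> \<in> space M"
    using good unfolding good_def by (blast, blast, blast, blast)
  have close: "(LBINT r:{t..s}. \<bar>g n r \<omega> - \<eta> (X r \<omega>)\<bar>) \<le> 1"
  proof -
    have "(LBINT r:{t..s}. \<bar>g n r \<omega> - \<eta> (X r \<omega>)\<bar>)
        \<le> \<epsilon>\<^sub>0 * (s - t) + (LBINT r:{t..s}. (g n r \<omega> - \<eta> (X r \<omega>))\<^sup>2) / \<epsilon>\<^sub>0"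
      by (rule integral_abs_le_square[OF ts(1) eps0(1) g_integrable(1)[OF good ts(2)] g_integrable(2)[OF good ts(2)]])
    also have "\<dots> \<le> 1 / 2 + (\<epsilon>\<^sub>0 / 2) / \<epsilon>\<^sub>0"
      using eps0 J_ge[OF good, of n] J by (intro add_mono divide_right_mono) auto
    also have "\<dots> = 1" using eps0(1) by simp
    finally show ?thesis .
  qed
  obtain d where d: "d \<in> {t..s}" "R < \<bar>X d \<omega> - x\<bar>" using U D(2) unfolding U_def by auto
  have Xs: "continuous_on {t..s} (\<lambda>r. X r \<omega>)" by (rule continuous_on_subset[OF X(1)]) (use ts in auto)
  have X0: "X t \<omega> = x" using X(3)[of t] t(2) by (simp add: set_integral_point)
  have eq: "X r \<omega> = x + \<sigma> * ((W r \<omega> - W t \<omega>) + (LBINT v:{t..r}. \<eta> (X v \<omega>)))" if "r \<in> {t..s}" for r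
    using X(3)[of r] that ts by simp
  obtain \<tau> where \<tau>: "\<tau> \<in> {t..s}" "R / \<sigma> - 1 \<le> \<bar>(W \<tau> \<omega> - W t \<omega>) + (LBINT v:{t..\<tau>}. clip C (g n v \<omega>))\<bar>"
  proof (rule exit_forces_large_shift[where p = "\<lambda>r. X r \<omega>" and w = "\<lambda>r. W r \<omega> - W t \<omega>"
        and f = "\<lambda>r. clip C (g n r \<omega>)" and g = "\<lambda>r. g n r \<omega>" and h = "\<lambda>r. \<eta> (X r \<omega>)"
        and C = C, OF ts(1) Xs X0 R sig d eq])
    fix r assume "r \<in> {t..s}" "\<bar>X r \<omega> - x\<bar> \<le> R"
    then show "\<bar>\<eta> (X r \<omega>)\<bar> \<le> C" by (intro eta_le)
  next
    show "clip C (g n r \<omega>) = max (- C) (min C (g n r \<omega>))" for r by (rule clip_def)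
    show "set_integrable lborel {t..v} (\<lambda>v. clip C (g n v \<omega>))" if "v \<in> {t..s}" for v
      using clip_g_integrable(5)[OF good, of v n] that ts by auto
    show "set_integrable lborel {t..v} (\<lambda>v. \<eta> (X v \<omega>))" if "v \<in> {t..s}" for v
      using clip_g_integrable(3)[OF good, of v] that ts by auto
    show "set_integrable lborel {t..s} (\<lambda>r. g n r \<omega>)"
      by (rule g_integrable(5)[OF good ts(2)])
  qed (use close in auto)
  define f where "f r = \<bar>simple_shift t (k n) (a n) (\<xi>' n) r \<omega>\<bar>" for r
  have "f \<tau> = \<bar>(W \<tau> \<omega> - W t \<omega>) + (LBINT v:{t..\<tau>}. clip C (g n v \<omega>))\<bar>"
    unfolding f_def simple_shift_def \<xi>'_def using drift_eq[of \<tau> "clip C" n \<omega>] \<tau>(1) ts by simp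
  then have "R / \<sigma> - 2 < f \<tau>" using \<tau>(2) by simp
  moreover have "continuous_on {t..s} f"
  proof -
    have "continuous_on {t..s} (\<lambda>r. W r \<omega>)" by (rule continuous_on_subset[OF X(2)]) (use t in auto)
    then have Wc: "continuous_on {t..s} (\<lambda>r. W r \<omega>)" .
    show ?thesis
      unfolding f_def simple_shift_def simple_integral_def by (intro continuous_intros Wc)
  qed
  ultimately obtain d where "d \<in> D" "R / \<sigma> - 2 < f d"
    unfolding D_def using dense_grid[of t s f \<tau> "R / \<sigma> - 2"] \<tau>(1) by blast
  then show ?thesis using X(4) unfolding V_def f_def by (blast intro: less_imp_le)
qed

text \<open>Each summand has its own reason to be controlled: on paths in the ball the truncated
  density converges boundedly; on \<open>V n\<close> the maximal inequality applies; a poor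
  approximation has small probability, and N is held fixed; and the excess over N is at most the
  square divided by N, which the L2 bound controls.\<close>

lemma z_le:
  assumes "good \<omega>" "0 < N"
  shows "z n \<omega> \<le> indicator (space M - U) \<omega> * min (z n \<omega>) N + indicator (V n) \<omega> * z n \<omega>
     + N * indicator {\<omega> \<in> space M. \<epsilon>\<^sub>0 / 2 < J n \<omega>} \<omega> + (z n \<omega>)\<^sup>2 / N"
proof -
  have sp: "\<omega> \<in> space M" by (rule good_space[OF assms(1)])
  have sq: "z n \<omega> \<le> N + (z n \<omega>)\<^sup>2 / N" "z n \<omega> \<le> min (z n \<omega>) N + (z n \<omega>)\<^sup>2 / N"
  proof -
    show "z n \<omega> \<le> min (z n \<omega>) N + (z n \<omega>)\<^sup>2 / N"
    proof (cases "z n \<omega> \<le> N")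
      case False
      then have "z n \<omega> * N \<le> z n \<omega> * z n \<omega>" using z_pos[of n \<omega>] by (intro mult_left_mono) auto
      then have "z n \<omega> \<le> (z n \<omega>)\<^sup>2 / N" using assms(2) by (simp add: field_simps power2_eq_square)
      then show ?thesis using False assms(2) by simp
    qed (use assms in auto)
    then show "z n \<omega> \<le> N + (z n \<omega>)\<^sup>2 / N" by linarith
  qed
  have nn: "0 \<le> (z n \<omega>)\<^sup>2 / N" "0 \<le> z n \<omega>" using assms z_pos[of n \<omega>] by auto
  show ?thesis
  proof (cases "\<omega> \<in> U")
    case False
    then show ?thesis using sq(2) nn sp assms(2) by (auto split: split_indicator)
  next
    case True
    show ?thesis
    proof (cases "J n \<omega> \<le> \<epsilon>\<^sub>0 / 2")
      case J: True
      then have "\<omega> \<in> V n" by (rule exit_in_V[OF assms(1) True])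
      then show ?thesis using nn assms(2) True by (auto split: split_indicator)
    next
      case False
      then show ?thesis using sq(1) nn sp True by (auto split: split_indicator)
    qed
  qed
qed

text \<open>The stochastic integrals are known to converge to \<open>I\<close> only for the
  unclipped integrands. The change caused by clipping therefore has to be shown to vanish
  separately, and it does so only where X stays in the ball.\<close>

definition defect :: "nat \<Rightarrow> 'a \<Rightarrow> real" where
  "defect n \<omega> = indicator (space M - U) \<omega> *
     (simple_integral W (k n) (a n) (\<xi> n) s \<omega> - simple_integral W (k n) (a n) (\<xi>' n) s \<omega>)"

text \<open>Off \<open>U\<close> the defect is the stochastic integral of the clipped-off part,
  whose energy is at most \<open>J n\<close>. As \<open>J n\<close> tends to zero in probability,
  \<open>simple_integral_tail\<close> applies.\<close>

lemma defect_conv: "converges_in_prob M defect (\<lambda>_. 0)"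
  unfolding converges_in_prob_def
proof (intro conjI allI impI)
  have [measurable]: "simple_integral W (k n) (a n) (\<xi> n) s \<in> borel_measurable M"
    "simple_integral W (k n) (a n) (\<xi>' n) s \<in> borel_measurable M" for n
    using simple_density_measurable(2)[OF simple t(1) ts(1)] simple_density_measurable(2)[OF simple' t(1) ts(1)] by auto
  show dm[measurable]: "defect n \<in> borel_measurable M" for n
    unfolding defect_def[abs_def] by measurable
  fix \<epsilon> :: real assume \<epsilon>: "0 < \<epsilon>"
  show "(\<lambda>n. prob {\<omega> \<in> space M. \<epsilon> < \<bar>defect n \<omega> - 0\<bar>}) \<longlonglongrightarrow> 0"
  proof (rule tendsto_upperbound_zero)
    fix e :: real assume e: "0 < e"
    \<comment> \<open>With energy level \<open>1 / \<theta>\<^sup>2\<close> the exponent of the tail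
      bound is 1/2 - \<theta> \<epsilon>, and this \<theta> makes it - 1 - \<bar>ln (4 / e)\<bar>.
      The tail is then below e / 2; the other half of e is left for the event of large
      energy.\<close>
    define \<theta> where "\<theta> = (3 / 2 + \<bar>ln (4 / e)\<bar>) / \<epsilon>"
    have \<theta>: "0 < \<theta>" unfolding \<theta>_def using \<epsilon> by (auto intro: divide_pos_pos add_pos_nonneg)
    have "2 * exp (\<theta>\<^sup>2 * (1 / \<theta>\<^sup>2) / 2 - \<theta> * \<epsilon>) < e / 2"
    proof -
      have "\<theta>\<^sup>2 * (1 / \<theta>\<^sup>2) / 2 - \<theta> * \<epsilon> = - 1 - \<bar>ln (4 / e)\<bar>" using \<theta> \<epsilon> unfolding \<theta>_def by simp
      also have "\<dots> < - ln (4 / e)" by simp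
      finally have "exp (\<theta>\<^sup>2 * (1 / \<theta>\<^sup>2) / 2 - \<theta> * \<epsilon>) < exp (- ln (4 / e))" by simp
      also have "\<dots> = e / 4" using e by (simp add: exp_minus)
      finally show ?thesis by simp
    qed
    note small = this
    have "(\<lambda>n. prob {\<omega> \<in> space M. 1 / \<theta>\<^sup>2 < \<bar>J n \<omega> - 0\<bar>}) \<longlonglongrightarrow> 0"
      using L2 \<theta> unfolding converges_in_prob_def J_def by simp
    then have "eventually (\<lambda>n. prob {\<omega> \<in> space M. 1 / \<theta>\<^sup>2 < \<bar>J n \<omega> - 0\<bar>} < e / 2) sequentially"
      by (rule order_tendstoD(2)) (use e in simp)
    then show "eventually (\<lambda>n. prob {\<omega> \<in> space M. \<epsilon> < \<bar>defect n \<omega> - 0\<bar>} < e) sequentially"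
    proof eventually_elim
      case (elim n)
      define \<Delta> where "\<Delta> i \<omega> = \<xi> n i \<omega> - \<xi>' n i \<omega>" for i \<omega>
      define A where "A = {\<omega> \<in> space M. 1 / \<theta>\<^sup>2 < \<bar>J n \<omega> - 0\<bar>}"
      define B where "B = {\<omega> \<in> space M. \<epsilon> < \<bar>simple_integral W (k n) (a n) \<Delta> s \<omega>\<bar> \<and>
        simple_energy (k n) (a n) \<Delta> s \<omega> \<le> 1 / \<theta>\<^sup>2}"
      have sd: "simple_data F t T (k n) (a n) \<Delta>"
        unfolding \<Delta>_def \<xi>'_def
        using simple_data_comp[OF simple[of n] continuous_on_diff[OF continuous_on_id continuous_clip[of C]]] by simp
      have [measurable]: "simple_integral W (k n) (a n) \<Delta> s \<in> borel_measurable M"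
        "simple_energy (k n) (a n) \<Delta> s \<in> borel_measurable M"
        using simple_density_measurable[OF sd t(1) ts(1)] by auto
      have AB: "A \<in> sets M" "B \<in> sets M" unfolding A_def B_def by measurable
      have "prob {\<omega> \<in> space M. \<epsilon> < \<bar>defect n \<omega> - 0\<bar>} \<le> prob (A \<union> B)"
      proof (rule finite_measure_mono_AE)
        show "AE \<omega> in M. \<omega> \<in> {\<omega> \<in> space M. \<epsilon> < \<bar>defect n \<omega> - 0\<bar>} \<longrightarrow> \<omega> \<in> A \<union> B"
          using AE_good
        proof eventually_elim
          case (elim \<omega>)
          show ?case
          proof
            assume a: "\<omega> \<in> {\<omega> \<in> space M. \<epsilon> < \<bar>defect n \<omega> - 0\<bar>}"
            then have U: "\<omega> \<notin> U" using \<epsilon> unfolding defect_def by (auto split: split_indicator_asm)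
            have "simple_integral W (k n) (a n) \<Delta> s \<omega> = defect n \<omega>"
              using U a unfolding \<Delta>_def simple_integral_linear(2) defect_def by simp
            moreover have "simple_energy (k n) (a n) \<Delta> s \<omega> \<le> J n \<omega>"
              unfolding \<Delta>_def by (rule energy_defect[OF elim U])
            ultimately show "\<omega> \<in> A \<union> B" using a unfolding A_def B_def by auto
          qed
        qed
      qed (use AB in auto)
      also have "\<dots> \<le> prob A + prob B" by (rule measure_Un_le[OF AB])
      also have "prob B \<le> 2 * exp (\<theta>\<^sup>2 * (1 / \<theta>\<^sup>2) / 2 - \<theta> * \<epsilon>)"
        unfolding B_def by (rule simple_integral_tail[OF sd t(1) ts(1,2) \<theta>])
      finally show ?case using small elim unfolding A_def by linarith
    qed
  qed simp
qed simp

lemma z_limit: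
  assumes good: "good \<omega>" and U: "\<omega> \<notin> U" and J: "(\<lambda>n. J (\<phi> n) \<omega>) \<longlonglongrightarrow> 0"
    and I: "(\<lambda>n. simple_integral W (k (\<phi> n)) (a (\<phi> n)) (\<xi> (\<phi> n)) s \<omega>) \<longlonglongrightarrow> I s \<omega>"
    and d: "(\<lambda>n. defect (\<phi> n) \<omega>) \<longlonglongrightarrow> 0"
  shows "(\<lambda>n. z (\<phi> n) \<omega>) \<longlonglongrightarrow> Z s \<omega>"
proof -
  have sp: "\<omega> \<in> space M" by (rule good_space[OF good])
  have "(\<lambda>n. simple_integral W (k (\<phi> n)) (a (\<phi> n)) (\<xi> (\<phi> n)) s \<omega> - defect (\<phi> n) \<omega>) \<longlonglongrightarrow> I s \<omega> - 0"
    by (rule tendsto_diff[OF I d])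
  then have I': "(\<lambda>n. simple_integral W (k (\<phi> n)) (a (\<phi> n)) (\<xi>' (\<phi> n)) s \<omega>) \<longlonglongrightarrow> I s \<omega>"
    using sp U unfolding defect_def by simp
  have "(\<lambda>n. LBINT r:{t..s}. (clip C (g (\<phi> n) r \<omega>) - \<eta> (X r \<omega>))\<^sup>2) \<longlonglongrightarrow> 0"
  proof (rule tendsto_sandwich[OF _ _ tendsto_const J])
    show "eventually (\<lambda>n. 0 \<le> (LBINT r:{t..s}. (clip C (g (\<phi> n) r \<omega>) - \<eta> (X r \<omega>))\<^sup>2)) sequentially"
      unfolding set_lebesgue_integral_def by (intro always_eventually allI integral_nonneg_AE) auto
    have "(LBINT r:{t..s}. (clip C (g n r \<omega>) - \<eta> (X r \<omega>))\<^sup>2) \<le> (LBINT r:{t..s}. (g n r \<omega> - \<eta> (X r \<omega>))\<^sup>2)" for n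
      by (rule set_integral_mono[OF clip_g_integrable(2)[OF good ts(2)] g_integrable(2)[OF good ts(2)]])
        (intro abs_le_imp_square_le clip_close outside_U[OF good U])
    then show "eventually (\<lambda>n. (LBINT r:{t..s}. (clip C (g (\<phi> n) r \<omega>) - \<eta> (X r \<omega>))\<^sup>2) \<le> J (\<phi> n) \<omega>) sequentially"
      using J_ge[OF good] by (intro always_eventually allI) (rule order_trans)
  qed
  then have "(\<lambda>n. LBINT r:{t..s}. (clip C (g (\<phi> n) r \<omega>))\<^sup>2) \<longlonglongrightarrow> (LBINT r:{t..s}. (\<eta> (X r \<omega>))\<^sup>2)"
    by (intro L2_convergence_drift_energy(3)[OF ts(1) order_refl h_cont[OF good ts(2)] clip_g_measurable clip_g_bounded])
  then have e: "(\<lambda>n. simple_energy (k (\<phi> n)) (a (\<phi> n)) (\<xi>' (\<phi> n)) s \<omega>) \<longlonglongrightarrow> (LBINT r:{t..s}. (\<eta> (X r \<omega>))\<^sup>2)"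
    using drift_eq[OF s, of "\<lambda>y. (clip C y)\<^sup>2"] unfolding \<xi>'_def by simp
  show ?thesis
    unfolding z_def simple_density_def exp_density_def
    using tendsto_exp[OF tendsto_diff[OF tendsto_minus[OF I'] tendsto_divide[OF e tendsto_const[of 2]]]] by simp
qed

text \<open>Integrate \<open>z_le\<close> and let the index tend to infinity with R, C and N fixed;
  the summand with the probability of a poor approximation disappears. N remains free because it can
  be chosen only after C is known.\<close>

lemma Z_lower:
  assumes N: "0 < N"
  shows "1 \<le> (\<integral>\<omega>. Z s \<omega> \<partial>M) + 2 * exp ((T - t) / 2 - (R / \<sigma> - 2)) + exp (C\<^sup>2 * (s - t)) / N"
proof -
  \<comment> \<open>The indices 0, 1, 2 encode the L2 error, the unclipped integral and the defect,
    for which a common subsequence is needed.\<close>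
  define Y where "Y i n = (case i of (0::nat) \<Rightarrow> J n | Suc 0 \<Rightarrow> simple_integral W (k n) (a n) (\<xi> n) s | _ \<Rightarrow> defect n)" for i n
  define L where "L i = (case i of Suc 0 \<Rightarrow> I s | _ \<Rightarrow> (\<lambda>_. 0))" for i
  have "converges_in_prob M (Y i) (L i)" if "i \<in> {0, 1, 2}" for i
    using that L2 integral_conv[OF s] defect_conv unfolding Y_def L_def J_def[abs_def]
    by (auto simp: numeral_2_eq_2)
  then obtain \<phi> :: "nat \<Rightarrow> nat" where \<phi>: "strict_mono \<phi>"
      "\<And>i. i \<in> {0, 1, 2} \<Longrightarrow> AE \<omega> in M. (\<lambda>n. Y i (\<phi> n) \<omega>) \<longlonglongrightarrow> L i \<omega>"
    using converges_in_prob_common_AE_subseq[of "{0, 1, 2}" Y L] by blast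
  have lim: "AE \<omega> in M. (\<lambda>n. J (\<phi> n) \<omega>) \<longlonglongrightarrow> 0"
    "AE \<omega> in M. (\<lambda>n. simple_integral W (k (\<phi> n)) (a (\<phi> n)) (\<xi> (\<phi> n)) s \<omega>) \<longlonglongrightarrow> I s \<omega>"
    "AE \<omega> in M. (\<lambda>n. defect (\<phi> n) \<omega>) \<longlonglongrightarrow> 0"
    using \<phi>(2)[of 0] \<phi>(2)[of 1] \<phi>(2)[of 2] unfolding Y_def L_def by (simp_all add: numeral_2_eq_2)
  have zm[measurable]: "z n \<in> borel_measurable M" for n using z_integrable(1) by auto
  have Zm[measurable]: "Z s \<in> borel_measurable M" by (rule Z_measurable_M[OF s])
  define q where "q n = (\<integral>\<omega>. indicator (space M - U) \<omega> * min (z n \<omega>) N \<partial>M)" for n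
  define p where "p n = prob {\<omega> \<in> space M. \<epsilon>\<^sub>0 / 2 < J n \<omega>}" for n
  have limq: "(\<lambda>n. q (\<phi> n)) \<longlonglongrightarrow> (\<integral>\<omega>. indicator (space M - U) \<omega> * min (Z s \<omega>) N \<partial>M)"
    unfolding q_def
  proof (rule integral_dominated_convergence[where w = "\<lambda>_. N"])
    show "AE \<omega> in M. (\<lambda>n. indicator (space M - U) \<omega> * min (z (\<phi> n) \<omega>) N)
        \<longlonglongrightarrow> indicator (space M - U) \<omega> * min (Z s \<omega>) N"
      using lim AE_good
    proof eventually_elim
      case (elim \<omega>)
      show ?case
      proof (cases "\<omega> \<in> U")
        case False
        then show ?thesis using z_limit[OF elim(4) False elim(1,2,3)] by (intro tendsto_intros)
      qed simp
    qed
    show "AE \<omega> in M. norm (indicator (space M - U) \<omega> * min (z (\<phi> n) \<omega>) N) \<le> N" for n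
    proof (rule AE_I2)
      fix \<omega>
      show "norm (indicator (space M - U) \<omega> * min (z (\<phi> n) \<omega>) N) \<le> N"
        using z_pos[of "\<phi> n" \<omega>] N by (auto split: split_indicator)
    qed
  qed auto
  have "(\<integral>\<omega>. indicator (space M - U) \<omega> * min (Z s \<omega>) N \<partial>M) \<le> (\<integral>\<omega>. Z s \<omega> \<partial>M)"
  proof (rule integral_mono[OF _ Z_integrable(1)[OF s]])
    show "integrable M (\<lambda>\<omega>. indicator (space M - U) \<omega> * min (Z s \<omega>) N)"
      by (rule Bochner_Integration.integrable_bound[OF Z_integrable(1)[OF s]])
        (use Z_pos[of s] N in \<open>auto split: split_indicator simp: min_def less_imp_le\<close>)
    show "indicator (space M - U) \<omega> * min (Z s \<omega>) N \<le> Z s \<omega>" for \<omega>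
      using Z_pos[of s \<omega>] by (auto split: split_indicator)
  qed
  moreover have limp: "(\<lambda>n. p (\<phi> n)) \<longlonglongrightarrow> 0"
  proof -
    have J0: "0 \<le> J n \<omega>" for n \<omega> unfolding J_def set_lebesgue_integral_def by (intro integral_nonneg_AE) auto
    have half_pos: "0 < \<epsilon>\<^sub>0 / 2" using eps0(1) by simp
    have "(\<lambda>n. prob {\<omega> \<in> space M. \<epsilon>\<^sub>0 / 2 < \<bar>J n \<omega> - 0\<bar>}) \<longlonglongrightarrow> 0"
      using L2 half_pos unfolding converges_in_prob_def J_def by blast
    then have "p \<longlonglongrightarrow> 0" unfolding p_def using J0 by simp
    from LIMSEQ_subseq_LIMSEQ[OF this \<phi>(1)] show ?thesis by (simp add: o_def)
  qed
  moreover have "1 \<le> q n + 2 * exp ((T - t) / 2 - (R / \<sigma> - 2)) + N * p n + exp (C\<^sup>2 * (s - t)) / N" for n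
  proof -
    define A where "A = {\<omega> \<in> space M. \<epsilon>\<^sub>0 / 2 < J n \<omega>}"
    have A: "A \<in> sets M" unfolding A_def by measurable
    have i1: "integrable M (\<lambda>\<omega>. indicator (space M - U) \<omega> * min (z n \<omega>) N)"
      by (rule integrable_const_bound[where B = N])
        (use z_pos[of n] N in \<open>auto split: split_indicator simp: min_def less_imp_le\<close>)
    have i2: "integrable M (\<lambda>\<omega>. indicator (V n) \<omega> * z n \<omega>)"
      by (rule integrable_indicator_times[OF V_sets z_integrable(1)])
    have i3: "integrable M (\<lambda>\<omega>. N * indicator A \<omega>)" using A by (simp add: emeasure_eq_measure)
    have i4: "integrable M (\<lambda>\<omega>. (z n \<omega>)\<^sup>2 / N)" using z_square(1) by simp
    have "1 = (\<integral>\<omega>. z n \<omega> \<partial>M)" by (simp add: z_integrable)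
    also have "\<dots> \<le> (\<integral>\<omega>. indicator (space M - U) \<omega> * min (z n \<omega>) N + indicator (V n) \<omega> * z n \<omega>
     + N * indicator A \<omega> + (z n \<omega>)\<^sup>2 / N \<partial>M)"
    proof (rule integral_mono_AE[OF z_integrable(1)])
      show "AE \<omega> in M. z n \<omega> \<le> indicator (space M - U) \<omega> * min (z n \<omega>) N + indicator (V n) \<omega> * z n \<omega>
         + N * indicator A \<omega> + (z n \<omega>)\<^sup>2 / N"
        using AE_good unfolding A_def by eventually_elim (rule z_le[OF _ N])
    qed (intro Bochner_Integration.integrable_add i1 i2 i3 i4)
    also have "\<dots> = q n + (\<integral>\<omega>. indicator (V n) \<omega> * z n \<omega> \<partial>M) + N * p n + (\<integral>\<omega>. (z n \<omega>)\<^sup>2 \<partial>M) / N"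
      using i1 i2 i3 i4 A unfolding q_def p_def A_def[symmetric] by simp
    also have "\<dots> \<le> q n + 2 * exp ((T - t) / 2 - (R / \<sigma> - 2)) + N * p n + exp (C\<^sup>2 * (s - t)) / N"
      using V_bound[of n] z_square(2)[of n] N by (intro add_mono divide_right_mono) auto
    finally show ?thesis .
  qed
  then have "1 \<le> q (\<phi> n) + 2 * exp ((T - t) / 2 - (R / \<sigma> - 2)) + N * p (\<phi> n) + exp (C\<^sup>2 * (s - t)) / N" for n .
  then have "1 \<le> (\<integral>\<omega>. indicator (space M - U) \<omega> * min (Z s \<omega>) N \<partial>M) + 2 * exp ((T - t) / 2 - (R / \<sigma> - 2)) + N * 0 + exp (C\<^sup>2 * (s - t)) / N"
    by (intro LIMSEQ_le_const[OF tendsto_add[OF tendsto_add[OF tendsto_add[OF limq tendsto_const] tendsto_mult[OF tendsto_const limp]] tendsto_const]])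
      auto
  ultimately show ?thesis by linarith
qed

end

section \<open>Passage to the limit\<close>

text \<open>The difference of the products splits in two. Replacing \<open>f n\<close> by
  \<open>f'\<close> costs at most their L1 distance, which vanishes by Scheffe's lemma because the
  masses agree; replacing \<open>c n\<close> by \<open>c'\<close> is dominated convergence with
  majorant \<open>f'\<close>.\<close>

lemma Scheffe_integral_limit:
  fixes f :: "nat \<Rightarrow> 'a \<Rightarrow> real" and f' :: "'a \<Rightarrow> real" and c :: "nat \<Rightarrow> 'a \<Rightarrow> complex"
  assumes f: "\<And>n. integrable M (f n)" "integrable M f'" "\<And>n \<omega>. 0 \<le> f n \<omega>" "\<And>\<omega>. 0 \<le> f' \<omega>"
    and eq: "\<And>n. (\<integral>\<omega>. f n \<omega> \<partial>M) = (\<integral>\<omega>. f' \<omega> \<partial>M)" and lim: "AE \<omega> in M. (\<lambda>n. f n \<omega>) \<longlonglongrightarrow> f' \<omega>"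
    and c[measurable]: "\<And>n. c n \<in> borel_measurable M" "c' \<in> borel_measurable M"
    and cb: "\<And>n \<omega>. norm (c n \<omega>) \<le> 1" and clim: "AE \<omega> in M. (\<lambda>n. c n \<omega>) \<longlonglongrightarrow> c' \<omega>"
  shows "(\<lambda>n. \<integral>\<omega>. complex_of_real (f n \<omega>) * c n \<omega> \<partial>M) \<longlonglongrightarrow> (\<integral>\<omega>. complex_of_real (f' \<omega>) * c' \<omega> \<partial>M)"
proof -
  have [measurable]: "f n \<in> borel_measurable M" "f' \<in> borel_measurable M" for n using f by auto
  have "(\<lambda>n. \<integral>\<^sup>+\<omega>. norm (f n \<omega> - f' \<omega>) \<partial>M) \<longlonglongrightarrow> 0"
  proof (rule Scheffe_lemma2)
    show "(\<integral>\<^sup>+\<omega>. norm (f n \<omega>) \<partial>M) \<le> (\<integral>\<^sup>+\<omega>. norm (f' \<omega>) \<partial>M)" for n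
      using f eq[of n] by (simp add: nn_integral_eq_integral)
  qed (use f lim in auto)
  then have "(\<lambda>n. ennreal (\<integral>\<omega>. norm (f n \<omega> - f' \<omega>) \<partial>M)) \<longlonglongrightarrow> 0"
    using f by (subst (asm) nn_integral_eq_integral) auto
  then have L1: "(\<lambda>n. \<integral>\<omega>. norm (f n \<omega> - f' \<omega>) \<partial>M) \<longlonglongrightarrow> 0"
    by (subst (asm) ennreal_tendsto_0_iff) auto
  have i: "integrable M (\<lambda>\<omega>. complex_of_real (f n \<omega>) * c m \<omega>)" "integrable M (\<lambda>\<omega>. complex_of_real (f' \<omega>) * c m \<omega>)" for n m
  proof -
    show "integrable M (\<lambda>\<omega>. complex_of_real (f n \<omega>) * c m \<omega>)"
      by (rule Bochner_Integration.integrable_bound[OF f(1)[of n]])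
        (use cb[of m] f(3)[of n] in \<open>auto simp: norm_mult mult_left_le\<close>)
    show "integrable M (\<lambda>\<omega>. complex_of_real (f' \<omega>) * c m \<omega>)"
      by (rule Bochner_Integration.integrable_bound[OF f(2)])
        (use cb[of m] f(4) in \<open>auto simp: norm_mult mult_left_le\<close>)
  qed
  have lim': "(\<lambda>n. \<integral>\<omega>. complex_of_real (f' \<omega>) * c n \<omega> \<partial>M) \<longlonglongrightarrow> (\<integral>\<omega>. complex_of_real (f' \<omega>) * c' \<omega> \<partial>M)"
  proof (rule integral_dominated_convergence[where w = f'])
    show "AE \<omega> in M. (\<lambda>n. complex_of_real (f' \<omega>) * c n \<omega>) \<longlonglongrightarrow> complex_of_real (f' \<omega>) * c' \<omega>"
      using clim by eventually_elim (intro tendsto_intros)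
    show "AE \<omega> in M. norm (complex_of_real (f' \<omega>) * c n \<omega>) \<le> f' \<omega>" for n
      using cb[of n] f(4) by (auto simp: norm_mult mult_left_le)
  qed (use f in auto)
  have "(\<lambda>n. (\<integral>\<omega>. complex_of_real (f n \<omega>) * c n \<omega> \<partial>M) - (\<integral>\<omega>. complex_of_real (f' \<omega>) * c n \<omega> \<partial>M)) \<longlonglongrightarrow> 0"
  proof (rule Lim_null_comparison[OF always_eventually L1], rule allI)
    fix n
    have "(\<integral>\<omega>. complex_of_real (f n \<omega>) * c n \<omega> \<partial>M) - (\<integral>\<omega>. complex_of_real (f' \<omega>) * c n \<omega> \<partial>M)
        = (\<integral>\<omega>. complex_of_real (f n \<omega> - f' \<omega>) * c n \<omega> \<partial>M)"
      using i(1)[of n n] i(2)[of n] by (subst Bochner_Integration.integral_diff[symmetric]) (auto simp: left_diff_distrib)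
    also have "norm \<dots> \<le> (\<integral>\<omega>. norm (complex_of_real (f n \<omega> - f' \<omega>) * c n \<omega>) \<partial>M)"
      by (rule integral_norm_bound)
    also have "\<dots> \<le> (\<integral>\<omega>. norm (f n \<omega> - f' \<omega>) \<partial>M)"
    proof (rule integral_mono)
      show "integrable M (\<lambda>\<omega>. norm (complex_of_real (f n \<omega> - f' \<omega>) * c n \<omega>))"
        using integrable_norm[OF Bochner_Integration.integrable_diff[OF i(1)[of n n] i(2)[of n]]]
        by (simp add: left_diff_distrib)
      show "norm (complex_of_real (f n \<omega> - f' \<omega>) * c n \<omega>) \<le> norm (f n \<omega> - f' \<omega>)" for \<omega>
        using mult_left_le[OF cb[of n \<omega>], of "\<bar>f n \<omega> - f' \<omega>\<bar>"]
        by (simp only: norm_mult norm_of_real real_norm_def abs_ge_zero)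
    qed (use f in auto)
    finally show "norm ((\<integral>\<omega>. complex_of_real (f n \<omega>) * c n \<omega> \<partial>M) - (\<integral>\<omega>. complex_of_real (f' \<omega>) * c n \<omega> \<partial>M))
        \<le> (\<integral>\<omega>. norm (f n \<omega> - f' \<omega>) \<partial>M)" .
  qed
  from tendsto_add[OF this lim'] show ?thesis by simp
qed

context ito_approximation
begin

lemma Z_expectation:
  assumes s: "s \<in> {t..T}"
  shows "(\<integral>\<omega>. Z s \<omega> \<partial>M) = 1"
proof (rule antisym[OF Z_integrable(2)[OF s]], rule ccontr)
  define e where "e = 1 - (\<integral>\<omega>. Z s \<omega> \<partial>M)"
  assume "\<not> 1 \<le> (\<integral>\<omega>. Z s \<omega> \<partial>M)"
  then have e: "0 < e" unfolding e_def by simp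
  \<comment> \<open>This makes the exponent of the maximal inequality equal to - 1 - \<bar>ln (8 /
    e)\<bar>, so that twice the exponential is below e / 4, a quarter of the supposedly missing
    mass.\<close>
  define R where "R = \<sigma> * (3 + (T - t) / 2 + \<bar>ln (8 / e)\<bar>)"
  have "0 \<le> (T - t) / 2" using t by simp
  then have "0 < 3 + (T - t) / 2 + \<bar>ln (8 / e)\<bar>" by linarith
  then have R: "0 < R" unfolding R_def using sig by simp
  have "compact (\<eta> ` {x - R..x + R})"
    by (intro compact_continuous_image continuous_on_subset[OF eta]) auto
  then obtain C where C: "\<And>y. y \<in> \<eta> ` {x - R..x + R} \<Longrightarrow> \<bar>y\<bar> \<le> C"
    using compact_imp_bounded bounded_real by metis
  have "0 \<le> C" using C[of "\<eta> x"] R by auto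
  interpret clipped_approximation M F W \<sigma> x t T \<eta> X I k a \<xi> s R C
  proof unfold_locales
    show "\<bar>\<eta> y\<bar> \<le> C" if "\<bar>y - x\<bar> \<le> R" for y
      using that by (intro C imageI) auto
  qed (use s R \<open>0 \<le> C\<close> in auto)
  \<comment> \<open>Chosen after C, so that the square term is exactly e / 4. The two errors
    together stay below e / 2, which contradicts a missing mass of e.\<close>
  define N where "N = 4 * exp (C\<^sup>2 * (s - t)) / e"
  have "0 < N" unfolding N_def using e by simp
  have "(T - t) / 2 - (R / \<sigma> - 2) = - 1 - \<bar>ln (8 / e)\<bar>" unfolding R_def using sig by simp
  also have "\<dots> < - ln (8 / e)" by simp
  finally have "exp ((T - t) / 2 - (R / \<sigma> - 2)) < exp (- ln (8 / e))" by simp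
  also have "\<dots> = e / 8" using e by (simp add: exp_minus)
  finally have tail: "exp ((T - t) / 2 - (R / \<sigma> - 2)) < e / 8" .
  have square: "exp (C\<^sup>2 * (s - t)) / N = e / 4" unfolding N_def using e by simp
  have "False" if "p < e / 8" "q = e / 4" "1 \<le> v + 2 * p + q" "e = 1 - v" for p q v
    using that e by linarith
  from this[OF tail square Z_lower[OF \<open>0 < N\<close>] e_def] show False .
qed

text \<open>The identity of \<open>simple_density_char\<close> passes to the limit on both sides
  along one subsequence serving r and s. Knowing that the mass of Z is 1 at both times is what makes
  \<open>Scheffe_integral_limit\<close> applicable.\<close>

lemma Z_char:
  assumes rs: "t \<le> r" "r \<le> s" "s \<le> T" and A: "A \<in> sets (F r)"
  shows "(\<integral>\<omega>. complex_of_real (Z s \<omega>) * (complex_of_real (indicator A \<omega>) * iexp (u * ((X s \<omega> - X r \<omega>) / \<sigma>))) \<partial>M)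
    = complex_of_real (exp (- u\<^sup>2 * (s - r) / 2) * (\<integral>\<omega>. indicator A \<omega> * Z r \<omega> \<partial>M))"
proof -
  have r: "r \<in> {t..T}" and s: "s \<in> {t..T}" using rs by auto
  have AM[measurable]: "A \<in> sets M" using A sets_F_subset[of r] rs t by auto
  obtain \<phi> :: "nat \<Rightarrow> nat" where \<phi>: "AE \<omega> in M. (\<lambda>n. J (\<phi> n) \<omega>) \<longlonglongrightarrow> 0"
    "\<And>v. v \<in> {r, s} \<Longrightarrow> AE \<omega> in M. (\<lambda>n. simple_integral W (k (\<phi> n)) (a (\<phi> n)) (\<xi> (\<phi> n)) v \<omega>) \<longlonglongrightarrow> I v \<omega>"
    using common_subseq[of "{r, s}"] r s by blast
  define f where "f v n = simple_density (k (\<phi> n)) (a (\<phi> n)) (\<xi> (\<phi> n)) v" for v n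
  define S where "S v n = simple_shift t (k (\<phi> n)) (a (\<phi> n)) (\<xi> (\<phi> n)) v" for v n
  have flim: "AE \<omega> in M. (\<lambda>n. f v n \<omega>) \<longlonglongrightarrow> Z v \<omega>" if "v \<in> {r, s}" for v
    unfolding f_def by (rule AE_simple_density_limit[OF _ \<phi>(1) \<phi>(2)[OF that]]) (use that r s in auto)
  have fi: "integrable M (f v n)" "(\<integral>\<omega>. f v n \<omega> \<partial>M) = (\<integral>\<omega>. Z v \<omega> \<partial>M)" if "v \<in> {t..T}" for v n
    unfolding f_def Z_expectation[OF that] using simple_density_integrable[OF simple t(1)] that by auto
  have f0: "0 \<le> f v n \<omega>" "0 \<le> Z v \<omega>" for v n \<omega> unfolding f_def using Z_pos[of v \<omega>] by simp_all
  have Sm[measurable]: "S v n \<in> borel_measurable M" if "v \<in> {t..T}" for v n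
    unfolding S_def using simple_density_measurable(4)[OF simple t(1)] that by auto
  have Xm: "X v \<in> borel_measurable M" if "v \<in> {t..T}" for v
    by (rule measurable_F_M[OF X_meas]) (use that t in auto)
  have Slim: "AE \<omega> in M. (\<lambda>n. S s n \<omega> - S r n \<omega>) \<longlonglongrightarrow> (X s \<omega> - X r \<omega>) / \<sigma>"
    using \<phi>(1) X_path
  proof eventually_elim
    case (elim \<omega>)
    have "(\<lambda>n. S s n \<omega> - S r n \<omega>) \<longlonglongrightarrow> (X s \<omega> - x) / \<sigma> - (X r \<omega> - x) / \<sigma>"
      unfolding S_def
      by (intro tendsto_diff simple_shift_limit[OF s elim(1)] simple_shift_limit[OF r elim(1)]) (use elim(2) r s in blast)+
    then show ?case by (simp add: diff_divide_distrib)
  qed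
  have lim_s: "(\<lambda>n. \<integral>\<omega>. complex_of_real (f s n \<omega>) * (complex_of_real (indicator A \<omega>) * iexp (u * (S s n \<omega> - S r n \<omega>))) \<partial>M)
    \<longlonglongrightarrow> (\<integral>\<omega>. complex_of_real (Z s \<omega>) * (complex_of_real (indicator A \<omega>) * iexp (u * ((X s \<omega> - X r \<omega>) / \<sigma>))) \<partial>M)"
  proof (rule Scheffe_integral_limit[OF fi(1)[OF s] Z_integrable(1)[OF s] f0 fi(2)[OF s] flim])
    have [measurable]: "S s n \<in> borel_measurable M" "S r n \<in> borel_measurable M"
      "X s \<in> borel_measurable M" "X r \<in> borel_measurable M" for n using Sm Xm r s by auto
    show "(\<lambda>\<omega>. complex_of_real (indicator A \<omega>) * iexp (u * (S s n \<omega> - S r n \<omega>))) \<in> borel_measurable M" for n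
      by measurable
    show "(\<lambda>\<omega>. complex_of_real (indicator A \<omega>) * iexp (u * ((X s \<omega> - X r \<omega>) / \<sigma>))) \<in> borel_measurable M"
      by measurable
    show "norm (complex_of_real (indicator A \<omega>) * iexp (u * (S s n \<omega> - S r n \<omega>))) \<le> 1" for n \<omega>
      by (auto simp: norm_mult split: split_indicator)
    show "AE \<omega> in M. (\<lambda>n. complex_of_real (indicator A \<omega>) * iexp (u * (S s n \<omega> - S r n \<omega>)))
        \<longlonglongrightarrow> complex_of_real (indicator A \<omega>) * iexp (u * ((X s \<omega> - X r \<omega>) / \<sigma>))"
      using Slim by eventually_elim (intro tendsto_intros)
  qed simp
  have char_n: "(\<integral>\<omega>. complex_of_real (f s n \<omega>) * (complex_of_real (indicator A \<omega>) * iexp (u * (S s n \<omega> - S r n \<omega>))) \<partial>M)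
      = complex_of_real (exp (- u\<^sup>2 * (s - r) / 2)) * (\<integral>\<omega>. complex_of_real (f r n \<omega>) * complex_of_real (indicator A \<omega>) \<partial>M)" for n
  proof -
    have "(\<integral>\<omega>. complex_of_real (f s n \<omega>) * (complex_of_real (indicator A \<omega>) * iexp (u * (S s n \<omega> - S r n \<omega>))) \<partial>M)
        = (\<integral>\<omega>. complex_of_real (indicator A \<omega> * f s n \<omega>) * iexp (u * (S s n \<omega> - S r n \<omega>)) \<partial>M)"
      by (simp only: of_real_mult ac_simps)
    also have "\<dots> = complex_of_real (exp (- u\<^sup>2 * (s - r) / 2) * (\<integral>\<omega>. indicator A \<omega> * f r n \<omega> \<partial>M))"
      unfolding f_def S_def by (rule simple_density_char[OF simple t(1) rs A])
    also have "\<dots> = complex_of_real (exp (- u\<^sup>2 * (s - r) / 2)) * (\<integral>\<omega>. complex_of_real (indicator A \<omega> * f r n \<omega>) \<partial>M)"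
      by (simp only: of_real_mult[symmetric] integral_complex_of_real)
    finally show ?thesis by (simp only: of_real_mult mult.commute[of "complex_of_real (indicator A _)"])
  qed
  have lim_r: "(\<lambda>n. complex_of_real (exp (- u\<^sup>2 * (s - r) / 2)) * (\<integral>\<omega>. complex_of_real (f r n \<omega>) * complex_of_real (indicator A \<omega>) \<partial>M))
     \<longlonglongrightarrow> complex_of_real (exp (- u\<^sup>2 * (s - r) / 2)) * (\<integral>\<omega>. complex_of_real (Z r \<omega>) * complex_of_real (indicator A \<omega>) \<partial>M)"
    by (intro tendsto_mult tendsto_const Scheffe_integral_limit[OF fi(1)[OF r] Z_integrable(1)[OF r] f0 fi(2)[OF r] flim])
      (auto split: split_indicator)
  have "(\<integral>\<omega>. complex_of_real (Z s \<omega>) * (complex_of_real (indicator A \<omega>) * iexp (u * ((X s \<omega> - X r \<omega>) / \<sigma>))) \<partial>M)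
     = complex_of_real (exp (- u\<^sup>2 * (s - r) / 2)) * (\<integral>\<omega>. complex_of_real (Z r \<omega>) * complex_of_real (indicator A \<omega>) \<partial>M)"
    by (rule LIMSEQ_unique[OF lim_s[unfolded char_n] lim_r])
  also have "(\<integral>\<omega>. complex_of_real (Z r \<omega>) * complex_of_real (indicator A \<omega>) \<partial>M) = complex_of_real (\<integral>\<omega>. indicator A \<omega> * Z r \<omega> \<partial>M)"
    unfolding integral_complex_of_real[symmetric] by (simp only: of_real_mult mult.commute)
  finally show ?thesis by (simp only: of_real_mult)
qed

lemma Z_martingale:
  assumes rs: "t \<le> r" "r \<le> s" "s \<le> T" and A: "A \<in> sets (F r)"
  shows "(\<integral>\<omega>. indicator A \<omega> * Z s \<omega> \<partial>M) = (\<integral>\<omega>. indicator A \<omega> * Z r \<omega> \<partial>M)"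
proof -
  have "(\<integral>\<omega>. complex_of_real (indicator A \<omega> * Z s \<omega>) \<partial>M) = complex_of_real (\<integral>\<omega>. indicator A \<omega> * Z r \<omega> \<partial>M)"
    using Z_char[OF assms, of 0] by (simp add: mult.commute)
  then show ?thesis unfolding integral_complex_of_real of_real_eq_iff .
qed

end

section \<open>Gaussian law and independence from characteristic functions\<close>

lemma char_normal:
  assumes "0 < h"
  shows "char (density lborel (normal_density 0 (sqrt h))) u = complex_of_real (exp (- u\<^sup>2 * h / 2))"
proof -
  define N where "N = density lborel (normal_density 0 (sqrt h))"
  define E where "E = complex_of_real (exp (u\<^sup>2 * h / 2))"
  \<comment> \<open>The Gaussian integral at \<xi> = 0, with - u for u because its exponent carries
    - \<zeta> y.\<close>
  have "exp (- (complex_of_real 0 + \<i> * complex_of_real (- u)) * complex_of_real y - (complex_of_real 0 + \<i> * complex_of_real (- u))\<^sup>2 / 2 * complex_of_real h)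
      = E * iexp (u * y)" for y
    unfolding E_def exp_of_real[symmetric] exp_add[symmetric]
    by (rule arg_cong[where f = exp]) (simp add: power2_eq_square field_simps)
  then have "has_bochner_integral N (\<lambda>y. E * iexp (u * y)) 1"
    using gaussian_exponential_martingale[OF assms, of 0 "- u"] unfolding N_def by simp
  then have "E * char N u = 1"
    unfolding char_def using has_bochner_integral_integral_eq integral_mult_right_zero by metis
  moreover have "E * complex_of_real (exp (- u\<^sup>2 * h / 2)) = 1"
    unfolding E_def of_real_mult[symmetric] exp_add[symmetric] by simp
  moreover have "E \<noteq> 0" unfolding E_def by simp
  ultimately show ?thesis unfolding N_def by (metis mult_left_cancel)
qed

lemma (in prob_space) distr_eq_normal:
  assumes D[measurable]: "D \<in> borel_measurable M" and h: "0 < h"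
    and char: "\<And>u. (\<integral>\<omega>. iexp (u * D \<omega>) \<partial>M) = complex_of_real (exp (- u\<^sup>2 * h / 2))"
  shows "distr M borel D = density lborel (normal_density 0 (sqrt h))"
proof (rule Levy_uniqueness)
  show "real_distribution (distr M borel D)" by (rule real_distribution_distr[OF D])
  interpret N: prob_space "density lborel (normal_density 0 (sqrt h))"
    using h by (intro prob_space_normal_density) simp
  show "real_distribution (density lborel (normal_density 0 (sqrt h)))"
    by unfold_locales auto
  show "char (distr M borel D) = char (density lborel (normal_density 0 (sqrt h)))"
  proof
    fix u
    have "char (distr M borel D) u = (\<integral>\<omega>. iexp (u * D \<omega>) \<partial>M)"
      unfolding char_def by (rule integral_distr) auto
    then show "char (distr M borel D) u = char (density lborel (normal_density 0 (sqrt h))) u"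
      using char char_normal[OF h] by simp
  qed
qed

text \<open>Conditioning on A leaves the characteristic function of D unchanged, hence also its law
  by uniqueness, and that is independence of A. An event of probability zero cannot be conditioned
  on and is trivial.\<close>

lemma (in prob_space) normal_independent_of_event:
  assumes D[measurable]: "D \<in> borel_measurable M" and h: "0 < h" and A[measurable]: "A \<in> sets M"
    and char: "\<And>u. (\<integral>\<omega>. complex_of_real (indicator A \<omega>) * iexp (u * D \<omega>) \<partial>M) = complex_of_real (exp (- u\<^sup>2 * h / 2) * prob A)"
    and B: "B \<in> sets borel"
  shows "prob (A \<inter> (D -` B \<inter> space M)) = prob A * measure (density lborel (normal_density 0 (sqrt h))) B"
proof (cases "prob A = 0")
  case True
  have "prob (A \<inter> (D -` B \<inter> space M)) \<le> prob A" by (rule finite_measure_mono) auto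
  then show ?thesis using True measure_nonneg[of M "A \<inter> (D -` B \<inter> space M)"] by simp
next
  case False
  then have pA: "0 < prob A" using measure_nonneg[of M A] by linarith
  define P where "P = density M (\<lambda>\<omega>. ennreal (indicator A \<omega> / prob A))"
  have [measurable]: "(\<lambda>\<omega>. indicator A \<omega> / prob A) \<in> borel_measurable M" by measurable
  have em: "emeasure P S = ennreal (prob (A \<inter> S) / prob A)" if S: "S \<in> sets M" for S
  proof -
    have "emeasure P S = (\<integral>\<^sup>+\<omega>. ennreal (indicator A \<omega> / prob A) * indicator S \<omega> \<partial>M)"
      unfolding P_def using S by (intro emeasure_density) auto
    also have "\<dots> = (\<integral>\<^sup>+\<omega>. ennreal (1 / prob A) * indicator (A \<inter> S) \<omega> \<partial>M)"
      by (intro nn_integral_cong) (auto split: split_indicator)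
    also have "\<dots> = ennreal (1 / prob A) * emeasure M (A \<inter> S)"
      using S by (intro nn_integral_cmult_indicator) auto
    also have "\<dots> = ennreal (prob (A \<inter> S) / prob A)"
      using pA by (simp add: emeasure_eq_measure ennreal_mult[symmetric])
    finally show ?thesis .
  qed
  interpret P: prob_space P
  proof
    have "A \<inter> space M = A" using sets.sets_into_space[OF A] by auto
    then show "emeasure P (space P) = 1"
      using em[OF sets.top] pA unfolding P_def by simp
  qed
  have DP: "D \<in> borel_measurable P" unfolding P_def by simp
  have "distr P borel D = density lborel (normal_density 0 (sqrt h))"
  proof (rule P.distr_eq_normal[OF DP h])
    fix u
    have "(\<integral>\<omega>. iexp (u * D \<omega>) \<partial>P) = (\<integral>\<omega>. (indicator A \<omega> / prob A) *\<^sub>R iexp (u * D \<omega>) \<partial>M)"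
      unfolding P_def using pA by (intro integral_density) auto
    also have "\<dots> = (\<integral>\<omega>. complex_of_real (1 / prob A) * (complex_of_real (indicator A \<omega>) * iexp (u * D \<omega>)) \<partial>M)"
      by (intro Bochner_Integration.integral_cong) (auto simp: scaleR_conv_of_real)
    also have "\<dots> = complex_of_real (1 / prob A) * complex_of_real (exp (- u\<^sup>2 * h / 2) * prob A)"
      unfolding char[symmetric] by (rule integral_mult_right_zero)
    also have "\<dots> = complex_of_real (exp (- u\<^sup>2 * h / 2))"
      unfolding of_real_mult[symmetric] using pA by simp
    finally show "(\<integral>\<omega>. iexp (u * D \<omega>) \<partial>P) = complex_of_real (exp (- u\<^sup>2 * h / 2))" .
  qed
  then have "measure (density lborel (normal_density 0 (sqrt h))) B = measure (distr P borel D) B" by simp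
  also have "\<dots> = measure P (D -` B \<inter> space M)"
    using B DP by (subst measure_distr) (auto simp: P_def)
  also have "\<dots> = prob (A \<inter> (D -` B \<inter> space M)) / prob A"
    using B pA em[of "D -` B \<inter> space M"] measurable_sets[OF D B] by (simp add: measure_def)
  finally show ?thesis using pA by simp
qed

section \<open>The change of measure\<close>

text \<open>A property that holds almost surely need not be measurable with respect to
  \<open>F s\<close>, but its exceptional set is contained in a null set of M, and such null sets
  lie in \<open>F 0\<close>.\<close>

lemma (in usual_filtered_prob_space) AE_restr_F:
  assumes "AE \<omega> in M. P \<omega>" "0 \<le> s"
  shows "AE \<omega> in restr_to_subalg M (F s). P \<omega>"
proof -
  obtain N where N: "\<And>\<omega>. \<omega> \<in> space M - N \<Longrightarrow> P \<omega>" "N \<in> null_sets M"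
    using AE_E3[OF assms(1)] by metis
  have "N \<in> sets (F s)" using N(2) null_sets_F0 sets_F_mono[of 0 s] assms(2) by (auto simp: max_def)
  then have "N \<in> null_sets (restr_to_subalg M (F s))"
    using N(2) null_sets_restr_to_subalg[OF subalgebra_F[OF assms(2)]] by simp
  then show ?thesis
    by (rule AE_I') (use N(1) in \<open>auto simp: space_restr_to_subalg\<close>)
qed

context ito_approximation
begin

abbreviation "Q \<equiv> measure_change M F T Z"

lemma space_measure_change: "space (measure_change M F s Z) = space M"
  unfolding measure_change_def by (simp add: space_restr_to_subalg)

lemma sets_measure_change: "0 \<le> s \<Longrightarrow> sets (measure_change M F s Z) = sets (F s)"
  unfolding measure_change_def by (simp add: sets_restr_to_subalg subalgebra_F)

lemma Z_measurable_restr: "s \<in> {t..T} \<Longrightarrow> Z s \<in> borel_measurable (restr_to_subalg M (F s))"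
  using measurable_in_subalg[OF subalgebra_F Z_measurable_F, of s] t by simp

lemma emeasure_measure_change:
  assumes s: "s \<in> {t..T}" and A: "A \<in> sets (F s)"
  shows "emeasure (measure_change M F s Z) A = ennreal (\<integral>\<omega>. indicator A \<omega> * Z s \<omega> \<partial>M)"
proof -
  have s0: "0 \<le> s" using s t by simp
  have [measurable]: "Z s \<in> borel_measurable (F s)" "A \<in> sets (F s)" using Z_measurable_F[OF s] A by auto
  have AM: "A \<in> sets M" using A sets_F_subset[OF s0] by auto
  have "emeasure (measure_change M F s Z) A = (\<integral>\<^sup>+\<omega>. ennreal (Z s \<omega>) * indicator A \<omega> \<partial>restr_to_subalg M (F s))"
    unfolding measure_change_def using Z_measurable_restr[OF s] A sets_restr_to_subalg[OF subalgebra_F[OF s0]]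
    by (intro emeasure_density) auto
  also have "\<dots> = (\<integral>\<^sup>+\<omega>. ennreal (Z s \<omega>) * indicator A \<omega> \<partial>M)"
    by (rule nn_integral_subalgebra2[OF subalgebra_F[OF s0]]) measurable
  also have "\<dots> = (\<integral>\<^sup>+\<omega>. ennreal (indicator A \<omega> * Z s \<omega>) \<partial>M)"
    by (intro nn_integral_cong) (auto split: split_indicator)
  also have "\<dots> = ennreal (\<integral>\<omega>. indicator A \<omega> * Z s \<omega> \<partial>M)"
    using integrable_indicator_times[OF AM Z_integrable(1)[OF s]] Z_pos[of s]
    by (intro nn_integral_eq_integral) (auto simp: less_imp_le)
  finally show ?thesis .
qed

lemma measure_measure_change:
  assumes s: "s \<in> {t..T}" and A: "A \<in> sets (F s)"
  shows "measure (measure_change M F s Z) A = (\<integral>\<omega>. indicator A \<omega> * Z s \<omega> \<partial>M)"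
  unfolding measure_def emeasure_measure_change[OF assms]
  using Z_pos[of s] by (intro enn2real_ennreal integral_nonneg_AE) (auto simp: less_imp_le)

lemma prob_space_measure_change:
  assumes s: "s \<in> {t..T}"
  shows "prob_space (measure_change M F s Z)"
proof
  have s0: "0 \<le> s" using s t by simp
  have "emeasure (measure_change M F s Z) (space M) = ennreal (\<integral>\<omega>. indicator (space M) \<omega> * Z s \<omega> \<partial>M)"
    by (rule emeasure_measure_change[OF s]) (use space_F[OF s0] sets.top[of "F s"] in simp)
  also have "(\<integral>\<omega>. indicator (space M) \<omega> * Z s \<omega> \<partial>M) = (\<integral>\<omega>. Z s \<omega> \<partial>M)"
    by (intro Bochner_Integration.integral_cong) auto
  finally show "emeasure (measure_change M F s Z) (space (measure_change M F s Z)) = 1"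
    using Z_expectation[OF s] by (simp add: space_measure_change)
qed

lemma subalgebra_Q:
  assumes s: "s \<in> {t..T}"
  shows "subalgebra Q (F s)"
proof -
  have s0: "0 \<le> s" "0 \<le> T" "s \<le> T" using s t by auto
  show ?thesis
    unfolding subalgebra_def
    using space_F[OF s0(1)] space_measure_change[of T] sets_measure_change[OF s0(2)] sets_F_mono[OF s0(1,3)] by simp
qed

text \<open>Consistency of the densities at different times is the martingale property of Z tested
  on the events of \<open>F s\<close>.\<close>

lemma restr_Q:
  assumes s: "s \<in> {t..T}"
  shows "restr_to_subalg Q (F s) = measure_change M F s Z"
proof (rule measure_eqI)
  have s0: "0 \<le> s" "s \<le> T" using s t by auto
  show "sets (restr_to_subalg Q (F s)) = sets (measure_change M F s Z)"
    using sets_restr_to_subalg[OF subalgebra_Q[OF s]] sets_measure_change[OF s0(1)] by simp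
  fix A assume "A \<in> sets (restr_to_subalg Q (F s))"
  then have A: "A \<in> sets (F s)" using sets_restr_to_subalg[OF subalgebra_Q[OF s]] by simp
  then have AT: "A \<in> sets (F T)" using sets_F_mono[OF s0] by auto
  have "emeasure (restr_to_subalg Q (F s)) A = emeasure Q A"
    by (rule emeasure_restr_to_subalg[OF subalgebra_Q[OF s] A])
  also have "\<dots> = ennreal (\<integral>\<omega>. indicator A \<omega> * Z T \<omega> \<partial>M)"
    by (rule emeasure_measure_change[OF _ AT]) (use t in simp)
  also have "(\<integral>\<omega>. indicator A \<omega> * Z T \<omega> \<partial>M) = (\<integral>\<omega>. indicator A \<omega> * Z s \<omega> \<partial>M)"
    by (rule Z_martingale[OF _ s0(2) order_refl A]) (use s in simp)
  also have "ennreal \<dots> = emeasure (measure_change M F s Z) A"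
    by (rule emeasure_measure_change[OF s A, symmetric])
  finally show "emeasure (restr_to_subalg Q (F s)) A = emeasure (measure_change M F s Z) A" .
qed

lemma AE_Q:
  assumes "AE \<omega> in M. P \<omega>"
  shows "AE \<omega> in Q. P \<omega>"
proof -
  have T: "T \<in> {t..T}" "0 \<le> T" using t by auto
  show ?thesis
    unfolding measure_change_def
    using AE_restr_F[OF assms T(2)] Z_measurable_restr[OF T(1)] by (subst AE_density) auto
qed

lemma equivalent_Q:
  "absolutely_continuous (restr_to_subalg M (F T)) Q"
  "absolutely_continuous Q (restr_to_subalg M (F T))"
proof -
  have T: "T \<in> {t..T}" using t by auto
  have [measurable]: "(\<lambda>\<omega>. ennreal (Z T \<omega>)) \<in> borel_measurable (restr_to_subalg M (F T))"
    using Z_measurable_restr[OF T] by measurable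
  show "absolutely_continuous (restr_to_subalg M (F T)) Q"
    unfolding measure_change_def by (rule absolutely_continuousI_density) measurable
  show "absolutely_continuous Q (restr_to_subalg M (F T))"
    unfolding absolutely_continuous_def
  proof
    fix A assume "A \<in> null_sets Q"
    then have A: "A \<in> sets (restr_to_subalg M (F T))"
      and ae: "AE \<omega> in restr_to_subalg M (F T). \<omega> \<in> A \<longrightarrow> ennreal (Z T \<omega>) = 0"
      unfolding measure_change_def by (auto simp: null_sets_density_iff)
    from ae have "AE \<omega> in restr_to_subalg M (F T). \<omega> \<notin> A"
    proof eventually_elim
      case (elim \<omega>)
      then show ?case using Z_pos[of T \<omega>] by (auto simp: ennreal_eq_0_iff)
    qed
    then show "A \<in> null_sets (restr_to_subalg M (F T))" using Measure_Space.AE_iff_null_sets[OF A] by blast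
  qed
qed

text \<open>Formulated for the measure with density \<open>Z s\<close> at the later time, the form
  in which \<open>Z_char\<close> supplies it; \<open>restr_Q\<close> later carries it over to
  \<open>Q\<close>.\<close>

lemma increment_char:
  assumes rs: "t \<le> r" "r \<le> s" "s \<le> T" and A: "A \<in> sets (F r)"
  shows "(\<integral>\<omega>. complex_of_real (indicator A \<omega>) * iexp (u * ((X s \<omega> - X r \<omega>) / \<sigma>)) \<partial>measure_change M F s Z)
    = complex_of_real (exp (- u\<^sup>2 * (s - r) / 2) * measure (measure_change M F s Z) A)"
proof -
  have s: "s \<in> {t..T}" and r: "r \<in> {t..T}" and s0: "0 \<le> s" "0 \<le> r" using rs t by auto
  have As: "A \<in> sets (F s)" using A sets_F_mono[OF s0(2) rs(2)] by auto
  have [measurable]: "X s \<in> borel_measurable (F s)" "X r \<in> borel_measurable (F s)" "A \<in> sets (F s)" "Z s \<in> borel_measurable (F s)"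
    using X_meas[of s] measurable_F_mono[OF X_meas[of r] s0(2) rs(2)] As Z_measurable_F[OF s] rs by auto
  define f where "f \<omega> = complex_of_real (indicator A \<omega>) * iexp (u * ((X s \<omega> - X r \<omega>) / \<sigma>))" for \<omega>
  have fm: "f \<in> borel_measurable (F s)" unfolding f_def by measurable
  have "(\<integral>\<omega>. f \<omega> \<partial>measure_change M F s Z) = (\<integral>\<omega>. Z s \<omega> *\<^sub>R f \<omega> \<partial>restr_to_subalg M (F s))"
    unfolding measure_change_def
    by (rule integral_density)
      (use measurable_in_subalg[OF subalgebra_F[OF s0(1)] fm] Z_measurable_restr[OF s] Z_pos[of s] in \<open>auto simp: less_imp_le\<close>)
  also have "\<dots> = (\<integral>\<omega>. Z s \<omega> *\<^sub>R f \<omega> \<partial>M)"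
    by (rule integral_subalgebra2[OF subalgebra_F[OF s0(1)]]) (use fm in measurable)
  also have "\<dots> = complex_of_real (exp (- u\<^sup>2 * (s - r) / 2) * (\<integral>\<omega>. indicator A \<omega> * Z r \<omega> \<partial>M))"
    unfolding f_def scaleR_conv_of_real by (rule Z_char[OF rs A])
  also have "(\<integral>\<omega>. indicator A \<omega> * Z r \<omega> \<partial>M) = measure (measure_change M F s Z) A"
    unfolding measure_measure_change[OF s As] by (rule Z_martingale[OF rs A, symmetric])
  finally show ?thesis unfolding f_def .
qed

text \<open>One identity with two uses: A = \<open>space M\<close> yields the normal law of the
  increment, and general A its independence of \<open>F r\<close>.\<close>

lemma increment_law:
  assumes rs: "t \<le> r" "r < s" "s \<le> T" and A: "A \<in> sets (F r)" and B: "B \<in> sets borel"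
  shows "measure Q (A \<inter> ((\<lambda>\<omega>. (X s \<omega> - X r \<omega>) / \<sigma>) -` B \<inter> space M))
    = measure Q A * measure (density lborel (normal_density 0 (sqrt (s - r)))) B"
proof -
  define D where "D \<omega> = (X s \<omega> - X r \<omega>) / \<sigma>" for \<omega>
  have s: "s \<in> {t..T}" and rs': "r \<le> s" and s0: "0 \<le> s" "0 \<le> r" using rs t by auto
  interpret Qs: prob_space "measure_change M F s Z" by (rule prob_space_measure_change[OF s])
  have As: "A \<in> sets (F s)" using A sets_F_mono[OF s0(2) rs'] by auto
  have [measurable]: "X s \<in> borel_measurable (F s)" "X r \<in> borel_measurable (F s)"
    using X_meas[of s] measurable_F_mono[OF X_meas[of r] s0(2) rs'] rs by auto
  have DF: "D \<in> borel_measurable (F s)" unfolding D_def by measurable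
  then have Dm: "D \<in> borel_measurable (measure_change M F s Z)"
    using measurable_cong_sets[OF sets_measure_change[OF s0(1)] refl] by blast
  have e: "A \<inter> (D -` B \<inter> space M) \<in> sets (F s)"
    using As measurable_sets[OF DF B] space_F[OF s0(1)] by auto
  have eqQ: "measure Q S = measure (measure_change M F s Z) S" if "S \<in> sets (F s)" for S
    unfolding measure_def restr_Q[OF s, symmetric] emeasure_restr_to_subalg[OF subalgebra_Q[OF s] that] ..
  have "measure (measure_change M F s Z) (A \<inter> (D -` B \<inter> space (measure_change M F s Z)))
    = measure (measure_change M F s Z) A * measure (density lborel (normal_density 0 (sqrt (s - r)))) B"
  proof (rule Qs.normal_independent_of_event[OF Dm _ _ _ B])
    show "0 < s - r" using rs by simp
    show "A \<in> sets (measure_change M F s Z)" using As sets_measure_change[OF s0(1)] by simp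
    fix u
    show "(\<integral>\<omega>. complex_of_real (indicator A \<omega>) * iexp (u * D \<omega>) \<partial>measure_change M F s Z)
      = complex_of_real (exp (- u\<^sup>2 * (s - r) / 2) * measure (measure_change M F s Z) A)"
      unfolding D_def by (rule increment_char[OF rs(1) rs' rs(3) A])
  qed
  then show ?thesis unfolding space_measure_change eqQ[OF As] eqQ[OF e, unfolded D_def] D_def .
qed

text \<open>By the equation for X this process agrees almost surely with W plus the integral of
  \<open>\<eta> (X)\<close>, both counted from t. In terms of X its adaptedness and continuity are
  immediate.\<close>

lemma brownian_motion_Q: "brownian_motion Q F t {t..T} (\<lambda>s \<omega>. (X s \<omega> - x) / \<sigma>)"
  unfolding brownian_motion_def
proof (intro conjI ballI impI)
  have T: "T \<in> {t..T}" using t by auto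
  interpret Q: prob_space Q by (rule prob_space_measure_change[OF T])
  show "(\<lambda>\<omega>. (X s \<omega> - x) / \<sigma>) \<in> borel_measurable (F s)" if "s \<in> {t..T}" for s
    using X_meas[of s] that by (intro borel_measurable_divide borel_measurable_diff) auto
  show "AE \<omega> in Q. (X t \<omega> - x) / \<sigma> = 0"
  proof (rule AE_Q)
    show "AE \<omega> in M. (X t \<omega> - x) / \<sigma> = 0" using X_path
    proof eventually_elim
      case (elim \<omega>)
      have "X t \<omega> = x + \<sigma> * (W t \<omega> - W t \<omega> + (LBINT r:{t..t}. \<eta> (X r \<omega>)))"
        by (rule bspec[OF conjunct2[OF elim]]) (use t in simp)
      then show ?case by (simp add: set_integral_point)
    qed
  qed
  show "AE \<omega> in Q. continuous_on {t..T} (\<lambda>s. (X s \<omega> - x) / \<sigma>)"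
  proof (rule AE_Q)
    show "AE \<omega> in M. continuous_on {t..T} (\<lambda>s. (X s \<omega> - x) / \<sigma>)"
      using X_path
    proof eventually_elim
      case (elim \<omega>)
      then have "continuous_on {t..T} (\<lambda>s. X s \<omega>)" by blast
      then show ?case using sig by (intro continuous_intros) auto
    qed
  qed
  fix r s assume rs: "r \<in> {t..T}" "s \<in> {t..T}" "r < s"
  then have rs': "t \<le> r" "r < s" "s \<le> T" and s0: "0 \<le> s" "0 \<le> r" "0 \<le> T" using t by auto
  define D where "D \<omega> = (X s \<omega> - x) / \<sigma> - (X r \<omega> - x) / \<sigma>" for \<omega>
  have Deq: "D = (\<lambda>\<omega>. (X s \<omega> - X r \<omega>) / \<sigma>)" unfolding D_def by (auto simp: diff_divide_distrib)
  note law = increment_law[OF rs', folded Deq]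
  have [measurable]: "X s \<in> borel_measurable (F T)" "X r \<in> borel_measurable (F T)"
    using measurable_F_mono[OF X_meas[of s] s0(1) rs'(3)] measurable_F_mono[OF X_meas[of r] s0(2), of T] rs by auto
  have "D \<in> borel_measurable (F T)" unfolding D_def by measurable
  then have Dm: "D \<in> borel_measurable Q"
    using measurable_cong_sets[OF sets_measure_change[OF s0(3)] refl] by blast
  interpret N: prob_space "density lborel (normal_density 0 (sqrt (s - r)))"
    using rs by (intro prob_space_normal_density) simp
  have "space M \<in> sets (F r)" using sets.top[of "F r"] space_F[OF s0(2)] by simp
  note lawD = law[OF this]
  have prob1: "measure Q (space M) = 1" using Q.prob_space by (simp add: space_measure_change)
  have law1: "measure Q (D -` B \<inter> space M) = measure (density lborel (normal_density 0 (sqrt (s - r)))) B"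
    if "B \<in> sets borel" for B
  proof -
    have "space M \<inter> (D -` B \<inter> space M) = D -` B \<inter> space M" by auto
    then show ?thesis using lawD[OF that] prob1 by simp
  qed
  have "distr Q lborel D = density lborel (normal_density 0 (sqrt (s - r)))"
  proof (rule measure_eqI)
    fix B assume "B \<in> sets (distr Q lborel D)"
    then have B: "B \<in> sets borel" by simp
    have "emeasure (distr Q lborel D) B = emeasure Q (D -` B \<inter> space M)"
      using B Dm by (subst emeasure_distr) (auto simp: space_measure_change)
    also have "\<dots> = emeasure (density lborel (normal_density 0 (sqrt (s - r)))) B"
      by (simp add: Q.emeasure_eq_measure N.emeasure_eq_measure law1[OF B])
    finally show "emeasure (distr Q lborel D) B = emeasure (density lborel (normal_density 0 (sqrt (s - r)))) B" .
  qed simp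
  then have "distributed Q lborel D (normal_density 0 (sqrt (s - r)))"
    unfolding distributed_def using Dm by simp
  then show "distributed Q lborel (\<lambda>\<omega>. (X s \<omega> - x) / \<sigma> - (X r \<omega> - x) / \<sigma>) (normal_density 0 (sqrt (s - r)))"
    unfolding D_def .
  have "Q.indep_set (sets (F r)) {D -` A \<inter> space Q | A. A \<in> sets borel}"
  proof (rule Q.indep_setI)
    show "sets (F r) \<subseteq> sets Q" using subalgebra_Q[OF rs(1)] unfolding subalgebra_def by simp
    show "{D -` A \<inter> space Q | A. A \<in> sets borel} \<subseteq> sets Q" using measurable_sets[OF Dm] by auto
    fix A S assume A: "A \<in> sets (F r)" and "S \<in> {D -` A \<inter> space Q | A. A \<in> sets borel}"
    then obtain B where B: "B \<in> sets borel" "S = D -` B \<inter> space M" by (auto simp: space_measure_change)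
    show "Q.prob (A \<inter> S) = Q.prob A * Q.prob S"
      unfolding B(2) law[OF A B(1)] law1[OF B(1)] ..
  qed
  then show "Q.indep_set (sets (F r)) {(\<lambda>\<omega>. (X s \<omega> - x) / \<sigma> - (X r \<omega> - x) / \<sigma>) -` A \<inter> space Q | A. A \<in> sets borel}"
    unfolding D_def .
qed

lemma martingale_Z: "martingale M F {t..T} Z"
  unfolding martingale_def
proof (intro conjI ballI impI)
  fix r s assume rs: "r \<in> {t..T}" "s \<in> {t..T}" "r \<le> s"
  then have r0: "0 \<le> r" using t by simp
  interpret finite_measure_subalgebra M "F r"
    by unfold_locales (rule subalgebra_F[OF r0])
  show "AE \<omega> in M. real_cond_exp M (F r) (Z s) \<omega> = Z r \<omega>"
  proof (rule real_cond_exp_charact)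
    fix A assume "A \<in> sets (F r)"
    then show "(\<integral>\<omega>\<in>A. Z s \<omega> \<partial>M) = (\<integral>\<omega>\<in>A. Z r \<omega> \<partial>M)"
      using Z_martingale[of r s A] rs unfolding set_lebesgue_integral_def by simp
  qed (use rs Z_integrable(1) Z_measurable_F in auto)
qed (use Z_integrable(1) Z_measurable_F in auto)

end

theorem theorem2p5:
  fixes M :: "'a measure" and F :: "real \<Rightarrow> 'a measure"
    and W X I :: "real \<Rightarrow> 'a \<Rightarrow> real"
    and lam :: "real \<Rightarrow> real" and \<sigma> t T x :: real
  assumes "usual_filtered_prob_space M F"
    and "brownian_motion M F 0 {0..} W"
    and "\<sigma> > 0" and "lam \<in> class_D"
    and "0 \<le> t" and "t \<le> T"
    and "sde_solution M F W lam \<sigma> t x {t..} X"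
    and "is_ito_integral M F W t T (\<lambda>r \<omega>. lam (X r \<omega>) / \<sigma>) I"
  shows "let Z = exp_density (\<lambda>y. lam y / \<sigma>) X I t;
             P = restr_to_subalg M (F T);
             Q = measure_change M F T Z
         in martingale M F {t..T} Z \<and>
            (\<integral>\<omega>. Z T \<omega> \<partial>M) = 1 \<and>
            (AE \<omega> in M. Z T \<omega> > 0) \<and>
            prob_space Q \<and>
            absolutely_continuous P Q \<and> absolutely_continuous Q P \<and>
            (\<forall>s\<in>{t..T}. restr_to_subalg Q (F s) = measure_change M F s Z) \<and>
            (\<exists>WQ. brownian_motion Q F t {t..T} WQ \<and>
                  sde_solution Q F WQ (\<lambda>_. 0) \<sigma> t x {t..T} X \<and>
                  (AE \<omega> in Q. \<forall>s\<in>{t..T}. X s \<omega> = x + \<sigma> * WQ s \<omega>))"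
proof -
  interpret U: usual_filtered_prob_space M F by fact
  define \<eta> where "\<eta> y = lam y / \<sigma>" for y
  obtain k a \<xi> where
    sd: "\<And>n. simple_data F t T (k n) (a n) (\<xi> n)" and
    L2: "converges_in_prob M
          (\<lambda>n \<omega>. LBINT r:{t..T}. (simple_process (k n) (a n) (\<xi> n) r \<omega> - lam (X r \<omega>) / \<sigma>)\<^sup>2) (\<lambda>_. 0)" and
    conv: "\<And>s. s \<in> {t..T} \<Longrightarrow> converges_in_prob M (\<lambda>n. simple_integral W (k n) (a n) (\<xi> n) s) (I s)"
    using assms(8) unfolding is_ito_integral_def by blast
  have lam: "continuous_on UNIV lam"
    using assms(4) unfolding class_D_def by (auto intro: C1_differentiable_imp_continuous_on)
  have sde: "AE \<omega> in M. continuous_on {t..} (\<lambda>s. X s \<omega>)"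
    "AE \<omega> in M. \<forall>s\<in>{t..}. X s \<omega> = x + (LBINT r:{t..s}. lam (X r \<omega>)) + \<sigma> * (W s \<omega> - W t \<omega>)"
    "\<And>s. t \<le> s \<Longrightarrow> X s \<in> borel_measurable (F s)"
    using assms(7) unfolding sde_solution_def by auto
  have path: "AE \<omega> in M. continuous_on {t..T} (\<lambda>s. X s \<omega>) \<and>
       (\<forall>s\<in>{t..T}. X s \<omega> = x + \<sigma> * (W s \<omega> - W t \<omega> + (LBINT r:{t..s}. \<eta> (X r \<omega>))))"
    using sde(1,2)
  proof eventually_elim
    case (elim \<omega>)
    have "X s \<omega> = x + \<sigma> * (W s \<omega> - W t \<omega> + (LBINT r:{t..s}. \<eta> (X r \<omega>)))" if s: "s \<in> {t..T}" for s
    proof -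
      have "(LBINT r:{t..s}. lam (X r \<omega>)) = \<sigma> * (LBINT r:{t..s}. \<eta> (X r \<omega>))"
        unfolding \<eta>_def using assms(3) by simp
      moreover have "X s \<omega> = x + (LBINT r:{t..s}. lam (X r \<omega>)) + \<sigma> * (W s \<omega> - W t \<omega>)"
        using elim(2) s by (meson atLeastAtMost_iff atLeast_iff)
      ultimately show ?thesis by (simp only: distrib_left add.assoc add.commute[of "\<sigma> * (W s \<omega> - W t \<omega>)"])
    qed
    moreover have "continuous_on {t..T} (\<lambda>s. X s \<omega>)"
      by (rule continuous_on_subset[OF elim(1)]) auto
    ultimately show ?case by blast
  qed
  interpret ito_approximation M F W \<sigma> x t T \<eta> X I k a \<xi>
  proof unfold_locales
    show "continuous_on UNIV \<eta>" unfolding \<eta>_def using assms(3) by (intro continuous_intros lam) auto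
    show "converges_in_prob M (\<lambda>n \<omega>. LBINT r:{t..T}. (simple_process (k n) (a n) (\<xi> n) r \<omega> - \<eta> (X r \<omega>))\<^sup>2) (\<lambda>_. 0)"
      unfolding \<eta>_def by (rule L2)
  qed (fact assms sd conv sde(3) path)+
  have T: "T \<in> {t..T}" using assms(6) by simp
  \<comment> \<open>Defined by solving the desired equation for the noise, so that
    \<open>X s \<omega> = x + \<sigma> * WQ s \<omega>\<close> holds at every \<omega> and not just
    almost surely.\<close>
  define WQ where "WQ s \<omega> = (X s \<omega> - x) / \<sigma>" for s \<omega>
  have bm: "brownian_motion Q F t {t..T} WQ" unfolding WQ_def by (rule brownian_motion_Q)
  have X: "X s \<omega> = x + \<sigma> * WQ s \<omega>" for s \<omega> unfolding WQ_def using assms(3) by simp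
  have "sde_solution Q F WQ (\<lambda>_. 0) \<sigma> t x {t..T} X"
    unfolding sde_solution_def
  proof (intro conjI ballI)
    show "X s \<in> borel_measurable (F s)" if "s \<in> {t..T}" for s using sde(3) that by simp
    show "AE \<omega> in Q. continuous_on {t..T} (\<lambda>s. X s \<omega>)"
      by (rule AE_Q) (use path in \<open>eventually_elim, blast\<close>)
    have "AE \<omega> in Q. WQ t \<omega> = 0" using bm unfolding brownian_motion_def by blast
    then show "AE \<omega> in Q. \<forall>s\<in>{t..T}. X s \<omega> = x + (LBINT r:{t..s}. 0) + \<sigma> * (WQ s \<omega> - WQ t \<omega>)"
    proof eventually_elim
      case (elim \<omega>)
      then show ?case using X[of _ \<omega>] by (simp add: set_lebesgue_integral_def)
    qed
  qed
  with bm have ex: "\<exists>WQ. brownian_motion Q F t {t..T} WQ \<and> sde_solution Q F WQ (\<lambda>_. 0) \<sigma> t x {t..T} X \<and>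
      (AE \<omega> in Q. \<forall>s\<in>{t..T}. X s \<omega> = x + \<sigma> * WQ s \<omega>)"
    using X by (intro exI[of _ WQ]) auto
  have eta: "(\<lambda>y. lam y / \<sigma>) = \<eta>" unfolding \<eta>_def ..
  show ?thesis
    unfolding Let_def eta
    using martingale_Z Z_expectation[OF T] Z_pos prob_space_measure_change[OF T] equivalent_Q restr_Q ex by blast
qed

end
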